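(* Suppose that: (i) the problem $\min_{\theta\in\mathbb{R}^d}F(\theta)=\frac1m\sum_{i=1}^mf_i(\theta)$ has an optimal solution, $F$ is convex, and there is $L>0$ such that $\|\nabla f_i(u)-\nabla f_i(v)\|\le L\|u-v\|$ for all $i\in[m]$ and all $u,v\in\mathbb{R}^d$; (ii) the matrices $R,C\in\mathbb{R}^{m\times m}$ have nonnegative off-diagonal entries, the induced graphs $\mathcal{G}_R$ and $\mathcal{G}_{C^T}$ each contain at least one spanning tree, and at least one node is a root of spanning trees for both $\mathcal{G}_R$ and $\mathcal{G}_{C^T}$; (iii) for every $i\in[m]$, the noise sequences $\{\zeta_i^k\}$ and $\{\xi_i^k\}$ are zero-mean independent random variables, independent of $\{x_i^0;i\in[m]\}$; for every $k$, the noise collection $\{\zeta_j^k,\xi_j^k;j\in[m]\}$ is independent; the variances $(\sigma_{\zeta,i}^k)^2=\mathbb{E}[\|\zeta_i^k\|^2]$ and $(\sigma_{\xi,i}^k)^2=\mathbb{E}[\|\xi_i^k\|^2]$ satisfy $\sum_{k=0}^\infty(\gamma_1^k)^2\max_{i\in[m]}(\sigma_{\zeta,i}^k)^2<\infty$ and $\sum_{k=0}^\infty(\gamma_2^k)^2\max_{j\in[m]}(\sigma_{\xi,j}^k)^2<\infty$; and $\mathbb{E}[\|x_i^0\|^2]<\infty$ for all $i\in[m]$; (iv) there is a constant $C_0$ such that $\|\nabla f_i(x)\|_1\le C_0$ for all $x\in\mathbb{R}^d$ and $1\le i\le m$; (v) the nonnegative sequences $\{\gamma_1^k\},\{\gamma_2^k\},\{\alpha^k\},\{\lambda^k\}$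 satisfy $\sum_{k=0}^\infty\gamma_\imath^k=\infty$, $\sum_{k=0}^\infty(\gamma_\imath^k)^2<\infty$, $\sum_{k=0}^\infty\frac{(\lambda^k)^2}{\gamma_\imath^k}<\infty$, $\lim_{k\to\infty}\lambda^k/\gamma_\imath^k=0$ for $\imath\in\{1,2\}$, and $\sum_{k=0}^\infty\alpha^k=\infty$, $\sum_{k=0}^\infty\lambda^k=\infty$, $\lim_{k\to\infty}\lambda^k/\alpha^k<\infty$, $\sum_{k=0}^\infty\frac{(\alpha^k)^2}{\gamma_2^k}<\infty$, $\sum_{k=0}^\infty\frac{(\gamma_1^k)^2}{\gamma_2^k}<\infty$. Then for the iterates of Algorithm 2: (a) $\lim_{k\to\infty}F(\bar x^k)$ exists almost surely, and almost surely $\lim_{k\to\infty}\|x_i^k-\bar x^k\|=\lim_{k\to\infty}\|y_i^k-v_i\bar y^k\|=0$ for all $i\in[m]$. (b) $\liminf_{k\to\infty}\|\nabla F(\bar x^k)\|=0$ almost surely. Moreover, if $F$ has bounded level sets, then almost surely $\{\bar x^k\}$ is bounded, every accumulation point of $\{\bar x^k\}$ is an optimal solution, and $\lim_{k\to\infty}F(x_i^k)=F^*$ for all $i\in[m]$.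
   Context: There are $m$ agents, $[m]=\{1,\dots,m\}$; agent $i$ has a private differentiable function $f_i:\mathbb{R}^d\to\mathbb{R}$; $F^*=\min_{\theta\in\mathbb{R}^d}F(\theta)$. For a matrix $A$ with nonnegative off-diagonal entries, $\mathcal{G}_A$ is the directed graph on $[m]$ with an edge from $j$ to $i$ ($i\ne j$) if and only if $A_{ij}>0$; $\mathcal{G}_{A^T}$ is $\mathcal{G}_A$ with edge directions reversed. $\mathbb{N}_{A,i}^{\rm in}=\{j\ne i:A_{ij}>0\}$, $\mathbb{N}_{A,i}^{\rm out}=\{j\ne i:A_{ji}>0\}$. The diagonal entries are $R_{ii}=-\sum_{j\in\mathbb{N}_{R,i}^{\rm in}}R_{ij}$ and $C_{ii}=-\sum_{j\in\mathbb{N}_{C,i}^{\rm out}}C_{ji}$, so that $R$ has zero row sums and $C$ has zero column sums. Algorithm 2 (gradient-tracking method): parameters are stepsizes $\lambda^k,\alpha^k$ and weakening factors $\gamma_1^k>0$, $\gamma_2^k>0$ with $1+\gamma_1^kR_{ii}>0$ and $1+\gamma_2^kC_{ii}>0$ for all $i$. Every agent $i$ maintains $x_i^k,y_i^k\in\mathbb{R}^d$, initialized with a random $x_i^0\in\mathbb{R}^d$ and $y_i^0=\nabla f_i(x_i^0)$. For $k=0,1,2,\dots$, with noises $\zeta_j^k,\xi_j^k\in\mathbb{R}^d$, $$x_i^{k+1}=(1+\gamma_1^kR_{ii})x_i^k+\gamma_1^k\sum_{j\in\mathbb{N}_{R,i}^{\rm in}}R_{ij}(x_j^k+\zeta_j^k)-\lambda^ky_i^k,$$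 $$y_i^{k+1}=(1-\alpha^k+\gamma_2^kC_{ii})y_i^k+\gamma_2^k\sum_{j\in\mathbb{N}_{C,i}^{\rm in}}C_{ij}(y_j^k+\xi_j^k)+\nabla f_i(x_i^{k+1})-(1-\alpha^k)\nabla f_i(x_i^k).$$ The vector $u\in\mathbb{R}^m$ is the unique nonnegative vector with $u^T(I+\gamma_1^kR)=u^T$ (equivalently $u^TR=0$) and $u^T\mathbf{1}=m$; the vector $v\in\mathbb{R}^m$ is the unique nonnegative vector with $((1-\alpha^k)I+\gamma_2^kC)v=(1-\alpha^k)v$ (equivalently $Cv=0$) and $\mathbf{1}^Tv=m$. Define $\bar x^k=\frac1m\sum_{i=1}^mu_ix_i^k$ and $\bar y^k=\frac1m\sum_{i=1}^my_i^k$. *)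

theory Defs
  imports "HOL-Probability.Probability"
begin

definition gradient :: "('a::real_inner \<Rightarrow> real) \<Rightarrow> 'a \<Rightarrow> 'a" where
  "gradient f x = (THE D. GDERIV f x :> D)"

lemma gradient_eqI: "GDERIV f x :> D \<Longrightarrow> gradient f x = D"
proof -
  assume D: "GDERIV f x :> D"
  have "D' = D" if "GDERIV f x :> D'" for D'
  proof -
    have "(\<lambda>h. inner h D') = (\<lambda>h. inner h D)"
      using D that unfolding gderiv_def by (rule has_derivative_unique[rotated])
    then show ?thesis
      by (metis vector_eq_ldot)
  qed
  with D show ?thesis
    unfolding gradient_def by (intro the_equality)
qed

lemma GDERIV_gradient:
  fixes f :: "'a::euclidean_space \<Rightarrow> real"
  assumes "f differentiable (at x)"
  shows "GDERIV f x :> gradient f x"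
proof -
  obtain f' where f': "(f has_derivative f') (at x)"
    using assms unfolding differentiable_def by blast
  have "f' h = inner h (\<Sum>b\<in>Basis. f' b *\<^sub>R b)" for h
  proof -
    interpret bounded_linear f' using f' by (rule has_derivative_bounded_linear)
    have "f' h = f' (\<Sum>b\<in>Basis. inner h b *\<^sub>R b)"
      by (simp add: euclidean_representation)
    also have "\<dots> = inner h (\<Sum>b\<in>Basis. f' b *\<^sub>R b)"
      by (simp add: sum scaleR inner_sum_right mult.commute)
    finally show ?thesis .
  qed
  then have "f' = (\<lambda>h. inner h (\<Sum>b\<in>Basis. f' b *\<^sub>R b))"
    by blast
  with f' have "GDERIV f x :> (\<Sum>b\<in>Basis. f' b *\<^sub>R b)"
    unfolding gderiv_def by simp
  then show ?thesis
    by (simp add: gradient_eqI)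
qed

definition avg_obj :: "('m::finite \<Rightarrow> 'a \<Rightarrow> real) \<Rightarrow> 'a \<Rightarrow> real" where
  "avg_obj f \<theta> = (\<Sum>i\<in>UNIV. f i \<theta>) / real CARD('m)"

definition l1_norm :: "real ^ 'd \<Rightarrow> real" where
  "l1_norm x = (\<Sum>l\<in>UNIV. \<bar>x $ l\<bar>)"

definition in_nbrs :: "real ^ 'm ^ 'm \<Rightarrow> 'm \<Rightarrow> 'm set" where
  "in_nbrs A i = {j. j \<noteq> i \<and> A $ i $ j > 0}"

definition out_nbrs :: "real ^ 'm ^ 'm \<Rightarrow> 'm \<Rightarrow> 'm set" where
  "out_nbrs A i = {j. j \<noteq> i \<and> A $ j $ i > 0}"

(* A pair (j, i) is an edge from j to i. *)
definition induced_graph :: "real ^ 'm ^ 'm \<Rightarrow> ('m \<times> 'm) set" where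
  "induced_graph A = {(j, i). i \<noteq> j \<and> A $ i $ j > 0}"

(* Directed trees: every vertex except the root has exactly one parent, and all vertices
   are reached from the root. The vertex set is the whole type. *)
definition spanning_tree :: "('m \<times> 'm) set \<Rightarrow> 'm \<Rightarrow> ('m \<times> 'm) set \<Rightarrow> bool" where
  "spanning_tree E r T \<longleftrightarrow>
     T \<subseteq> E \<and> (\<forall>j. (j, r) \<notin> T) \<and> (\<forall>i. i \<noteq> r \<longrightarrow> (\<exists>!j. (j, i) \<in> T)) \<and> (\<forall>i. (r, i) \<in> T\<^sup>*)"

definition spanning_tree_roots :: "('m \<times> 'm) set \<Rightarrow> 'm set" where
  "spanning_tree_roots E = {r. \<exists>T. spanning_tree E r T}"

(* All noises injected at time k: Inl j is the noise on x_j, Inr j the noise on y_j. *)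
definition noise_at ::
  "('m \<Rightarrow> nat \<Rightarrow> 'w \<Rightarrow> 'a) \<Rightarrow> ('m \<Rightarrow> nat \<Rightarrow> 'w \<Rightarrow> 'a) \<Rightarrow> nat \<Rightarrow> 'm + 'm \<Rightarrow> 'w \<Rightarrow> 'a" where
  "noise_at \<zeta> \<xi> k = case_sum (\<lambda>j. \<zeta> j k) (\<lambda>j. \<xi> j k)"

(* The first conjunct says that the collections of all agents' noises at times 0, 1, 2, ... are
   independent of each other, the second that the whole noise process is independent of the
   initial states of all agents; it is stated for the generated sigma-algebras because
   indep_var needs both variables to have the same type. Together with the third conjunct, all the individual noises
   are mutually independent. *)
definition independent_noise ::
  "'w measure \<Rightarrow> ('m \<Rightarrow> 'w \<Rightarrow> 'a::topological_space) \<Rightarrow>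
     ('m \<Rightarrow> nat \<Rightarrow> 'w \<Rightarrow> 'a) \<Rightarrow> ('m \<Rightarrow> nat \<Rightarrow> 'w \<Rightarrow> 'a) \<Rightarrow> bool" where
  "independent_noise M x0 \<zeta> \<xi> \<longleftrightarrow>
     prob_space.indep_vars M (\<lambda>_. PiM UNIV (\<lambda>_. borel)) (\<lambda>k \<omega> s. noise_at \<zeta> \<xi> k s \<omega>) UNIV \<and>
     prob_space.indep_set M
       (sets (vimage_algebra (space M) (\<lambda>\<omega> i. x0 i \<omega>) (PiM UNIV (\<lambda>_. borel))))
       (sets (vimage_algebra (space M) (\<lambda>\<omega> (k, s). noise_at \<zeta> \<xi> k s \<omega>) (PiM UNIV (\<lambda>_. borel)))) \<and>
     (\<forall>k. prob_space.indep_vars M (\<lambda>_. borel) (noise_at \<zeta> \<xi> k) UNIV)"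

definition gradient_tracking ::
  "('m::finite \<Rightarrow> real ^ 'd \<Rightarrow> real) \<Rightarrow> real ^ 'm ^ 'm \<Rightarrow> real ^ 'm ^ 'm \<Rightarrow>
     (nat \<Rightarrow> real) \<Rightarrow> (nat \<Rightarrow> real) \<Rightarrow> (nat \<Rightarrow> real) \<Rightarrow> (nat \<Rightarrow> real) \<Rightarrow>
     ('m \<Rightarrow> nat \<Rightarrow> real ^ 'd) \<Rightarrow> ('m \<Rightarrow> nat \<Rightarrow> real ^ 'd) \<Rightarrow>
     ('m \<Rightarrow> nat \<Rightarrow> real ^ 'd) \<Rightarrow> ('m \<Rightarrow> nat \<Rightarrow> real ^ 'd) \<Rightarrow> bool" where
  "gradient_tracking f R C \<gamma>\<^sub>1 \<gamma>\<^sub>2 \<alpha> lam \<zeta> \<xi> x y \<longleftrightarrow>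
     (\<forall>i. y i 0 = gradient (f i) (x i 0)) \<and>
     (\<forall>i k. x i (Suc k) =
        (1 + \<gamma>\<^sub>1 k * R $ i $ i) *\<^sub>R x i k
        + \<gamma>\<^sub>1 k *\<^sub>R (\<Sum>j\<in>in_nbrs R i. (R $ i $ j) *\<^sub>R (x j k + \<zeta> j k))
        - lam k *\<^sub>R y i k) \<and>
     (\<forall>i k. y i (Suc k) =
        (1 - \<alpha> k + \<gamma>\<^sub>2 k * C $ i $ i) *\<^sub>R y i k
        + \<gamma>\<^sub>2 k *\<^sub>R (\<Sum>j\<in>in_nbrs C i. (C $ i $ j) *\<^sub>R (y j k + \<xi> j k))
        + gradient (f i) (x i (Suc k)) - (1 - \<alpha> k) *\<^sub>R gradient (f i) (x i k))"

definition x_avg :: "real ^ 'm \<Rightarrow> ('m::finite \<Rightarrow> nat \<Rightarrow> 'w \<Rightarrow> 'a::real_vector) \<Rightarrow> nat \<Rightarrow> 'w \<Rightarrow> 'a" where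
  "x_avg u x k \<omega> = (1 / real CARD('m)) *\<^sub>R (\<Sum>i\<in>UNIV. (u $ i) *\<^sub>R x i k \<omega>)"

definition y_avg :: "('m::finite \<Rightarrow> nat \<Rightarrow> 'w \<Rightarrow> 'a::real_vector) \<Rightarrow> nat \<Rightarrow> 'w \<Rightarrow> 'a" where
  "y_avg y k \<omega> = (1 / real CARD('m)) *\<^sub>R (\<Sum>i\<in>UNIV. y i k \<omega>)"

definition series_diverges :: "(nat \<Rightarrow> real) \<Rightarrow> bool" where
  "series_diverges a \<longleftrightarrow> filterlim (\<lambda>n. \<Sum>k<n. a k) at_top sequentially"

end

theory Submission
  imports Defs
begin

text \<open>Each Laplacian contracts, at a rate proportional to the weakening factor, a quadratic form on the
  complement of its left kernel. So every error process satisfies a recursion \<open>Z' = B Z + r + n\<close> with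
  \<open>B\<close> contracting, \<open>r\<close> adapted and \<open>n\<close> a centered noise independent of the past; such a process
  has weighted summable second moments and, by \<open>L\<^sup>2\<close> martingale convergence, tends to \<open>0\<close> almost surely.
  This is applied in turn to the average of \<open>y - \<nabla>f(x)\<close>, to its projection (for a uniform moment
  bound on \<open>y\<close>, from the bounded gradients), to the consensus error of \<open>x\<close>, and to the tracking error
  of \<open>y\<close>. The noise in \<open>x\<close> may have unbounded variance, so for the last one the gradients are taken
  along a lagged copy of \<open>x\<close>, whose increments are small compared with the weakening factor.
  Finally \<open>F\<close> decreases along the averaged states up to summable errors, and \<open>\<Sum>\<lambda>\<^sup>k = \<infinity>\<close> forces the
  gradient to be small along a subsequence.\<close>

subsection \<open>Powers of stochastic matrices\<close>

text \<open>Neither Laplacian need be symmetric, so a step may enlarge the Euclidean norm of an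
  error; hence a quadratic form, chosen once and valid for all small weakening factors. The order of
  the estimates is shaped by a circle: \<open>y\<close> is driven by gradients along
  \<open>x\<close>, and \<open>x\<close> by \<open>y\<close>. It is broken by
  \<open>W = Y - grads X\<close>, whose recursion has no gradient increment, and bounded gradients
  then bound \<open>Y\<close> without any bound on \<open>X\<close>. Each error is summable in mean
  square against its own rate (\<alpha>, \<open>\<gamma>\<^sub>1\<close> or
  \<open>\<gamma>\<^sub>2\<close>); as \<open>lam\<close> is eventually at most a constant times
  each rate, all are summable against \<open>lam\<close>, the one weight that the descent sees.
  Almost sure statements use no conditional expectations: along a path the noise contributes a
  squared part, summable because its expectations are, and a linear part, summable as a martingale;
  the rest is an argument on real sequences. The common root of the two graphs makes
  \<open>u\<close> and \<open>v\<close> overlap, so that the averaged step follows a positive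
  multiple of the gradient.\<close>

definition mat_act :: "real ^ 'n ^ 'm \<Rightarrow> 'a::real_vector ^ 'n \<Rightarrow> 'a ^ 'm" where
  "mat_act A z = (\<chi> i. \<Sum>j\<in>UNIV. A $ i $ j *\<^sub>R z $ j)"

lemma mat_act_nth: "mat_act A z $ i = (\<Sum>j\<in>UNIV. A $ i $ j *\<^sub>R z $ j)"
  by (simp add: mat_act_def)

lemma linear_mat_act: "linear (mat_act A)"
  by (rule linearI)
    (simp_all add: vec_eq_iff mat_act_nth scaleR_add_right sum.distrib scaleR_sum_right mult.commute)

lemma mat_act_mat_1: "mat_act (mat 1) z = z"
  by (simp add: vec_eq_iff mat_act_nth mat_def if_distrib[of "\<lambda>c. c *\<^sub>R _"] cong: if_cong)

lemma mat_act_matrix_mult: "mat_act (A ** B) z = mat_act A (mat_act B z)"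
proof -
  have "(\<Sum>j\<in>UNIV. (\<Sum>k\<in>UNIV. A $ i $ k * B $ k $ j) *\<^sub>R z $ j)
      = (\<Sum>k\<in>UNIV. A $ i $ k *\<^sub>R (\<Sum>j\<in>UNIV. B $ k $ j *\<^sub>R z $ j))" for i
    by (simp add: scaleR_sum_left scaleR_sum_right, subst sum.swap) simp
  then show ?thesis
    by (simp add: vec_eq_iff mat_act_nth matrix_matrix_mult_def)
qed

primrec mat_pow :: "real ^ 'n ^ 'n \<Rightarrow> nat \<Rightarrow> real ^ 'n ^ 'n" where
  "mat_pow A 0 = mat 1"
| "mat_pow A (Suc n) = A ** mat_pow A n"

lemma mat_pow_commute: "mat_pow A n ** A = A ** mat_pow A n"
  by (induction n) (simp_all add: matrix_mul_lid matrix_mul_rid matrix_mul_assoc[symmetric])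

lemma transpose_mat_pow: "transpose (mat_pow A n) = mat_pow (transpose A) n"
  by (induction n) (simp_all add: matrix_transpose_mul mat_pow_commute transpose_mat)

lemma mat_pow_nonneg:
  assumes "\<And>i j. 0 \<le> A $ i $ j"
  shows "0 \<le> mat_pow A n $ i $ j"
  using assms
  by (induction n arbitrary: i j) (auto simp: mat_def matrix_matrix_mult_def intro!: sum_nonneg)

lemma mat_pow_row_sum:
  assumes "\<And>i. (\<Sum>j\<in>UNIV. A $ i $ j) = 1"
  shows "(\<Sum>j\<in>UNIV. mat_pow A n $ i $ j) = 1"
proof (induction n arbitrary: i)
  case 0
  then show ?case by (simp add: mat_def)
next
  case (Suc n)
  have "(\<Sum>j\<in>UNIV. mat_pow A (Suc n) $ i $ j)
      = (\<Sum>k\<in>UNIV. A $ i $ k * (\<Sum>j\<in>UNIV. mat_pow A n $ k $ j))"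
    by (simp add: matrix_matrix_mult_def sum_distrib_left, subst sum.swap) simp
  then show ?case
    using Suc assms by simp
qed

text \<open>A positive diagonal keeps an entry positive in all later powers, so one exponent beyond
  the finitely many path lengths serves every row. Only column \<open>r\<close> is claimed: a graph
  with a root need not be strongly connected, and other columns may keep zero entries.\<close>

lemma mat_pow_pos_column:
  fixes A :: "real ^ 'n ^ 'n"
  assumes nonneg: "\<And>i j. 0 \<le> A $ i $ j" and diag: "\<And>i. 0 < A $ i $ i"
    and edges: "\<And>i j. (j, i) \<in> E \<Longrightarrow> 0 < A $ i $ j"
    and reach: "\<And>i. (r, i) \<in> E\<^sup>*"
  obtains N where "N > 0" "\<And>i. 0 < mat_pow A N $ i $ r"
proof -
  have advance: "0 < mat_pow A (Suc n) $ i $ r" if "0 < A $ i $ j" "0 < mat_pow A n $ j $ r" for i j n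
  proof -
    have "0 < A $ i $ j * mat_pow A n $ j $ r"
      using that by simp
    also have "\<dots> \<le> (\<Sum>k\<in>UNIV. A $ i $ k * mat_pow A n $ k $ r)"
      by (rule member_le_sum) (auto simp: nonneg mat_pow_nonneg)
    finally show ?thesis
      by (simp add: matrix_matrix_mult_def)
  qed
  have mono: "0 < mat_pow A (n + k) $ i $ r" if "0 < mat_pow A n $ i $ r" for n k i
    by (induction k) (use that advance[OF diag] in auto)
  have "\<exists>n. 0 < mat_pow A n $ i $ r" for i
    using reach[of i]
  proof (induction rule: rtrancl_induct)
    case base
    show ?case by (intro exI[of _ 0]) (simp add: mat_def)
  next
    case (step j i)
    then show ?case
      using edges advance by blast
  qed
  then obtain n where n: "\<And>i. 0 < mat_pow A (n i) $ i $ r"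
    by metis
  define N where "N = Suc (Max (range n))"
  have "n i \<le> N" for i
    unfolding N_def by (intro le_SucI Max_ge) auto
  then have "0 < mat_pow A N $ i $ r" for i
    using mono[OF n, of i "N - n i"] by simp
  moreover have "N > 0" by (simp add: N_def)
  ultimately show ?thesis using that by blast
qed

text \<open>Subtracting from every row the mass \<open>\<delta>\<close> that it puts on \<open>r\<close> leaves a matrix of row sums
  \<open>1 - \<delta>\<close>, and the subtracted part acts as a constant vector.\<close>
lemma stochastic_contracts_spread:
  fixes A :: "real ^ 'n ^ 'n" and z :: "real ^ 'n"
  assumes nonneg: "\<And>i j. 0 \<le> A $ i $ j" and rows: "\<And>i. (\<Sum>j\<in>UNIV. A $ i $ j) = 1"
    and delta: "\<And>i. \<delta> \<le> A $ i $ r"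
    and z: "\<And>i. \<bar>z $ i - c\<bar> \<le> s"
  shows "\<exists>c'. \<forall>i. \<bar>(A *v z) $ i - c'\<bar> \<le> (1 - \<delta>) * s"
proof (intro exI allI)
  fix i
  define a where "a j = A $ i $ j - (if j = r then \<delta> else 0)" for j
  have a: "0 \<le> a j" for j
    using nonneg[of i j] delta[of i] by (auto simp: a_def)
  have suma: "(\<Sum>j\<in>UNIV. a j) = 1 - \<delta>"
    by (simp add: a_def sum_subtractf rows)
  have "(\<Sum>j\<in>UNIV. a j * (z $ j - c))
      = (\<Sum>j\<in>UNIV. A $ i $ j * z $ j) - \<delta> * z $ r - (1 - \<delta>) * c"
    by (simp add: a_def right_diff_distrib left_diff_distrib sum_subtractf
        rows if_distrib[of "\<lambda>x. x * _"] flip: sum_distrib_right cong: if_cong)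
  then have "(A *v z) $ i - (\<delta> * z $ r + (1 - \<delta>) * c) = (\<Sum>j\<in>UNIV. a j * (z $ j - c))"
    by (simp add: matrix_vector_mult_def)
  also have "\<bar>\<dots>\<bar> \<le> (\<Sum>j\<in>UNIV. a j * s)"
    by (rule order_trans[OF sum_abs sum_mono]) (auto simp: abs_mult a z intro!: mult_left_mono)
  also have "\<dots> = (1 - \<delta>) * s"
    by (simp add: suma flip: sum_distrib_right)
  finally show "\<bar>(A *v z) $ i - (\<delta> * z $ r + (1 - \<delta>) * c)\<bar> \<le> (1 - \<delta>) * s" .
qed

lemma mat_pow_add: "mat_pow A (m + n) = mat_pow A m ** mat_pow A n"
  by (induction m) (simp_all add: matrix_mul_lid matrix_mul_assoc[symmetric])

lemma vec_mat_pow_fixed: "w v* A = w \<Longrightarrow> w v* mat_pow A n = w"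
  by (induction n) (simp_all add: vector_matrix_mul_rid flip: vector_matrix_mul_assoc)

text \<open>Doeblin's argument: a power whose column \<open>r\<close> is at least \<delta> contracts
  the oscillation of every vector by \<open>1 - \<delta>\<close>, so the powers approach a matrix
  with equal rows, and the invariant vector \<open>u\<close> identifies that row.\<close>

lemma stochastic_mat_pow_limit:
  fixes B :: "real ^ 'n ^ 'n" and u :: "real ^ 'n"
  assumes nonneg: "\<And>i j. 0 \<le> B $ i $ j" and rows: "\<And>i. (\<Sum>j\<in>UNIV. B $ i $ j) = 1"
    and diag: "\<And>i. 0 < B $ i $ i"
    and edges: "\<And>i j. (j, i) \<in> E \<Longrightarrow> 0 < B $ i $ j"
    and reach: "\<And>i. (r, i) \<in> E\<^sup>*"
    and u: "\<And>i. 0 \<le> u $ i" "u v* B = u" "(\<Sum>i\<in>UNIV. u $ i) = real CARD('n)"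
    and "\<epsilon> > 0"
  obtains N where "N > 0" "\<And>i j. \<bar>mat_pow B N $ i $ j - u $ j / real CARD('n)\<bar> \<le> \<epsilon>"
proof -
  let ?m = "real CARD('n)"
  have m: "?m > 0" by simp
  obtain K where K: "K > 0" "\<And>i. 0 < mat_pow B K $ i $ r"
    using mat_pow_pos_column[OF nonneg diag edges reach] by metis
  define A where "A = mat_pow B K"
  define \<delta> where "\<delta> = Min (range (\<lambda>i. A $ i $ r))"
  have \<delta>: "\<delta> > 0" "\<delta> \<le> A $ i $ r" for i
    using K(2) by (auto simp: \<delta>_def A_def)
  have A: "0 \<le> A $ i $ j" "(\<Sum>j\<in>UNIV. A $ i $ j) = 1" for i j
    by (auto simp: A_def mat_pow_nonneg nonneg mat_pow_row_sum rows)
  have "A $ r $ r \<le> (\<Sum>j\<in>UNIV. A $ r $ j)"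
    by (rule member_le_sum) (auto simp: A)
  then have "\<delta> \<le> 1"
    using A(2) \<delta>(2)[of r] by simp
  have uA: "u v* mat_pow B n = u" for n
    using u(2) by (rule vec_mat_pow_fixed)
  \<comment> \<open>The oscillation is measured around an unspecified centre, since every
    contraction step moves the centre.\<close>
  have spread: "\<exists>c. \<forall>i. \<bar>(mat_pow B (n * K) *v z) $ i - c\<bar> \<le> (1 - \<delta>) ^ n"
    if "\<And>i. \<bar>z $ i\<bar> \<le> 1" for n z
  proof (induction n)
    case 0
    show ?case using that by (intro exI[of _ 0]) simp
  next
    case (Suc n)
    then obtain c where "\<And>i. \<bar>(mat_pow B (n * K) *v z) $ i - c\<bar> \<le> (1 - \<delta>) ^ n"
      by blast
    from stochastic_contracts_spread[OF A \<delta>(2) this]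
    show ?case
      by (simp add: A_def mat_pow_add matrix_vector_mul_assoc mult.assoc)
  qed
  \<comment> \<open>On vectors orthogonal to \<open>u\<close> the centre is small as well: the image
    stays orthogonal to \<open>u\<close>, whose total weight is \<open>?m\<close>, so the centre is
    at most the oscillation. This is the origin of the factor 2.\<close>
  then have near: "\<bar>(mat_pow B (n * K) *v z) $ i\<bar> \<le> 2 * (1 - \<delta>) ^ n"
    if bounded: "\<And>i. \<bar>z $ i\<bar> \<le> 1" and orth: "u \<bullet> z = 0" for n z i
  proof -
    obtain c where c: "\<And>i. \<bar>(mat_pow B (n * K) *v z) $ i - c\<bar> \<le> (1 - \<delta>) ^ n"
      using spread[OF bounded] by blast
    let ?w = "mat_pow B (n * K) *v z"
    have "(\<Sum>i\<in>UNIV. u $ i * ?w $ i) = u \<bullet> ?w"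
      by (simp add: inner_vec_def)
    also have "\<dots> = 0"
      using orth uA by (metis dot_matrix_vector_mul dot_lmul_matrix)
    finally have "?m * c = - (\<Sum>i\<in>UNIV. u $ i * (?w $ i - c))"
      by (simp add: right_diff_distrib sum_subtractf u(3) flip: sum_distrib_right)
    then have "?m * \<bar>c\<bar> = \<bar>\<Sum>i\<in>UNIV. u $ i * (?w $ i - c)\<bar>"
      by (metis abs_minus_cancel abs_mult abs_of_nat)
    also have "\<dots> \<le> (\<Sum>i\<in>UNIV. u $ i * (1 - \<delta>) ^ n)"
      by (rule order_trans[OF sum_abs sum_mono]) (auto simp: abs_mult u c intro!: mult_left_mono)
    also have "\<dots> = ?m * (1 - \<delta>) ^ n"
      by (simp add: u(3) flip: sum_distrib_right)
    finally have "\<bar>c\<bar> \<le> (1 - \<delta>) ^ n" by simp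
    then show ?thesis using c[of i] by linarith
  qed
  have "(\<lambda>n. 2 * (1 - \<delta>) ^ n) \<longlonglongrightarrow> 2 * 0"
    using \<delta>(1) \<open>\<delta> \<le> 1\<close> by (intro tendsto_intros LIMSEQ_abs_realpow_zero2) auto
  then have "\<forall>\<^sub>F n in sequentially. 2 * (1 - \<delta>) ^ n < \<epsilon> \<and> n > 0"
    using \<open>\<epsilon> > 0\<close> by (intro eventually_conj order_tendstoD(2) eventually_gt_at_top) auto
  then obtain n where n: "2 * (1 - \<delta>) ^ n < \<epsilon>" "n > 0"
    by (auto simp: eventually_sequentially)
  have "\<bar>mat_pow B (n * K) $ i $ j - u $ j / ?m\<bar> \<le> \<epsilon>" for i j
  proof -
    \<comment> \<open>The unit vector of \<open>j\<close> minus its \<open>u\<close>-average, hence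
      orthogonal to \<open>u\<close>. Unit row sums leave the constant part unchanged, so the image
      of \<open>z\<close> is exactly the error in column \<open>j\<close>.\<close>
    define z where "z = axis j 1 - (\<chi> i. u $ j / ?m)"
    have "u $ j \<le> ?m"
      unfolding u(3)[symmetric] by (rule member_le_sum) (auto simp: u)
    then have "0 \<le> u $ j / ?m" "u $ j / ?m \<le> 1"
      using u(1)[of j] by auto
    then have "\<bar>z $ i\<bar> \<le> 1" for i
      using u(1)[of j] by (auto simp: z_def axis_def)
    moreover have "u \<bullet> z = u \<bullet> axis j 1 - (\<Sum>i\<in>UNIV. u $ i * (u $ j / ?m))"
      by (simp only: z_def inner_diff_right) (simp add: inner_vec_def)
    then have "u \<bullet> z = 0"
      unfolding sum_distrib_right[symmetric] u(3) by (simp add: inner_axis)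
    moreover have "(mat_pow B (n * K) *v z) $ i
        = mat_pow B (n * K) $ i $ j - (\<Sum>l\<in>UNIV. mat_pow B (n * K) $ i $ l) * (u $ j / ?m)"
      by (simp add: z_def matrix_vector_mult_def axis_def right_diff_distrib sum_subtractf
          sum_distrib_right sum_divide_distrib if_distrib[of "\<lambda>x. _ * x"] cong: if_cong)
    then have "(mat_pow B (n * K) *v z) $ i = mat_pow B (n * K) $ i $ j - u $ j / ?m"
      by (simp add: mat_pow_row_sum rows)
    ultimately show ?thesis
      using near[of z n i] n(1) by auto
  qed
  moreover have "n * K > 0" using n K by simp
  ultimately show ?thesis using that by blast
qed

subsection \<open>Quadratic Lyapunov functions\<close>

text \<open>A symmetric operator pinched between the identity and \<kappa> times the identity. The
  lower constant is normalised to 1, so that energy bounds are at once bounds on squared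
  norms.\<close>

definition energy_form :: "('e::real_inner \<Rightarrow> 'e) \<Rightarrow> real \<Rightarrow> bool" where
  "energy_form P \<kappa> \<longleftrightarrow> linear P \<and> (\<forall>x y. x \<bullet> P y = y \<bullet> P x) \<and>
     (\<forall>x. (norm x)\<^sup>2 \<le> x \<bullet> P x \<and> x \<bullet> P x \<le> \<kappa> * (norm x)\<^sup>2)"

lemma energy_formD:
  assumes "energy_form P \<kappa>"
  shows "linear P" "x \<bullet> P y = y \<bullet> P x" "(norm x)\<^sup>2 \<le> x \<bullet> P x" "x \<bullet> P x \<le> \<kappa> * (norm x)\<^sup>2"
  using assms by (auto simp: energy_form_def)

lemma energy_form_id: "energy_form (\<lambda>x. x) 1"
  by (simp add: energy_form_def linear_ident inner_commute power2_norm_eq_inner)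

lemma inner_shrink_le:
  fixes x :: "'e::real_inner"
  assumes "0 \<le> a" "a \<le> 1"
  shows "(1 - a) *\<^sub>R x \<bullet> (1 - a) *\<^sub>R x \<le> (1 - a) * (x \<bullet> x)"
proof -
  have "(1 - a) * ((1 - a) * (x \<bullet> x)) \<le> (1 - a) * (x \<bullet> x)"
    using assms by (intro mult_left_le_one_le) auto
  then show ?thesis by simp
qed

lemma energy_form_nonneg: "energy_form P \<kappa> \<Longrightarrow> 0 \<le> x \<bullet> P x"
  using energy_formD(3)[of P \<kappa> x] zero_le_power2[of "norm x"] by linarith

lemma energy_form_bound_nonneg:
  fixes P :: "'e::euclidean_space \<Rightarrow> 'e"
  assumes "energy_form P \<kappa>" shows "0 \<le> \<kappa>"
proof -
  obtain b :: 'e where "b \<in> Basis" using nonempty_Basis by blast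
  then show ?thesis
    using energy_formD(3,4)[OF assms, of b] by simp
qed

lemma energy_form_add:
  assumes "energy_form P \<kappa>"
  shows "(x + y) \<bullet> P (x + y) = x \<bullet> P x + 2 * (x \<bullet> P y) + y \<bullet> P y"
  using energy_formD(2)[OF assms, of x y]
  by (simp add: linear_add[OF energy_formD(1)[OF assms]] inner_add_left inner_add_right)

lemma energy_form_scale:
  assumes "energy_form P \<kappa>"
  shows "(c *\<^sub>R x) \<bullet> P (c *\<^sub>R x) = c\<^sup>2 * (x \<bullet> P x)"
  by (simp add: linear_scale[OF energy_formD(1)[OF assms]] power2_eq_square)

text \<open>Young's inequality for the form: nonnegativity at
  \<open>s *\<^sub>R x - (1 / s) *\<^sub>R y\<close> with \<open>s = sqrt t\<close> bounds the cross
  term.\<close>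

lemma energy_form_add_le:
  assumes P: "energy_form P \<kappa>" and t: "t > 0"
  shows "(x + y) \<bullet> P (x + y) \<le> (1 + t) * (x \<bullet> P x) + (1 + 1 / t) * (y \<bullet> P y)"
proof -
  define s where "s = sqrt t"
  have s: "s > 0" "t = s\<^sup>2" using t by (auto simp: s_def)
  have "0 \<le> (s *\<^sub>R x + (- 1 / s) *\<^sub>R y) \<bullet> P (s *\<^sub>R x + (- 1 / s) *\<^sub>R y)"
    by (rule energy_form_nonneg[OF P])
  also have "\<dots> = t * (x \<bullet> P x) - 2 * (x \<bullet> P y) + (1 / t) * (y \<bullet> P y)"
    unfolding energy_form_add[OF P] energy_form_scale[OF P] using s
    by (simp add: linear_scale[OF energy_formD(1)[OF P]] linear_neg[OF energy_formD(1)[OF P]] power2_eq_square)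
  finally show ?thesis
    by (simp only: energy_form_add[OF P]) (simp add: algebra_simps)
qed

text \<open>Young's inequality with \<open>t = \<rho> / 2\<close> spends half of the contraction on
  the cross term. The price \<open>1 + 2 / \<rho>\<close> for \<open>y\<close> is at most
  \<open>3 / \<rho>\<close> because \<open>\<rho> \<le> 1\<close>.\<close>

lemma energy_form_contract_add_le:
  assumes P: "energy_form P \<kappa>" and \<rho>: "0 < \<rho>" "\<rho> \<le> 1"
    and x: "x \<bullet> P x \<le> (1 - \<rho>) * E" and E: "0 \<le> E"
  shows "(x + y) \<bullet> P (x + y) \<le> (1 - \<rho> / 2) * E + 3 / \<rho> * (y \<bullet> P y)"
proof -
  have "(x + y) \<bullet> P (x + y) \<le> (1 + \<rho> / 2) * (x \<bullet> P x) + (1 + 1 / (\<rho> / 2)) * (y \<bullet> P y)"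
    using \<rho> by (intro energy_form_add_le[OF P]) auto
  also have "(1 + \<rho> / 2) * (x \<bullet> P x) \<le> (1 + \<rho> / 2) * ((1 - \<rho>) * E)"
    using \<rho> x by (intro mult_left_mono) auto
  also have "\<dots> = (1 - \<rho> / 2) * E - \<rho>\<^sup>2 / 2 * E"
    by (simp add: field_simps power2_eq_square)
  also have "\<dots> \<le> (1 - \<rho> / 2) * E"
    using E by simp
  also have "(1 + 1 / (\<rho> / 2)) * (y \<bullet> P y) \<le> 3 / \<rho> * (y \<bullet> P y)"
    using \<rho> by (intro mult_right_mono energy_form_nonneg[OF P]) (simp add: field_simps)
  finally show ?thesis by simp
qed

lemma norm_vec_le_sum: "norm x \<le> (\<Sum>i\<in>UNIV. norm (x $ i))"
  unfolding norm_vec_def by (rule L2_set_le_sum) simp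

text \<open>A negative derivative of the energy along \<open>T\<close> beats the term quadratic in
  \<gamma> once \<gamma> is small. The scalar \<theta> anticipates the decay factor
  \<open>1 - \<alpha> k\<close>. Of the rate \<open>c\<close>, a half is lost to
  \<open>\<theta> \<ge> 1 / 2\<close> and a quarter to the quadratic term, which leaves
  \<open>c / 4\<close>.\<close>

lemma linear_energy_dissipation:
  fixes P :: "'e::euclidean_space \<Rightarrow> 'e"
  assumes P: "energy_form P \<kappa>" and T: "linear T" and c: "c > 0"
    and diss: "\<And>z. z \<in> W \<Longrightarrow> 2 * (z \<bullet> P (T z)) \<le> - c * (z \<bullet> P z)"
  obtains \<gamma>m where "\<gamma>m > 0"
    "\<And>z \<theta> \<gamma>. z \<in> W \<Longrightarrow> 1 / 2 \<le> \<theta> \<Longrightarrow> \<theta> \<le> 1 \<Longrightarrow> 0 \<le> \<gamma> \<Longrightarrow> \<gamma> \<le> \<gamma>m \<Longrightarrow>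
      (\<theta> *\<^sub>R z + \<gamma> *\<^sub>R T z) \<bullet> P (\<theta> *\<^sub>R z + \<gamma> *\<^sub>R T z) \<le> (1 - c / 4 * \<gamma>) * (z \<bullet> P z)"
proof -
  obtain B where B: "B > 0" "\<And>x. norm (T x) \<le> B * norm x"
    using linear_bounded_pos[OF T] by auto
  define K where "K = \<kappa> * B\<^sup>2 + 1"
  have \<kappa>: "0 \<le> \<kappa>" by (rule energy_form_bound_nonneg[OF P])
  then have K: "K > 0" by (simp add: K_def add_nonneg_pos)
  have TK: "T z \<bullet> P (T z) \<le> K * (z \<bullet> P z)" for z
  proof -
    have "T z \<bullet> P (T z) \<le> \<kappa> * (norm (T z))\<^sup>2"
      by (rule energy_formD[OF P])
    also have "\<dots> \<le> \<kappa> * (B * norm z)\<^sup>2"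
      using B \<kappa> by (intro mult_left_mono power_mono) auto
    also have "\<dots> = \<kappa> * B\<^sup>2 * (norm z)\<^sup>2"
      by (simp add: power_mult_distrib)
    also have "\<dots> \<le> K * (z \<bullet> P z)"
      using \<kappa> energy_formD(3)[OF P, of z] by (intro mult_mono) (auto simp: K_def)
    finally show ?thesis .
  qed
  show ?thesis
  proof (rule that[of "c / (4 * K)"])
    show "c / (4 * K) > 0" using c K by simp
    fix z and \<theta> \<gamma> :: real assume z: "z \<in> W" and \<theta>: "1 / 2 \<le> \<theta>" "\<theta> \<le> 1" and \<gamma>: "0 \<le> \<gamma>" "\<gamma> \<le> c / (4 * K)"
    define E where "E = z \<bullet> P z"
    have E: "E \<ge> 0" unfolding E_def by (rule energy_form_nonneg[OF P])
    have "(\<theta> *\<^sub>R z + \<gamma> *\<^sub>R T z) \<bullet> P (\<theta> *\<^sub>R z + \<gamma> *\<^sub>R T z)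
        = \<theta>\<^sup>2 * E + \<theta> * \<gamma> * (2 * (z \<bullet> P (T z))) + \<gamma>\<^sup>2 * (T z \<bullet> P (T z))"
      unfolding energy_form_add[OF P] energy_form_scale[OF P]
      by (simp add: linear_scale[OF energy_formD(1)[OF P]] E_def)
    also have "\<dots> \<le> 1 * E + \<theta> * \<gamma> * (- c * E) + \<gamma>\<^sup>2 * (K * E)"
      using \<theta> \<gamma> E diss[OF z] TK[of z] unfolding E_def
      by (intro add_mono mult_left_mono mult_right_mono power_le_one) auto
    also have "\<theta> * \<gamma> * (- c * E) \<le> 1 / 2 * \<gamma> * (- c * E)"
      using \<theta> \<gamma> c E by (intro mult_right_mono_neg mult_right_mono) auto
    also have "\<gamma>\<^sup>2 * (K * E) \<le> \<gamma> * (c / (4 * K)) * (K * E)"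
      using mult_left_mono[OF \<gamma>(2,1)] K E by (intro mult_right_mono) (simp_all add: power2_eq_square)
    also have "1 * E + 1 / 2 * \<gamma> * (- c * E) + \<gamma> * (c / (4 * K)) * (K * E) = (1 - c / 4 * \<gamma>) * E"
      using K by (simp add: field_simps)
    finally show "(\<theta> *\<^sub>R z + \<gamma> *\<^sub>R T z) \<bullet> P (\<theta> *\<^sub>R z + \<gamma> *\<^sub>R T z) \<le> (1 - c / 4 * \<gamma>) * (z \<bullet> P z)"
      by (simp add: E_def)
  qed
qed

text \<open>The form \<open>\<Sum>t<N. \<parallel>B\<^sup>t z\<parallel>\<^sup>2\<close> with \<open>B = I + \<gamma> A\<close> decreases by \<open>\<parallel>z\<parallel>\<^sup>2 - \<parallel>B\<^sup>N z\<parallel>\<^sup>2\<close> under \<open>B\<close>. This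
  forces its derivative along \<open>A\<close> to be negative, so it also contracts under every smaller step.\<close>
lemma mat_act_lyapunov:
  fixes A :: "real ^ 'n ^ 'n" and a b :: "real ^ 'n"
  assumes g: "g > 0"
    and lim: "\<And>\<epsilon>. \<epsilon> > 0 \<Longrightarrow> \<exists>N>0. \<forall>i j. \<bar>mat_pow (mat 1 + g *\<^sub>R A) N $ i $ j - a $ i * b $ j / real CARD('n)\<bar> \<le> \<epsilon>"
  obtains P :: "'a::euclidean_space ^ 'n \<Rightarrow> 'a ^ 'n" and \<kappa> c \<gamma>m :: real
  where "energy_form P \<kappa>" "c > 0" "\<gamma>m > 0"
    "\<And>z \<theta> \<gamma>. (\<Sum>j\<in>UNIV. b $ j *\<^sub>R z $ j) = 0 \<Longrightarrow> 1 / 2 \<le> \<theta> \<Longrightarrow> \<theta> \<le> 1 \<Longrightarrow> 0 \<le> \<gamma> \<Longrightarrow> \<gamma> \<le> \<gamma>m \<Longrightarrow>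
      (\<theta> *\<^sub>R z + \<gamma> *\<^sub>R mat_act A z) \<bullet> P (\<theta> *\<^sub>R z + \<gamma> *\<^sub>R mat_act A z) \<le> (1 - c * \<gamma>) * (z \<bullet> P z)"
proof -
  let ?m = "real CARD('n)"
  define B where "B = mat 1 + g *\<^sub>R A"
  define W :: "('a ^ 'n) set" where "W = {z. (\<Sum>j\<in>UNIV. b $ j *\<^sub>R z $ j) = 0}"
  \<comment> \<open>The tolerance is chosen so that summing over the \<open>?m\<close> columns and
    then over the \<open>?m\<close> rows leaves a norm of at most one half on
    \<open>W\<close>.\<close>
  obtain N where N: "N > 0" "\<And>i j. \<bar>mat_pow B N $ i $ j - a $ i * b $ j / ?m\<bar> \<le> 1 / (2 * ?m\<^sup>2)"
    using lim[of "1 / (2 * ?m\<^sup>2)"] unfolding B_def by auto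
  have half: "norm (mat_act (mat_pow B N) z) \<le> norm z / 2" if "z \<in> W" for z
  proof -
    have "norm (mat_act (mat_pow B N) z $ i) \<le> norm z / (2 * ?m)" for i
    proof -
      \<comment> \<open>The rank-one limit may be subtracted at no cost, since it annihilates
        \<open>W\<close>.\<close>
      have "mat_act (mat_pow B N) z $ i
          = (\<Sum>j\<in>UNIV. (mat_pow B N $ i $ j - a $ i * b $ j / ?m) *\<^sub>R z $ j) + (a $ i / ?m) *\<^sub>R (\<Sum>j\<in>UNIV. b $ j *\<^sub>R z $ j)"
        by (simp add: mat_act_nth scaleR_diff_left sum_subtractf scaleR_sum_right)
      also have "\<dots> = (\<Sum>j\<in>UNIV. (mat_pow B N $ i $ j - a $ i * b $ j / ?m) *\<^sub>R z $ j)"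
        using that by (simp add: W_def)
      also have "norm \<dots> \<le> (\<Sum>j\<in>(UNIV::'n set). 1 / (2 * ?m\<^sup>2) * norm z)"
      proof (rule order_trans[OF norm_sum sum_mono])
        fix j
        have "\<bar>mat_pow B N $ i $ j - a $ i * b $ j / ?m\<bar> * norm (z $ j) \<le> 1 / (2 * ?m\<^sup>2) * norm z"
          by (rule mult_mono[OF N(2) Finite_Cartesian_Product.norm_nth_le]) auto
        then show "norm ((mat_pow B N $ i $ j - a $ i * b $ j / ?m) *\<^sub>R z $ j) \<le> 1 / (2 * ?m\<^sup>2) * norm z"
          by simp
      qed
      also have "\<dots> = norm z / (2 * ?m)"
        by (simp add: power2_eq_square)
      finally show ?thesis .
    qed
    then have "(\<Sum>i\<in>UNIV. norm (mat_act (mat_pow B N) z $ i)) \<le> ?m * (norm z / (2 * ?m))"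
      by (intro sum_bounded_above) auto
    then show ?thesis
      using norm_vec_le_sum[of "mat_act (mat_pow B N) z"] by simp
  qed
  define S where "S t = (mat_act (mat_pow B t) :: 'a ^ 'n \<Rightarrow> 'a ^ 'n)" for t
  \<comment> \<open>Adjoints turn the sum of squared norms into a form
    \<open>z \<bullet> P z\<close>; its term \<open>t = 0\<close> supplies the lower bound by the
    squared norm.\<close>
  define P where "P z = (\<Sum>t<N. adjoint (S t) (S t z))" for z
  have linS: "linear (S t)" for t
    by (simp add: S_def linear_mat_act)
  have linP: "linear P"
    unfolding P_def
    by (intro linear_compose_sum ballI linear_compose[OF linS adjoint_linear[OF linS], unfolded comp_def])
  have inP: "x \<bullet> P y = (\<Sum>t<N. S t x \<bullet> S t y)" for x y
    by (simp add: P_def inner_sum_right adjoint_works[OF linS])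
  obtain \<kappa> where \<kappa>: "\<kappa> > 0" "\<And>x. norm (P x) \<le> \<kappa> * norm x"
    using linear_bounded_pos[OF linP] by auto
  have P: "energy_form P \<kappa>"
    unfolding energy_form_def
  proof (intro conjI allI linP)
    fix x y
    show "x \<bullet> P y = y \<bullet> P x" by (simp add: inP inner_commute)
    have "x \<bullet> x = (\<Sum>t\<in>{0}. S t x \<bullet> S t x)"
      by (simp add: S_def mat_act_mat_1)
    also have "\<dots> \<le> x \<bullet> P x"
      unfolding inP using N(1) by (intro sum_mono2) auto
    finally show "(norm x)\<^sup>2 \<le> x \<bullet> P x"
      by (simp add: power2_norm_eq_inner)
    have "x \<bullet> P x \<le> norm x * (\<kappa> * norm x)"
      by (rule order_trans[OF norm_cauchy_schwarz]) (intro mult_left_mono \<kappa> norm_ge_zero)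
    then show "x \<bullet> P x \<le> \<kappa> * (norm x)\<^sup>2"
      by (simp add: power2_eq_square mult_ac)
  qed
  let ?T = "mat_act A :: 'a ^ 'n \<Rightarrow> 'a ^ 'n"
  have B_act: "mat_act B z = z + g *\<^sub>R ?T z" for z :: "'a ^ 'n"
  proof -
    have "mat_act B z $ i = mat_act (mat 1) z $ i + (g *\<^sub>R ?T z) $ i" for i
      by (simp add: B_def mat_act_nth scaleR_add_left sum.distrib scaleR_sum_right)
    then show ?thesis by (simp add: vec_eq_iff mat_act_mat_1)
  qed
  have SB: "S t (mat_act B z) = S (Suc t) z" for t z
    by (simp add: S_def flip: mat_act_matrix_mult mat_pow_commute)
  have diss: "2 * (z \<bullet> P (?T z)) \<le> - (1 / (2 * g * \<kappa>)) * (z \<bullet> P z)" if "z \<in> W" for z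
  proof -
    \<comment> \<open>Dropping the quadratic term bounds the derivative of the energy along
      \<open>A\<close> by the change of energy over one step of \<open>B\<close>, and that change
      telescopes.\<close>
    have "z \<bullet> P z + 2 * g * (z \<bullet> P (?T z)) \<le> (z + g *\<^sub>R ?T z) \<bullet> P (z + g *\<^sub>R ?T z)"
      using energy_form_nonneg[OF P, of "g *\<^sub>R ?T z"]
      by (simp add: energy_form_add[OF P] linear_scale[OF linP])
    also have "\<dots> = (\<Sum>t<N. S (Suc t) z \<bullet> S (Suc t) z)"
      unfolding B_act[symmetric] by (simp add: inP SB)
    also have "\<dots> = z \<bullet> P z + (S N z \<bullet> S N z - S 0 z \<bullet> S 0 z)"
      unfolding inP using sum_lessThan_telescope[of "\<lambda>t. S t z \<bullet> S t z" N]
      by (simp add: sum_subtractf)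
    also have "S N z \<bullet> S N z \<le> (norm z / 2)\<^sup>2"
      unfolding S_def power2_norm_eq_inner[symmetric] using half[OF that] by (intro power_mono) auto
    also have "S 0 z \<bullet> S 0 z = (norm z)\<^sup>2"
      by (simp add: S_def mat_act_mat_1 power2_norm_eq_inner)
    finally have "g * (2 * (z \<bullet> P (?T z))) \<le> - (3 / 4) * (norm z)\<^sup>2"
      by (simp add: power2_eq_square)
    also have "\<dots> \<le> - (1 / 2) * (norm z)\<^sup>2"
      by (intro mult_right_mono) auto
    also have "\<dots> \<le> - (1 / 2) * (z \<bullet> P z / \<kappa>)"
      using energy_formD(4)[OF P, of z] \<kappa>(1) by (simp add: field_simps)
    also have "\<dots> = g * (- (1 / (2 * g * \<kappa>)) * (z \<bullet> P z))"
      using g by simp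
    finally show ?thesis
      using g by (simp only: mult_le_cancel_left_pos)
  qed
  obtain \<gamma>m where "\<gamma>m > 0"
    "\<And>z \<theta> \<gamma>. z \<in> W \<Longrightarrow> 1 / 2 \<le> \<theta> \<Longrightarrow> \<theta> \<le> 1 \<Longrightarrow> 0 \<le> \<gamma> \<Longrightarrow> \<gamma> \<le> \<gamma>m \<Longrightarrow>
      (\<theta> *\<^sub>R z + \<gamma> *\<^sub>R ?T z) \<bullet> P (\<theta> *\<^sub>R z + \<gamma> *\<^sub>R ?T z) \<le> (1 - 1 / (2 * g * \<kappa>) / 4 * \<gamma>) * (z \<bullet> P z)"
    using linear_energy_dissipation[OF P linear_mat_act _ diss] g \<kappa>(1) by (metis divide_pos_pos mult_pos_pos zero_less_numeral zero_less_one)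
  moreover have "1 / (2 * g * \<kappa>) / 4 > 0"
    using g \<kappa>(1) by simp
  ultimately show ?thesis
    using P that[of P \<kappa> "1 / (2 * g * \<kappa>) / 4" \<gamma>m] by (simp add: W_def)
qed

subsection \<open>Square-integrable noise and martingale convergence\<close>

lemma real_mult_le_half_squares: "a * b \<le> (a\<^sup>2 + b\<^sup>2) / 2" for a b :: real
  using sum_squares_bound[of a b] by simp

lemma norm_add_sq_le: "(norm (x + y))\<^sup>2 \<le> 2 * (norm x)\<^sup>2 + 2 * (norm y)\<^sup>2"
proof -
  have "(norm (x + y))\<^sup>2 \<le> (norm x + norm y)\<^sup>2"
    by (intro power_mono norm_triangle_ineq norm_ge_zero)
  then show ?thesis
    using sum_squares_bound[of "norm x" "norm y"] by (simp add: power2_sum)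
qed

text \<open>Integrals are taken in \<open>M\<close>, while \<open>N\<close> is meant to be a
  sub-sigma-algebra that records what the variable may depend on.\<close>

definition sqint :: "'w measure \<Rightarrow> 'w measure \<Rightarrow> ('w \<Rightarrow> 'b::euclidean_space) \<Rightarrow> bool" where
  "sqint M N X \<longleftrightarrow> X \<in> borel_measurable N \<and> integrable M (\<lambda>\<omega>. (norm (X \<omega>))\<^sup>2)"

lemma sqintD:
  assumes "sqint M N X"
  shows "X \<in> borel_measurable N" "integrable M (\<lambda>\<omega>. (norm (X \<omega>))\<^sup>2)"
  using assms by (auto simp: sqint_def)

lemma sqint_dominated:
  assumes "sqint M N Y" "subalgebra M N" "X \<in> borel_measurable N"
    and "\<And>\<omega>. \<omega> \<in> space M \<Longrightarrow> norm (X \<omega>) \<le> c * norm (Y \<omega>)"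
  shows "sqint M N X"
  unfolding sqint_def
proof (intro conjI assms(3))
  show "integrable M (\<lambda>\<omega>. (norm (X \<omega>))\<^sup>2)"
  proof (rule Bochner_Integration.integrable_bound)
    show "integrable M (\<lambda>\<omega>. c\<^sup>2 * (norm (Y \<omega>))\<^sup>2)"
      by (intro integrable_mult_right sqintD(2)[OF assms(1)])
    have "X \<in> borel_measurable M"
      by (rule measurable_from_subalg[OF assms(2,3)])
    then show "(\<lambda>\<omega>. (norm (X \<omega>))\<^sup>2) \<in> borel_measurable M"
      by measurable
    show "AE \<omega> in M. norm ((norm (X \<omega>))\<^sup>2) \<le> norm (c\<^sup>2 * (norm (Y \<omega>))\<^sup>2)"
      using assms(4) by (intro AE_I2) (auto simp flip: power_mult_distrib intro!: power_mono)
  qed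
qed

lemma sqint_linear:
  fixes h :: "'b::euclidean_space \<Rightarrow> 'c::euclidean_space"
  assumes "sqint M N X" "subalgebra M N" "linear h"
  shows "sqint M N (\<lambda>\<omega>. h (X \<omega>))"
proof -
  obtain B where B: "\<And>x. norm (h x) \<le> B * norm x"
    using linear_bounded[OF assms(3)] by blast
  have "h \<in> borel_measurable borel"
    using assms(3) by (intro borel_measurable_continuous_onI linear_continuous_on linear_conv_bounded_linear[THEN iffD1])
  then have "(\<lambda>\<omega>. h (X \<omega>)) \<in> borel_measurable N"
    by (rule measurable_compose[OF sqintD(1)[OF assms(1)]])
  then show ?thesis
    using B by (rule sqint_dominated[OF assms(1,2)])
qed

lemma sqint_scaleR: "sqint M N X \<Longrightarrow> subalgebra M N \<Longrightarrow> sqint M N (\<lambda>\<omega>. c *\<^sub>R X \<omega>)"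
  by (rule sqint_linear) (auto intro: linear_scaleR)

lemma sqint_add:
  assumes "sqint M N X" "sqint M N Y" "subalgebra M N"
  shows "sqint M N (\<lambda>\<omega>. X \<omega> + Y \<omega>)"
  unfolding sqint_def
proof (intro conjI)
  show meas: "(\<lambda>\<omega>. X \<omega> + Y \<omega>) \<in> borel_measurable N"
    using sqintD(1)[OF assms(1)] sqintD(1)[OF assms(2)] by measurable
  show "integrable M (\<lambda>\<omega>. (norm (X \<omega> + Y \<omega>))\<^sup>2)"
  proof (rule Bochner_Integration.integrable_bound)
    show "integrable M (\<lambda>\<omega>. 2 * (norm (X \<omega>))\<^sup>2 + 2 * (norm (Y \<omega>))\<^sup>2)"
      using sqintD(2)[OF assms(1)] sqintD(2)[OF assms(2)] by simp
    show "(\<lambda>\<omega>. (norm (X \<omega> + Y \<omega>))\<^sup>2) \<in> borel_measurable M"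
      using measurable_from_subalg[OF assms(3) meas] by measurable
    show "AE \<omega> in M. norm ((norm (X \<omega> + Y \<omega>))\<^sup>2) \<le> norm (2 * (norm (X \<omega>))\<^sup>2 + 2 * (norm (Y \<omega>))\<^sup>2)"
      using norm_add_sq_le by (intro AE_I2) auto
  qed
qed

lemma sqint_diff:
  assumes "sqint M N X" "sqint M N Y" "subalgebra M N"
  shows "sqint M N (\<lambda>\<omega>. X \<omega> - Y \<omega>)"
  using sqint_add[OF assms(1) sqint_scaleR[OF assms(2,3), of "-1"] assms(3)] by simp

lemma sqint_mono:
  assumes "sqint M N X" "subalgebra N' N" shows "sqint M N' X"
  using assms by (auto simp: sqint_def intro: measurable_from_subalg)

lemma sqint_cong:
  assumes "subalgebra M N" "\<And>\<omega>. \<omega> \<in> space M \<Longrightarrow> X \<omega> = Y \<omega>"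
  shows "sqint M N X \<longleftrightarrow> sqint M N Y"
proof -
  have "X \<in> borel_measurable N \<longleftrightarrow> Y \<in> borel_measurable N"
    using assms by (intro measurable_cong) (auto simp: subalgebra_def)
  moreover have "integrable M (\<lambda>\<omega>. (norm (X \<omega>))\<^sup>2) \<longleftrightarrow> integrable M (\<lambda>\<omega>. (norm (Y \<omega>))\<^sup>2)"
    using assms by (intro Bochner_Integration.integrable_cong) auto
  ultimately show ?thesis by (simp add: sqint_def)
qed

lemma sqint_integrable_norm_mult:
  assumes "sqint M N X" "sqint M N' Y" "subalgebra M N" "subalgebra M N'"
  shows "integrable M (\<lambda>\<omega>. norm (X \<omega>) * norm (Y \<omega>))"
proof (rule Bochner_Integration.integrable_bound)
  show "integrable M (\<lambda>\<omega>. ((norm (X \<omega>))\<^sup>2 + (norm (Y \<omega>))\<^sup>2) / 2)"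
    using sqintD(2)[OF assms(1)] sqintD(2)[OF assms(2)] by simp
  show "(\<lambda>\<omega>. norm (X \<omega>) * norm (Y \<omega>)) \<in> borel_measurable M"
    using measurable_from_subalg[OF assms(3) sqintD(1)[OF assms(1)]]
      measurable_from_subalg[OF assms(4) sqintD(1)[OF assms(2)]] by measurable
  show "AE \<omega> in M. norm (norm (X \<omega>) * norm (Y \<omega>)) \<le> norm (((norm (X \<omega>))\<^sup>2 + (norm (Y \<omega>))\<^sup>2) / 2)"
    using real_mult_le_half_squares by (intro AE_I2) (simp add: abs_mult)
qed

lemma sqint_integrable_inner:
  assumes "sqint M N X" "sqint M N' Y" "subalgebra M N" "subalgebra M N'"
  shows "integrable M (\<lambda>\<omega>. X \<omega> \<bullet> Y \<omega>)"
proof (rule Bochner_Integration.integrable_bound[OF sqint_integrable_norm_mult[OF assms]])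
  show "(\<lambda>\<omega>. X \<omega> \<bullet> Y \<omega>) \<in> borel_measurable M"
    using measurable_from_subalg[OF assms(3) sqintD(1)[OF assms(1)]]
      measurable_from_subalg[OF assms(4) sqintD(1)[OF assms(2)]] by measurable
  show "AE \<omega> in M. norm (X \<omega> \<bullet> Y \<omega>) \<le> norm (norm (X \<omega>) * norm (Y \<omega>))"
    by (intro AE_I2) (simp add: Cauchy_Schwarz_ineq2)
qed

lemma (in prob_space) sqint_bounded:
  assumes "X \<in> borel_measurable N" "subalgebra M N" "\<And>\<omega>. \<omega> \<in> space M \<Longrightarrow> norm (X \<omega>) \<le> c"
  shows "sqint M N X"
  unfolding sqint_def
proof (intro conjI assms(1))
  show "integrable M (\<lambda>\<omega>. (norm (X \<omega>))\<^sup>2)"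
  proof (rule Bochner_Integration.integrable_bound)
    show "integrable M (\<lambda>\<omega>. c\<^sup>2)" by simp
    show "(\<lambda>\<omega>. (norm (X \<omega>))\<^sup>2) \<in> borel_measurable M"
      using measurable_from_subalg[OF assms(2,1)] by measurable
    show "AE \<omega> in M. norm ((norm (X \<omega>))\<^sup>2) \<le> norm (c\<^sup>2)"
      using assms(3) by (intro AE_I2) (auto intro!: power_mono)
  qed
qed

lemma (in prob_space) sqint_integrable:
  assumes "sqint M N X" "subalgebra M N"
  shows "integrable M X"
proof (rule Bochner_Integration.integrable_bound)
  show "integrable M (\<lambda>\<omega>. ((norm (X \<omega>))\<^sup>2 + 1) / 2)"
    using sqintD(2)[OF assms(1)] by simp
  show "X \<in> borel_measurable M"
    by (rule measurable_from_subalg[OF assms(2) sqintD(1)[OF assms(1)]])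
  show "AE \<omega> in M. norm (X \<omega>) \<le> norm (((norm (X \<omega>))\<^sup>2 + 1) / 2)"
    using real_mult_le_half_squares[of _ 1] by (intro AE_I2) simp
qed

text \<open>\<open>F k\<close> is the information available before the noise of time
  \<open>k\<close> is drawn, \<open>G k\<close> that of this noise. Independence of the two takes
  the place of conditional expectations.\<close>

locale noise_filtration = prob_space M for M :: "'w measure" +
  fixes F G :: "nat \<Rightarrow> 'w measure"
  assumes F_sub: "subalgebra M (F k)"
    and F_mono: "subalgebra (F (Suc k)) (F k)"
    and G_sub: "subalgebra (F (Suc k)) (G k)"
    and indep_FG: "indep_set (sets (F k)) (sets (G k))"
begin

lemma G_sub_M: "subalgebra M (G k)"
  using F_sub[of "Suc k"] G_sub[of k] by (auto simp: subalgebra_def)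

lemma F_mono_le: "j \<le> k \<Longrightarrow> subalgebra (F k) (F j)"
proof (induction k rule: dec_induct)
  case (step n)
  then show ?case using F_mono[of n] by (auto simp: subalgebra_def)
qed (simp add: subalgebra_def)

text \<open>Independence passes from the sigma-algebras to the variables measurable in them. Every
  later use of \<open>indep_FG\<close> goes through these two formulas.\<close>

lemma indep_FG_expectation:
  fixes X Y :: "'w \<Rightarrow> real"
  assumes "X \<in> borel_measurable (F k)" "integrable M X" "Y \<in> borel_measurable (G k)" "integrable M Y"
  shows "integrable M (\<lambda>\<omega>. X \<omega> * Y \<omega>)"
    and "(LINT \<omega>|M. X \<omega> * Y \<omega>) = (LINT \<omega>|M. X \<omega>) * (LINT \<omega>|M. Y \<omega>)"
proof -
  have gen: "sigma_sets (space M) {Z -` A \<inter> space M |A. A \<in> sets borel} \<subseteq> sets N"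
    if "Z \<in> borel_measurable N" "subalgebra M N" for Z :: "'w \<Rightarrow> real" and N
  proof -
    have "space N = space M" using that(2) by (simp add: subalgebra_def)
    then show ?thesis
      using sets.sigma_sets_subset[of "{Z -` A \<inter> space M |A. A \<in> sets borel}" N] measurable_sets[OF that(1)]
      by auto
  qed
  have "indep_var borel X borel Y"
    unfolding indep_var_eq indep_sets2_eq
  proof (intro conjI ballI)
    show "random_variable borel X" "random_variable borel Y"
      using assms by auto
    show "sigma_sets (space M) {X -` A \<inter> space M |A. A \<in> sets borel} \<subseteq> events"
      using gen[OF assms(1) F_sub] F_sub by (force simp: subalgebra_def)
    show "sigma_sets (space M) {Y -` A \<inter> space M |A. A \<in> sets borel} \<subseteq> events"
      using gen[OF assms(3) G_sub_M] G_sub_M by (force simp: subalgebra_def)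
    fix a b assume "a \<in> sigma_sets (space M) {X -` A \<inter> space M |A. A \<in> sets borel}"
      "b \<in> sigma_sets (space M) {Y -` A \<inter> space M |A. A \<in> sets borel}"
    then have "a \<in> sets (F k)" "b \<in> sets (G k)"
      using gen[OF assms(1) F_sub] gen[OF assms(3) G_sub_M] by auto
    then show "prob (a \<inter> b) = prob a * prob b"
      by (rule indep_setD[OF indep_FG])
  qed
  then show "integrable M (\<lambda>\<omega>. X \<omega> * Y \<omega>)"
    "(LINT \<omega>|M. X \<omega> * Y \<omega>) = (LINT \<omega>|M. X \<omega>) * (LINT \<omega>|M. Y \<omega>)"
    using assms by (auto intro: indep_var_integrable indep_var_lebesgue_integral)
qed

definition centered :: "nat \<Rightarrow> ('w \<Rightarrow> 'b::euclidean_space) \<Rightarrow> bool" where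
  "centered k n \<longleftrightarrow> sqint M (G k) n \<and> (LINT \<omega>|M. n \<omega>) = 0"

lemma centered_linear:
  fixes h :: "'b::euclidean_space \<Rightarrow> 'c::euclidean_space"
  assumes "centered k n" "linear h"
  shows "centered k (\<lambda>\<omega>. h (n \<omega>))"
proof -
  have n: "sqint M (G k) n" "(LINT \<omega>|M. n \<omega>) = 0"
    using assms(1) by (auto simp: centered_def)
  have "(LINT \<omega>|M. h (n \<omega>)) = h (LINT \<omega>|M. n \<omega>)"
    using assms(2) by (intro integral_bounded_linear sqint_integrable[OF n(1) G_sub_M] linear_conv_bounded_linear[THEN iffD1])
  then show ?thesis
    using sqint_linear[OF n(1) G_sub_M assms(2)] linear_0[OF assms(2)] n(2)
    by (simp add: centered_def)
qed

lemma centered_sqint_F: "centered k n \<Longrightarrow> sqint M (F (Suc k)) n"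
  by (auto simp: centered_def intro: sqint_mono[OF _ G_sub])

text \<open>In each coordinate the expectation factors and the mean of \<open>n\<close> vanishes.
  Integrability of \<open>X\<close>, rather than square-integrability, is the right demand because
  \<open>X\<close> will be a product of two square-integrable variables.\<close>

lemma integral_inner_centered:
  fixes X n :: "'w \<Rightarrow> 'b::euclidean_space"
  assumes X: "X \<in> borel_measurable (F k)" "integrable M X" and n: "centered k n"
  shows "integrable M (\<lambda>\<omega>. X \<omega> \<bullet> n \<omega>)" "(LINT \<omega>|M. X \<omega> \<bullet> n \<omega>) = 0"
proof -
  have int_n: "integrable M n" and meas_n: "n \<in> borel_measurable (G k)" and mean: "(LINT \<omega>|M. n \<omega>) = 0"
    using n sqint_integrable[OF _ G_sub_M] by (auto simp: centered_def sqint_def)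
  have coord: "integrable M (\<lambda>\<omega>. (X \<omega> \<bullet> b) * (n \<omega> \<bullet> b))" "(LINT \<omega>|M. (X \<omega> \<bullet> b) * (n \<omega> \<bullet> b)) = 0" for b
    using indep_FG_expectation[of "\<lambda>\<omega>. X \<omega> \<bullet> b" k "\<lambda>\<omega>. n \<omega> \<bullet> b"] X int_n meas_n mean
    by (auto simp: integral_inner_left)
  have eq: "X \<omega> \<bullet> n \<omega> = (\<Sum>b\<in>Basis. (X \<omega> \<bullet> b) * (n \<omega> \<bullet> b))" for \<omega>
    by (rule euclidean_inner)
  show "integrable M (\<lambda>\<omega>. X \<omega> \<bullet> n \<omega>)"
    unfolding eq by (intro Bochner_Integration.integrable_sum coord)
  show "(LINT \<omega>|M. X \<omega> \<bullet> n \<omega>) = 0"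
    unfolding eq by (subst Bochner_Integration.integral_sum) (auto simp: coord)
qed

text \<open>A product of square-integrable variables is in general only integrable. Independence
  makes the product of the squared norms integrable, so the cross term is again
  square-integrable.\<close>

lemma inner_centered_sq:
  fixes X n :: "'w \<Rightarrow> 'b::euclidean_space"
  assumes X: "sqint M (F k) X" and n: "centered k n"
  shows "sqint M (F (Suc k)) (\<lambda>\<omega>. X \<omega> \<bullet> n \<omega>)"
    and "(LINT \<omega>|M. (X \<omega> \<bullet> n \<omega>)\<^sup>2) \<le> (LINT \<omega>|M. (norm (X \<omega>))\<^sup>2) * (LINT \<omega>|M. (norm (n \<omega>))\<^sup>2)"
proof -
  note prod = indep_FG_expectation[of "\<lambda>\<omega>. (norm (X \<omega>))\<^sup>2" k "\<lambda>\<omega>. (norm (n \<omega>))\<^sup>2"]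
  have prod: "integrable M (\<lambda>\<omega>. (norm (X \<omega>))\<^sup>2 * (norm (n \<omega>))\<^sup>2)"
    "(LINT \<omega>|M. (norm (X \<omega>))\<^sup>2 * (norm (n \<omega>))\<^sup>2) = (LINT \<omega>|M. (norm (X \<omega>))\<^sup>2) * (LINT \<omega>|M. (norm (n \<omega>))\<^sup>2)"
    using X n by (auto intro!: prod simp: sqint_def centered_def)
  have bound: "(X \<omega> \<bullet> n \<omega>)\<^sup>2 \<le> (norm (X \<omega>))\<^sup>2 * (norm (n \<omega>))\<^sup>2" for \<omega>
    using Cauchy_Schwarz_ineq[of "X \<omega>" "n \<omega>"] by (simp add: power2_norm_eq_inner)
  have meas: "(\<lambda>\<omega>. X \<omega> \<bullet> n \<omega>) \<in> borel_measurable (F (Suc k))"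
    using sqintD(1)[OF sqint_mono[OF X F_mono]] sqintD(1)[OF centered_sqint_F[OF n]] by measurable
  have int: "integrable M (\<lambda>\<omega>. (X \<omega> \<bullet> n \<omega>)\<^sup>2)"
    by (rule Bochner_Integration.integrable_bound[OF prod(1)])
      (use bound measurable_from_subalg[OF F_sub meas] in \<open>auto\<close>)
  then show "sqint M (F (Suc k)) (\<lambda>\<omega>. X \<omega> \<bullet> n \<omega>)"
    using meas by (simp add: sqint_def)
  show "(LINT \<omega>|M. (X \<omega> \<bullet> n \<omega>)\<^sup>2) \<le> (LINT \<omega>|M. (norm (X \<omega>))\<^sup>2) * (LINT \<omega>|M. (norm (n \<omega>))\<^sup>2)"
    unfolding prod(2)[symmetric] by (intro integral_mono int prod bound)
qed

text \<open>Centering given the past is encoded as orthogonality to the square-integrable variables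
  of the past, which is what second-moment computations consume. \<open>D k\<close> is revealed at
  time \<open>Suc k\<close>.\<close>

definition martingale_diff :: "(nat \<Rightarrow> 'w \<Rightarrow> real) \<Rightarrow> bool" where
  "martingale_diff D \<longleftrightarrow> (\<forall>k. sqint M (F (Suc k)) (D k)) \<and>
     (\<forall>k X. sqint M (F k) X \<longrightarrow> (LINT \<omega>|M. X \<omega> * D k \<omega>) = 0)"

text \<open>A scalar test variable from the past is absorbed into the predictable factor
  \<open>X k\<close>, which leaves an inner product with centered noise.\<close>

lemma martingale_diff_inner:
  fixes X n :: "nat \<Rightarrow> 'w \<Rightarrow> 'b::euclidean_space"
  assumes "\<And>k. sqint M (F k) (X k)" "\<And>k. centered k (n k)"
  shows "martingale_diff (\<lambda>k \<omega>. X k \<omega> \<bullet> n k \<omega>)"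
  unfolding martingale_diff_def
proof (intro conjI allI impI)
  show "sqint M (F (Suc k)) (\<lambda>\<omega>. X k \<omega> \<bullet> n k \<omega>)" for k
    by (rule inner_centered_sq(1)[OF assms])
  fix k and Y :: "'w \<Rightarrow> real" assume Y: "sqint M (F k) Y"
  have "integrable M (\<lambda>\<omega>. Y \<omega> *\<^sub>R X k \<omega>)"
    by (rule Bochner_Integration.integrable_bound[OF sqint_integrable_norm_mult[OF Y assms(1)[of k] F_sub F_sub]])
      (use measurable_from_subalg[OF F_sub sqintD(1)[OF Y]]
        measurable_from_subalg[OF F_sub sqintD(1)[OF assms(1)[of k]]] in auto)
  moreover have "(\<lambda>\<omega>. Y \<omega> *\<^sub>R X k \<omega>) \<in> borel_measurable (F k)"
    using sqintD(1)[OF Y] sqintD(1)[OF assms(1)[of k]] by measurable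
  ultimately show "(LINT \<omega>|M. Y \<omega> * (X k \<omega> \<bullet> n k \<omega>)) = 0"
    using integral_inner_centered(2)[OF _ _ assms(2)[of k], of "\<lambda>\<omega>. Y \<omega> *\<^sub>R X k \<omega>"] by simp
qed

text \<open>Kolmogorov's maximal inequality: stop the partial sums when they first reach \<open>\<epsilon>\<close> and apply
  Markov's inequality to the square of the stopped sum.\<close>
lemma martingale_maximal:
  assumes D: "martingale_diff D" and \<epsilon>: "\<epsilon> > 0" and "a \<le> N"
  shows "prob {\<omega> \<in> space M. \<exists>n\<in>{a..N}. \<epsilon> \<le> \<bar>\<Sum>k=a..<n. D k \<omega>\<bar>}
    \<le> (\<Sum>k=a..<N. LINT \<omega>|M. (D k \<omega>)\<^sup>2) / \<epsilon>\<^sup>2"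
proof -
  \<comment> \<open>The stopping indicator. The sums with \<open>n \<le> k\<close> involve
    \<open>D j\<close> for \<open>j < k\<close> only, so \<open>I k\<close> is known at time
    \<open>k\<close>, before \<open>D k\<close> is revealed, and \<open>S\<close> is the stopped
    sum.\<close>
  define I where "I k \<omega> = (if \<exists>n\<in>{a..k}. \<epsilon> \<le> \<bar>\<Sum>j=a..<n. D j \<omega>\<bar> then 0 else 1 :: real)" for k \<omega>
  define S where "S N \<omega> = (\<Sum>k=a..<N. I k \<omega> * D k \<omega>)" for N \<omega>
  have Dsq: "sqint M (F (Suc k)) (D k)" and orth: "sqint M (F k) X \<Longrightarrow> (LINT \<omega>|M. X \<omega> * D k \<omega>) = 0" for k X
    using D by (auto simp: martingale_diff_def)
  have D_meas: "D j \<in> borel_measurable (F k)" if "j < k" for j k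
    using sqintD(1)[OF sqint_mono[OF Dsq F_mono_le[of "Suc j" k]]] that by simp
  have I_meas: "I k \<in> borel_measurable (F k)" for k
  proof -
    have [measurable]: "(\<lambda>\<omega>. \<Sum>j=a..<n. D j \<omega>) \<in> borel_measurable (F k)" if "n \<in> {a..k}" for n
      using that D_meas by (intro borel_measurable_sum) auto
    show ?thesis unfolding I_def by measurable
  qed
  have I01: "\<bar>I k \<omega>\<bar> \<le> 1" for k \<omega> by (simp add: I_def)
  have ID: "sqint M (F (Suc k)) (\<lambda>\<omega>. I k \<omega> * D k \<omega>)" for k
    by (rule sqint_dominated[OF Dsq F_sub, of _ _ 1])
      (use I01 measurable_from_subalg[OF F_mono I_meas] sqintD(1)[OF Dsq] in \<open>auto simp: abs_mult mult_left_le_one_le\<close>)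
  have S: "sqint M (F k) (S k)" if "a \<le> k" for k
    using that
  proof (induction k rule: dec_induct)
    case base
    show ?case unfolding S_def by (rule sqint_bounded[of _ _ 0]) (auto simp: F_sub)
  next
    case (step k)
    then show ?case
      using sqint_add[OF sqint_mono[OF step.IH F_mono] ID F_sub] by (simp add: S_def)
  qed
  have E: "(LINT \<omega>|M. (S k \<omega>)\<^sup>2) \<le> (\<Sum>k=a..<k. LINT \<omega>|M. (D k \<omega>)\<^sup>2)" if "a \<le> k" for k
    using that
  proof (induction k rule: dec_induct)
    case base
    show ?case by (simp add: S_def)
  next
    case (step k)
    have SI: "sqint M (F k) (\<lambda>\<omega>. 2 * S k \<omega> * I k \<omega>)"
      by (rule sqint_dominated[OF S[OF step.hyps(1)] F_sub, of _ 2])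
        (use I01 I_meas sqintD(1)[OF S[OF step.hyps(1)]] in \<open>auto simp: abs_mult mult_left_le\<close>)
    have split: "(S (Suc k) \<omega>)\<^sup>2 = (S k \<omega>)\<^sup>2 + (2 * S k \<omega> * I k \<omega>) * D k \<omega> + (I k \<omega> * D k \<omega>)\<^sup>2" for \<omega>
      using step.hyps(1) by (simp add: S_def power2_eq_square algebra_simps)
    have "(LINT \<omega>|M. (S (Suc k) \<omega>)\<^sup>2)
        = (LINT \<omega>|M. (S k \<omega>)\<^sup>2) + (LINT \<omega>|M. (2 * S k \<omega> * I k \<omega>) * D k \<omega>) + (LINT \<omega>|M. (I k \<omega> * D k \<omega>)\<^sup>2)"
      unfolding split
      using sqintD(2)[OF S[OF step.hyps(1)]] sqintD(2)[OF ID[of k]]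
        sqint_integrable_inner[OF SI Dsq[of k] F_sub F_sub]
      by simp
    also have "\<dots> \<le> (\<Sum>k=a..<k. LINT \<omega>|M. (D k \<omega>)\<^sup>2) + 0 + (LINT \<omega>|M. (D k \<omega>)\<^sup>2)"
    proof (intro add_mono step.IH)
      show "(LINT \<omega>|M. (2 * S k \<omega> * I k \<omega>) * D k \<omega>) \<le> 0"
        using orth[OF SI] by simp
      show "(LINT \<omega>|M. (I k \<omega> * D k \<omega>)\<^sup>2) \<le> (LINT \<omega>|M. (D k \<omega>)\<^sup>2)"
        using sqintD(2)[OF ID[of k]] sqintD(2)[OF Dsq[of k]]
        by (intro integral_mono) (auto simp: I_def)
    qed
    finally show ?case using step.hyps(1) by simp
  qed
  have stop: "\<epsilon>\<^sup>2 \<le> (S N \<omega>)\<^sup>2" if n: "n \<in> {a..N}" "\<epsilon> \<le> \<bar>\<Sum>k=a..<n. D k \<omega>\<bar>" for n \<omega>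
  proof -
    \<comment> \<open>The first passage time: \<open>I\<close> is 1 before it and 0 from it on, so
      \<open>S N\<close> equals the partial sum at \<tau>, which has reached \<epsilon>.\<close>
    define \<tau> where "\<tau> = (LEAST n. a \<le> n \<and> \<epsilon> \<le> \<bar>\<Sum>k=a..<n. D k \<omega>\<bar>)"
    have \<tau>: "a \<le> \<tau> \<and> \<epsilon> \<le> \<bar>\<Sum>k=a..<\<tau>. D k \<omega>\<bar>"
      unfolding \<tau>_def by (rule LeastI[of _ n]) (use n in auto)
    have "\<tau> \<le> n" unfolding \<tau>_def by (rule Least_le) (use n in auto)
    have before: "I k \<omega> = 1" if "k < \<tau>" for k
    proof -
      have "\<not> (a \<le> n \<and> \<epsilon> \<le> \<bar>\<Sum>k=a..<n. D k \<omega>\<bar>)" if "n \<le> k" for n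
        by (rule not_less_Least, fold \<tau>_def) (use that \<open>k < \<tau>\<close> in simp)
      then show ?thesis by (auto simp: I_def)
    qed
    have after: "I k \<omega> = 0" if "\<tau> \<le> k" for k
      using that \<tau> by (auto simp: I_def)
    have "S N \<omega> = (\<Sum>k=a..<\<tau>. I k \<omega> * D k \<omega>) + (\<Sum>k=\<tau>..<N. I k \<omega> * D k \<omega>)"
      unfolding S_def using \<tau> \<open>\<tau> \<le> n\<close> n(1) by (intro sum.atLeastLessThan_concat[symmetric]) auto
    then have "S N \<omega> = (\<Sum>k=a..<\<tau>. D k \<omega>)"
      by (simp add: before after)
    then have "\<epsilon> \<le> \<bar>S N \<omega>\<bar>" using \<tau> by simp
    then show ?thesis using \<epsilon> by (metis abs_le_square_iff abs_of_pos)
  qed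
  have SN: "integrable M (\<lambda>\<omega>. (S N \<omega>)\<^sup>2)"
    using sqintD(2)[OF S[OF \<open>a \<le> N\<close>]] by simp
  have [measurable]: "S N \<in> borel_measurable M"
    by (rule measurable_from_subalg[OF F_sub sqintD(1)[OF S[OF \<open>a \<le> N\<close>]]])
  have "prob {\<omega> \<in> space M. \<exists>n\<in>{a..N}. \<epsilon> \<le> \<bar>\<Sum>k=a..<n. D k \<omega>\<bar>} \<le> prob {\<omega> \<in> space M. \<epsilon>\<^sup>2 \<le> (S N \<omega>)\<^sup>2}"
    using stop by (intro finite_measure_mono) auto
  also have "\<dots> \<le> (LINT \<omega>|M. (S N \<omega>)\<^sup>2) / \<epsilon>\<^sup>2"
    using integral_Markov_inequality_measure[OF SN, of "{}" "\<epsilon>\<^sup>2"] \<epsilon> by simp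
  also have "\<dots> \<le> (\<Sum>k=a..<N. LINT \<omega>|M. (D k \<omega>)\<^sup>2) / \<epsilon>\<^sup>2"
    using E[OF \<open>a \<le> N\<close>] by (intro divide_right_mono) auto
  finally show ?thesis .
qed

text \<open>The maximal inequality bounds the probability of any late fluctuation by a tail of the
  variance series, so almost surely the partial sums are Cauchy.\<close>

lemma martingale_summable:
  assumes D: "martingale_diff D" and sum: "summable (\<lambda>k. LINT \<omega>|M. (D k \<omega>)\<^sup>2)"
  shows "AE \<omega> in M. summable (\<lambda>k. D k \<omega>)"
proof -
  let ?v = "\<lambda>k. LINT \<omega>|M. (D k \<omega>)\<^sup>2"
  have [measurable]: "D k \<in> borel_measurable M" for k
    using D measurable_from_subalg[OF F_sub] by (auto simp: martingale_diff_def sqint_def)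
  define A where "A \<epsilon> a N = {\<omega> \<in> space M. \<exists>n\<in>{a..N}. \<epsilon> \<le> \<bar>\<Sum>k=a..<n. D k \<omega>\<bar>}" for \<epsilon> :: real and a N :: nat
  have [measurable]: "A \<epsilon> a N \<in> sets M" for \<epsilon> a N
    unfolding A_def by measurable
  have AE_tail: "AE \<omega> in M. \<exists>a. \<forall>N. \<omega> \<notin> A \<epsilon> a N" if \<epsilon>: "\<epsilon> > 0" for \<epsilon>
  proof -
    have le: "prob (\<Inter>a. \<Union>N. A \<epsilon> a N) \<le> (\<Sum>k. ?v (k + a)) / \<epsilon>\<^sup>2" for a
    proof -
      have "prob (\<Inter>a. \<Union>N. A \<epsilon> a N) \<le> prob (\<Union>N. A \<epsilon> a N)"
        by (intro finite_measure_mono) auto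
      \<comment> \<open>The events increase with the horizon \<open>N\<close>, so a bound uniform in
        \<open>N\<close> passes to their union.\<close>
      also have "\<dots> \<le> (\<Sum>k. ?v (k + a)) / \<epsilon>\<^sup>2"
      proof (rule LIMSEQ_le_const2)
        have "mono (A \<epsilon> a)" by (force simp: A_def mono_def)
        then show "(\<lambda>N. prob (A \<epsilon> a N)) \<longlonglongrightarrow> prob (\<Union>N. A \<epsilon> a N)"
          by (intro finite_Lim_measure_incseq) auto
        have "prob (A \<epsilon> a N) \<le> (\<Sum>k. ?v (k + a)) / \<epsilon>\<^sup>2" if "a \<le> N" for N
        proof -
          have "prob (A \<epsilon> a N) \<le> (\<Sum>k=a..<N. ?v k) / \<epsilon>\<^sup>2"
            unfolding A_def by (rule martingale_maximal[OF D \<epsilon> that])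
          also have "(\<Sum>k=a..<N. ?v k) = (\<Sum>k<N - a. ?v (k + a))"
            using that sum.shift_bounds_nat_ivl[of ?v 0 a "N - a"] by (simp add: atLeast0LessThan)
          also have "\<dots> \<le> (\<Sum>k. ?v (k + a))"
            using sum by (intro sum_le_suminf summable_ignore_initial_segment) auto
          finally show ?thesis by (simp add: divide_right_mono)
        qed
        then show "\<exists>N. \<forall>n\<ge>N. prob (A \<epsilon> a n) \<le> (\<Sum>k. ?v (k + a)) / \<epsilon>\<^sup>2" by blast
      qed
      finally show ?thesis .
    qed
    have "(\<lambda>a. (\<Sum>k. ?v (k + a)) / \<epsilon>\<^sup>2) \<longlonglongrightarrow> 0 / \<epsilon>\<^sup>2"
      using \<epsilon> by (intro tendsto_intros suminf_exist_split2 sum) auto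
    then have "prob (\<Inter>a. \<Union>N. A \<epsilon> a N) \<le> 0"
      using le by (intro LIMSEQ_le_const[of _ 0]) auto
    then have "prob (\<Inter>a. \<Union>N. A \<epsilon> a N) = 0"
      by (simp add: measure_le_0_iff)
    then have "(\<Inter>a. \<Union>N. A \<epsilon> a N) \<in> null_sets M"
      by (intro null_setsI) (auto simp: emeasure_eq_measure)
    from AE_not_in[OF this] show ?thesis by auto
  qed
  have "AE \<omega> in M. \<forall>j::nat. \<exists>a. \<forall>N. \<omega> \<notin> A (1 / Suc j) a N"
    by (subst AE_all_countable) (auto intro!: AE_tail)
  then show ?thesis
  proof (rule AE_mp, intro AE_I2 impI)
    fix \<omega> assume \<omega>: "\<omega> \<in> space M" "\<forall>j::nat. \<exists>a. \<forall>N. \<omega> \<notin> A (1 / Suc j) a N"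
    show "summable (\<lambda>k. D k \<omega>)"
      unfolding summable_Cauchy
    proof (intro allI impI)
      fix e :: real assume "e > 0"
      \<comment> \<open>Half of \<open>e\<close>, because a block from \<open>m\<close> to
        \<open>n\<close> is the difference of two sums that both start at \<open>a\<close>.\<close>
      then obtain j where j: "1 / real (Suc j) < e / 2"
        using nat_approx_posE[of "e / 2"] by auto
      obtain a where a: "\<And>N. \<omega> \<notin> A (1 / Suc j) a N"
        using \<omega>(2) by blast
      have small: "\<bar>\<Sum>k=a..<n. D k \<omega>\<bar> < e / 2" if "a \<le> n" for n
      proof -
        have "\<not> 1 / real (Suc j) \<le> \<bar>\<Sum>k=a..<n. D k \<omega>\<bar>"
          using a[of n] that \<omega>(1) unfolding A_def by (auto simp del: of_nat_Suc)
        then show ?thesis using j by linarith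
      qed
      have "norm (sum (\<lambda>k. D k \<omega>) {m..<n}) < e" if "a \<le> m" for m n
      proof (cases "m \<le> n")
        case True
        have "(\<Sum>k=m..<n. D k \<omega>) = (\<Sum>k=a..<n. D k \<omega>) - (\<Sum>k=a..<m. D k \<omega>)"
          using sum.atLeastLessThan_concat[OF that True, of "\<lambda>k. D k \<omega>"] by simp
        then show ?thesis
          using small[OF order.trans[OF that True]] small[OF that] unfolding real_norm_def by linarith
      qed (use \<open>e > 0\<close> in simp)
      then show "\<exists>N. \<forall>m\<ge>N. \<forall>n. norm (sum (\<lambda>k. D k \<omega>) {m..<n}) < e"
        by blast
    qed
  qed
qed

end

subsection \<open>Stochastic contractions\<close>

text \<open>A pathwise form of the Robbins-Siegmund lemma: \<open>v\<close> plus the accumulated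
  decrease minus the accumulated perturbation is decreasing and bounded below. The terms of
  \<open>a\<close> may have either sign and their series may converge only conditionally, as suits
  the martingale terms fed into it.\<close>

lemma almost_decreasing_converges:
  fixes v d a :: "nat \<Rightarrow> real"
  assumes v: "\<And>k. K \<le> k \<Longrightarrow> 0 \<le> v k" and d: "\<And>k. K \<le> k \<Longrightarrow> 0 \<le> d k"
    and step: "\<And>k. K \<le> k \<Longrightarrow> v (Suc k) \<le> v k - d k + a k"
    and a: "summable a"
  shows "convergent v" "summable d"
proof -
  let ?D = "\<lambda>n. \<Sum>i<n. d (i + K)" and ?A = "\<lambda>n. \<Sum>i<n. a (i + K)"
  have sA: "summable (\<lambda>i. a (i + K))"
    using a by (rule summable_ignore_initial_segment)
  then have "Bseq ?A"
    unfolding summable_iff_convergent by (rule convergent_imp_Bseq)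
  then obtain B where B: "\<And>n. \<bar>?A n\<bar> \<le> B"
    by (auto simp: Bseq_def)
  have total: "v (n + K) + ?D n \<le> v K + ?A n" for n
  proof (induction n)
    case (Suc n)
    then show ?case using step[of "n + K"] by simp
  qed simp
  have "?D n \<le> v K + B" for n
    using total[of n] B[of n] v[of "n + K"] by simp
  then have sD: "summable (\<lambda>i. d (i + K))"
    by (intro summableI_nonneg_bounded[of _ "v K + B"]) (auto simp: d)
  then show "summable d" by simp
  define w where "w n = v (n + K) + ?D n - ?A n" for n
  have "decseq w"
    unfolding decseq_Suc_iff w_def using step by (auto simp: algebra_simps)
  moreover have "- B \<le> w n" for n
    using B[of n] v[of "n + K"] sum_nonneg[of "{..<n}" "\<lambda>i. d (i + K)"] d
    by (simp add: w_def)
  ultimately have "convergent w"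
    using decseq_convergent[of w "- B"] by (metis convergentI)
  moreover have "convergent ?D" "convergent ?A"
    using sA sD unfolding summable_iff_convergent by blast+
  ultimately have "convergent (\<lambda>n. w n - ?D n + ?A n)"
    by (intro convergent_add convergent_diff)
  then have "convergent (\<lambda>n. v (n + K))" by (simp add: w_def)
  then show "convergent v" by (simp add: convergent_ignore_initial_segment)
qed

text \<open>Up to \<open>s k\<close> the step is a convex combination of \<open>v k\<close> and
  \<open>c\<close>, so from \<open>K\<close> on the positive part of \<open>v - c\<close> grows by
  at most \<open>s k\<close>.\<close>

lemma bounded_of_contraction:
  fixes v \<rho> s :: "nat \<Rightarrow> real"
  assumes \<rho>: "\<And>k. K \<le> k \<Longrightarrow> 0 \<le> \<rho> k \<and> \<rho> k \<le> 1"
    and step: "\<And>k. K \<le> k \<Longrightarrow> v (Suc k) \<le> (1 - \<rho> k) * v k + \<rho> k * c + s k"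
    and s: "summable s" "\<And>k. 0 \<le> s k"
  shows "\<exists>b. \<forall>k. v k \<le> b"
proof -
  have "convergent (\<lambda>k. max (v k - c) 0)"
  proof (rule almost_decreasing_converges(1)[where K = K and d = "\<lambda>_. 0" and a = s])
    fix k assume k: "K \<le> k"
    have "v (Suc k) - c \<le> (1 - \<rho> k) * (v k - c) + s k"
      using step[OF k] by (simp add: algebra_simps)
    also have "(1 - \<rho> k) * (v k - c) \<le> (1 - \<rho> k) * max (v k - c) 0"
      using \<rho>[OF k] by (intro mult_left_mono) auto
    also have "\<dots> \<le> max (v k - c) 0"
      using \<rho>[OF k] by (intro mult_left_le_one_le) auto
    finally show "max (v (Suc k) - c) 0 \<le> max (v k - c) 0 - 0 + s k"
      using s(2)[of k] by auto
  qed (use s in auto)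
  then obtain B where "\<And>k. norm (max (v k - c) 0) \<le> B"
    using convergent_imp_Bseq BseqE by metis
  then have "v k \<le> c + B" for k
    by (smt (verit) real_norm_def)
  then show ?thesis by blast
qed

text \<open>A positive limit would make \<rho> eventually dominated by a multiple of the summable
  \<open>\<rho> k * v k\<close>.\<close>

lemma limit_zero_of_weighted_summable:
  fixes v \<rho> :: "nat \<Rightarrow> real"
  assumes "convergent v" and pos: "\<forall>\<^sub>F k in sequentially. 0 \<le> v k \<and> 0 \<le> \<rho> k"
    and sum: "summable (\<lambda>k. \<rho> k * v k)" and div: "\<not> summable \<rho>"
  shows "v \<longlonglongrightarrow> 0"
proof -
  obtain l where l: "v \<longlonglongrightarrow> l" using assms(1) by (auto simp: convergent_def)
  have "l \<ge> 0"
    by (rule tendsto_lowerbound[OF l]) (use pos in \<open>auto elim: eventually_mono\<close>)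
  moreover have "\<not> l > 0"
  proof
    assume "l > 0"
    then have "\<forall>\<^sub>F k in sequentially. l / 2 < v k"
      using l by (intro order_tendstoD(1)[of v l]) auto
    then have "\<forall>\<^sub>F k in sequentially. norm (\<rho> k) \<le> 2 / l * (\<rho> k * v k)"
      using pos
    proof eventually_elim
      case (elim k)
      then have "\<rho> k * (l / 2) \<le> \<rho> k * v k" by (intro mult_left_mono) auto
      then show ?case using \<open>l > 0\<close> elim by (simp add: field_simps)
    qed
    then have "summable \<rho>"
      by (rule summable_comparison_test_ev) (intro summable_mult sum)
    then show False using div by blast
  qed
  ultimately show ?thesis using l by simp
qed

lemma frequently_small_of_weighted_summable:
  fixes g \<rho> :: "nat \<Rightarrow> real"
  assumes \<rho>: "\<And>k. 0 \<le> \<rho> k" and g: "\<And>k. 0 \<le> g k"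
    and sum: "summable (\<lambda>k. \<rho> k * (g k)\<^sup>2)" and div: "\<not> summable \<rho>" and e: "e > 0"
  shows "\<exists>\<^sub>F k in sequentially. g k < e"
proof (rule ccontr)
  assume "\<not> ?thesis"
  then have "\<forall>\<^sub>F k in sequentially. e \<le> g k"
    by (simp add: not_frequently not_less)
  then have "\<forall>\<^sub>F k in sequentially. norm (\<rho> k) \<le> 1 / e\<^sup>2 * (\<rho> k * (g k)\<^sup>2)"
  proof eventually_elim
    case (elim k)
    then have "\<rho> k * e\<^sup>2 \<le> \<rho> k * (g k)\<^sup>2"
      using e \<rho> by (intro mult_left_mono power_mono) auto
    then show ?case using e \<rho>[of k] by (simp add: field_simps)
  qed
  then have "summable \<rho>"
    by (rule summable_comparison_test_ev) (intro summable_mult sum)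
  then show False using div by blast
qed

lemma series_diverges_not_summable: "series_diverges a \<Longrightarrow> \<not> summable a"
  unfolding series_diverges_def
  using not_tendsto_and_filterlim_at_infinity[OF sequentially_bot, of "\<lambda>n. \<Sum>k<n. a k"]
    filterlim_at_top_imp_at_infinity summable_LIMSEQ by blast

text \<open>By monotone convergence the sum has finite expectation, hence is finite almost
  everywhere.\<close>

lemma AE_summable_of_summable_integral:
  fixes g :: "nat \<Rightarrow> 'w \<Rightarrow> real"
  assumes nonneg: "\<And>k \<omega>. \<omega> \<in> space M \<Longrightarrow> 0 \<le> g k \<omega>"
    and int: "\<And>k. integrable M (g k)"
    and sum: "summable (\<lambda>k. LINT \<omega>|M. g k \<omega>)"
  shows "AE \<omega> in M. summable (\<lambda>k. g k \<omega>)"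
proof -
  have [measurable]: "g k \<in> borel_measurable M" for k using int by auto
  have pos: "0 \<le> (LINT \<omega>|M. g k \<omega>)" for k
    using nonneg by (intro integral_nonneg_AE AE_I2)
  have "(\<integral>\<^sup>+\<omega>. (\<Sum>k. ennreal (g k \<omega>)) \<partial>M) = (\<Sum>k. \<integral>\<^sup>+\<omega>. ennreal (g k \<omega>) \<partial>M)"
    by (rule nn_integral_suminf) measurable
  also have "\<dots> = (\<Sum>k. ennreal (LINT \<omega>|M. g k \<omega>))"
    using nonneg int by (intro suminf_cong nn_integral_eq_integral) auto
  also have "\<dots> = ennreal (\<Sum>k. LINT \<omega>|M. g k \<omega>)"
    using pos sum by (rule suminf_ennreal2)
  finally have "(\<integral>\<^sup>+\<omega>. (\<Sum>k. ennreal (g k \<omega>)) \<partial>M) \<noteq> \<infinity>" by simp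
  then have "AE \<omega> in M. (\<Sum>k. ennreal (g k \<omega>)) \<noteq> \<infinity>"
    by (intro nn_integral_PInf_AE) measurable
  then show ?thesis
    using AE_space
  proof eventually_elim
    case (elim \<omega>)
    then show ?case using nonneg by (intro summable_suminf_not_top) auto
  qed
qed

section \<open>The energy recursion of a contracting process\<close>

lemma integrable_energy:
  fixes P :: "'b::euclidean_space \<Rightarrow> 'b"
  assumes "sqint M N Z" "subalgebra M N" "energy_form P \<kappa>"
  shows "integrable M (\<lambda>\<omega>. Z \<omega> \<bullet> P (Z \<omega>))"
  by (rule sqint_integrable_inner[OF assms(1) sqint_linear[OF assms(1,2) energy_formD(1)[OF assms(3)]] assms(2,2)])

text \<open>The drift \<open>r\<close> is split off by Young's inequality, at the price
  \<open>1 / \<rho>\<close>. The noise \<open>n\<close> is expanded exactly: its cross term has mean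
  zero, and an estimate by absolute values would destroy this.\<close>

lemma energy_step:
  assumes P: "energy_form P \<kappa>" and \<rho>: "0 < \<rho>" "\<rho> \<le> 1"
    and b: "b \<bullet> P b \<le> (1 - \<rho>) * (z \<bullet> P z)"
  shows "(b + r + n) \<bullet> P (b + r + n)
    \<le> (1 - \<rho> / 2) * (z \<bullet> P z) + (3 * \<kappa> / \<rho> * (norm r)\<^sup>2 + \<kappa> * (norm n)\<^sup>2 + 2 * ((b + r) \<bullet> P n))"
proof -
  have "(b + r) \<bullet> P (b + r) \<le> (1 - \<rho> / 2) * (z \<bullet> P z) + 3 / \<rho> * (r \<bullet> P r)"
    by (rule energy_form_contract_add_le[OF P \<rho> b energy_form_nonneg[OF P]])
  also have "3 / \<rho> * (r \<bullet> P r) \<le> 3 / \<rho> * (\<kappa> * (norm r)\<^sup>2)"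
    using \<rho> by (intro mult_left_mono energy_formD(4)[OF P]) auto
  finally show ?thesis
    using energy_formD(4)[OF P, of n] by (simp only: energy_form_add[OF P, of "b + r" n]) simp
qed

text \<open>The common shape of all error recursions: \<open>b\<close> is the contracted old error,
  \<open>r\<close> an adapted drift, \<open>n\<close> a fresh noise. Contraction is demanded from
  \<open>K\<close> on, where the stepsizes have become small.\<close>

locale contracting_process = noise_filtration M F G for M :: "'w measure" and F G +
  fixes P :: "'b::euclidean_space \<Rightarrow> 'b" and \<kappa> :: real and K :: nat and \<rho> :: "nat \<Rightarrow> real"
    and Z b r n :: "nat \<Rightarrow> 'w \<Rightarrow> 'b"
  assumes P: "energy_form P \<kappa>"
    and \<rho>: "\<And>k. K \<le> k \<Longrightarrow> 0 < \<rho> k \<and> \<rho> k \<le> 1"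
    and Z: "sqint M (F k) (Z k)" and b: "sqint M (F k) (b k)" and r: "sqint M (F k) (r k)"
    and n: "centered k (n k)"
    and step: "\<And>k \<omega>. \<omega> \<in> space M \<Longrightarrow> Z (Suc k) \<omega> = b k \<omega> + r k \<omega> + n k \<omega>"
    and contract: "\<And>k \<omega>. K \<le> k \<Longrightarrow> \<omega> \<in> space M \<Longrightarrow>
      b k \<omega> \<bullet> P (b k \<omega>) \<le> (1 - \<rho> k) * (Z k \<omega> \<bullet> P (Z k \<omega>))"
    and noise: "summable (\<lambda>k. LINT \<omega>|M. (norm (n k \<omega>))\<^sup>2)"
begin

definition energy :: "nat \<Rightarrow> 'w \<Rightarrow> real" where "energy k \<omega> = Z k \<omega> \<bullet> P (Z k \<omega>)"

lemma energy_nonneg: "0 \<le> energy k \<omega>"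
  unfolding energy_def by (rule energy_form_nonneg[OF P])

lemma \<kappa>_nonneg: "0 \<le> \<kappa>"
  by (rule energy_form_bound_nonneg[OF P])

lemma integrable_process_energy: "integrable M (energy k)"
  unfolding energy_def by (rule integrable_energy[OF Z F_sub P])

lemma n_sq: "integrable M (\<lambda>\<omega>. (norm (n k \<omega>))\<^sup>2)"
  using n by (simp add: centered_def sqint_def)

lemma Pn: "centered k (\<lambda>\<omega>. P (n k \<omega>))"
  by (rule centered_linear[OF n energy_formD(1)[OF P]])

lemma br: "sqint M (F k) (\<lambda>\<omega>. b k \<omega> + r k \<omega>)"
  by (rule sqint_add[OF b r F_sub])

text \<open>Drift part, squared noise part and a martingale difference. The last one drops out in
  expectation and is handled by martingale convergence along paths.\<close>

definition defect :: "nat \<Rightarrow> 'w \<Rightarrow> real" where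
  "defect k \<omega> = 3 * \<kappa> / \<rho> k * (norm (r k \<omega>))\<^sup>2 + \<kappa> * (norm (n k \<omega>))\<^sup>2 + 2 * ((b k \<omega> + r k \<omega>) \<bullet> P (n k \<omega>))"

lemma energy_Suc_le:
  "K \<le> k \<Longrightarrow> \<omega> \<in> space M \<Longrightarrow> energy (Suc k) \<omega> \<le> (1 - \<rho> k / 2) * energy k \<omega> + defect k \<omega>"
  unfolding energy_def defect_def by (simp only: step) (rule energy_step[OF P]; use \<rho> contract in simp)

lemma integral_defect:
  shows "integrable M (defect k)"
    and "(LINT \<omega>|M. defect k \<omega>)
      = 3 * \<kappa> / \<rho> k * (LINT \<omega>|M. (norm (r k \<omega>))\<^sup>2) + \<kappa> * (LINT \<omega>|M. (norm (n k \<omega>))\<^sup>2)"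
  using integral_inner_centered[OF sqintD(1)[OF br] sqint_integrable[OF br F_sub] Pn, of k]
    n_sq[of k] sqintD(2)[OF r, of k]
  by (simp_all add: defect_def[abs_def])

lemma expected_energy_Suc_le:
  assumes "K \<le> k"
  shows "(LINT \<omega>|M. energy (Suc k) \<omega>) \<le> (1 - \<rho> k / 2) * (LINT \<omega>|M. energy k \<omega>)
    + 3 * \<kappa> / \<rho> k * (LINT \<omega>|M. (norm (r k \<omega>))\<^sup>2) + \<kappa> * (LINT \<omega>|M. (norm (n k \<omega>))\<^sup>2)"
proof -
  have "(LINT \<omega>|M. energy (Suc k) \<omega>) \<le> (LINT \<omega>|M. (1 - \<rho> k / 2) * energy k \<omega> + defect k \<omega>)"
    using energy_Suc_le[OF assms] integrable_process_energy integral_defect(1)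
    by (intro integral_mono) auto
  then show ?thesis
    using integrable_process_energy integral_defect by simp
qed

lemma norm_sq_le_energy: "(LINT \<omega>|M. (norm (Z k \<omega>))\<^sup>2) \<le> (LINT \<omega>|M. energy k \<omega>)"
  using energy_formD(3)[OF P] integrable_process_energy sqintD(2)[OF Z]
  unfolding energy_def[abs_def] by (intro integral_mono) auto

text \<open>A drift of the order of the rate itself balances the contraction, which yields
  boundedness but no decay.\<close>

lemma second_moment_bounded:
  assumes "\<And>k. K \<le> k \<Longrightarrow> (LINT \<omega>|M. (norm (r k \<omega>))\<^sup>2) \<le> c * (\<rho> k)\<^sup>2"
  shows "\<exists>B. \<forall>k. (LINT \<omega>|M. (norm (Z k \<omega>))\<^sup>2) \<le> B"
proof -
  have "\<exists>B. \<forall>k. (LINT \<omega>|M. energy k \<omega>) \<le> B"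
  \<comment> \<open>The level \<open>6 * \<kappa> * c\<close> arises by writing the drift term
    \<open>3 * \<kappa> / \<rho> k * (c * (\<rho> k)\<^sup>2)\<close> as the rate
    \<open>\<rho> k / 2\<close> times a constant.\<close>
  proof (rule bounded_of_contraction[where \<rho> = "\<lambda>k. \<rho> k / 2" and K = K and c = "6 * \<kappa> * c"
        and s = "\<lambda>k. \<kappa> * (LINT \<omega>|M. (norm (n k \<omega>))\<^sup>2)"])
    fix k assume k: "K \<le> k"
    have "3 * \<kappa> / \<rho> k * (LINT \<omega>|M. (norm (r k \<omega>))\<^sup>2) \<le> 3 * \<kappa> / \<rho> k * (c * (\<rho> k)\<^sup>2)"
      using assms[OF k] \<rho>[OF k] \<kappa>_nonneg by (intro mult_left_mono) auto
    also have "\<dots> = \<rho> k / 2 * (6 * \<kappa> * c)"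
      using \<rho>[OF k] by (simp add: power2_eq_square)
    finally show "(LINT \<omega>|M. energy (Suc k) \<omega>) \<le> (1 - \<rho> k / 2) * (LINT \<omega>|M. energy k \<omega>)
        + \<rho> k / 2 * (6 * \<kappa> * c) + \<kappa> * (LINT \<omega>|M. (norm (n k \<omega>))\<^sup>2)"
      using expected_energy_Suc_le[OF k] by simp
  qed (use \<rho> noise \<kappa>_nonneg in \<open>force intro: summable_mult\<close>)+
  then show ?thesis
    using norm_sq_le_energy order_trans by blast
qed

text \<open>The regime of decay: the squared drift stays summable after the division by the rate
  that Young's inequality costs.\<close>

context
  assumes drift: "summable (\<lambda>k. (LINT \<omega>|M. (norm (r k \<omega>))\<^sup>2) / \<rho> k)"
begin

lemma summable_expected_energy:
  "convergent (\<lambda>k. LINT \<omega>|M. energy k \<omega>)" "summable (\<lambda>k. \<rho> k * (LINT \<omega>|M. energy k \<omega>))"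
proof -
  let ?a = "\<lambda>k. 3 * \<kappa> * ((LINT \<omega>|M. (norm (r k \<omega>))\<^sup>2) / \<rho> k) + \<kappa> * (LINT \<omega>|M. (norm (n k \<omega>))\<^sup>2)"
  have v: "0 \<le> (LINT \<omega>|M. energy k \<omega>)" for k
    by (intro Bochner_Integration.integral_nonneg energy_nonneg)
  have d: "0 \<le> \<rho> k / 2 * (LINT \<omega>|M. energy k \<omega>)" if "K \<le> k" for k
    using \<rho>[OF that] v[of k] by simp
  have s: "(LINT \<omega>|M. energy (Suc k) \<omega>) \<le> (LINT \<omega>|M. energy k \<omega>) - \<rho> k / 2 * (LINT \<omega>|M. energy k \<omega>) + ?a k"
    if "K \<le> k" for k
    using expected_energy_Suc_le[OF that] by (simp add: algebra_simps)
  have a: "summable ?a"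
    by (intro summable_add summable_mult drift noise)
  show "convergent (\<lambda>k. LINT \<omega>|M. energy k \<omega>)"
    by (rule almost_decreasing_converges(1)[OF v d s a])
  have "summable (\<lambda>k. \<rho> k / 2 * (LINT \<omega>|M. energy k \<omega>))"
    by (rule almost_decreasing_converges(2)[OF v d s a])
  from summable_mult[OF this, of 2] show "summable (\<lambda>k. \<rho> k * (LINT \<omega>|M. energy k \<omega>))" by simp
qed

lemma bounded_expected_energy: "\<exists>B. \<forall>k. (LINT \<omega>|M. energy k \<omega>) \<le> B"
proof -
  obtain B where "\<And>k. \<bar>LINT \<omega>|M. energy k \<omega>\<bar> \<le> B"
    using convergent_imp_Bseq[OF summable_expected_energy(1)] by (auto simp: Bseq_def)
  then show ?thesis by (meson abs_le_D1)
qed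

lemma summable_second_moment: "summable (\<lambda>k. \<rho> k * (LINT \<omega>|M. (norm (Z k \<omega>))\<^sup>2))"
proof (rule summable_comparison_test_ev[OF _ summable_expected_energy(2)])
  show "\<forall>\<^sub>F k in sequentially. norm (\<rho> k * (LINT \<omega>|M. (norm (Z k \<omega>))\<^sup>2)) \<le> \<rho> k * (LINT \<omega>|M. energy k \<omega>)"
    using eventually_ge_at_top[of K]
  proof eventually_elim
    case (elim k)
    then show ?case
      using \<rho>[of k] norm_sq_le_energy[of k] by (simp add: abs_mult)
  qed
qed

lemma second_moment_bounded': "\<exists>B. \<forall>k. (LINT \<omega>|M. (norm (Z k \<omega>))\<^sup>2) \<le> B"
  using bounded_expected_energy norm_sq_le_energy order_trans by blast

text \<open>\<open>b\<close> inherits a bounded second moment from the energy, \<open>r\<close> is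
  eventually bounded in mean square, and independence bounds each variance by a constant times the
  second moment of the noise, which is summable.\<close>

lemma summable_cross_variance:
  "summable (\<lambda>k. LINT \<omega>|M. ((b k \<omega> + r k \<omega>) \<bullet> P (n k \<omega>))\<^sup>2)"
proof -
  obtain B where B: "\<And>k. (LINT \<omega>|M. energy k \<omega>) \<le> B"
    using bounded_expected_energy by blast
  obtain C where C: "\<And>x. norm (P x) \<le> C * norm x"
    using linear_bounded[OF energy_formD(1)[OF P]] by blast
  \<comment> \<open>Together with \<open>\<rho> k \<le> 1\<close> this bounds the second moment of
    \<open>r k\<close> itself by 1.\<close>
  have "\<forall>\<^sub>F k in sequentially. (LINT \<omega>|M. (norm (r k \<omega>))\<^sup>2) / \<rho> k < 1"
    using order_tendstoD(2)[OF summable_LIMSEQ_zero[OF drift]] by simp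
  then have "\<forall>\<^sub>F k in sequentially. norm (LINT \<omega>|M. ((b k \<omega> + r k \<omega>) \<bullet> P (n k \<omega>))\<^sup>2)
      \<le> (2 * B + 2) * (C\<^sup>2 * (LINT \<omega>|M. (norm (n k \<omega>))\<^sup>2))"
    using eventually_ge_at_top[of K]
  proof eventually_elim
    case (elim k)
    have "(LINT \<omega>|M. (norm (b k \<omega>))\<^sup>2) \<le> (LINT \<omega>|M. energy k \<omega>)"
    proof (rule integral_mono)
      fix \<omega> assume "\<omega> \<in> space M"
      have "(norm (b k \<omega>))\<^sup>2 \<le> (1 - \<rho> k) * energy k \<omega>"
        unfolding energy_def using energy_formD(3)[OF P] contract[OF elim(2) \<open>\<omega> \<in> space M\<close>] order_trans by blast
      also have "\<dots> \<le> energy k \<omega>"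
        using \<rho>[OF elim(2)] energy_nonneg by (intro mult_left_le_one_le) auto
      finally show "(norm (b k \<omega>))\<^sup>2 \<le> energy k \<omega>" .
    qed (use sqintD(2)[OF b] integrable_process_energy in auto)
    then have bB: "(LINT \<omega>|M. (norm (b k \<omega>))\<^sup>2) \<le> B"
      using B[of k] by linarith
    have r1: "(LINT \<omega>|M. (norm (r k \<omega>))\<^sup>2) \<le> 1"
      using elim(1) \<rho>[OF elim(2)] by (simp add: field_simps)
    have "(LINT \<omega>|M. (norm (b k \<omega> + r k \<omega>))\<^sup>2) \<le> (LINT \<omega>|M. 2 * (norm (b k \<omega>))\<^sup>2 + 2 * (norm (r k \<omega>))\<^sup>2)"
      using sqintD(2)[OF br] sqintD(2)[OF b] sqintD(2)[OF r] norm_add_sq_le by (intro integral_mono) auto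
    also have "\<dots> \<le> 2 * B + 2"
      using sqintD(2)[OF b] sqintD(2)[OF r] bB r1 by simp
    finally have br2: "(LINT \<omega>|M. (norm (b k \<omega> + r k \<omega>))\<^sup>2) \<le> 2 * B + 2" .
    have "(LINT \<omega>|M. (norm (P (n k \<omega>)))\<^sup>2) \<le> (LINT \<omega>|M. C\<^sup>2 * (norm (n k \<omega>))\<^sup>2)"
    proof (rule integral_mono)
      show "integrable M (\<lambda>\<omega>. (norm (P (n k \<omega>)))\<^sup>2)"
        using Pn[of k] by (simp add: centered_def sqint_def)
      show "(norm (P (n k \<omega>)))\<^sup>2 \<le> C\<^sup>2 * (norm (n k \<omega>))\<^sup>2" for \<omega>
        using C[of "n k \<omega>"] by (simp flip: power_mult_distrib add: power_mono)
    qed (use n_sq in simp)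
    also have "\<dots> = C\<^sup>2 * (LINT \<omega>|M. (norm (n k \<omega>))\<^sup>2)"
      by simp
    finally have "(LINT \<omega>|M. (norm (b k \<omega> + r k \<omega>))\<^sup>2) * (LINT \<omega>|M. (norm (P (n k \<omega>)))\<^sup>2)
        \<le> (2 * B + 2) * (C\<^sup>2 * (LINT \<omega>|M. (norm (n k \<omega>))\<^sup>2))"
      by (intro mult_mono br2) (auto intro: order_trans[OF _ br2])
    then show ?case
      using inner_centered_sq(2)[OF br Pn, of k] by simp
  qed
  then show ?thesis
    by (rule summable_comparison_test_ev) (intro summable_mult noise)
qed

lemma AE_summable_defect: "AE \<omega> in M. summable (\<lambda>k. defect k \<omega>)"
proof -
  \<comment> \<open>The shift skips the indices below \<open>K\<close>, where \<rho> may fail to be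
    positive, so that all terms are nonnegative.\<close>
  have "AE \<omega> in M. summable (\<lambda>k. (norm (r (k + K) \<omega>))\<^sup>2 / \<rho> (k + K))"
  proof (rule AE_summable_of_summable_integral)
    have "summable (\<lambda>k. (LINT \<omega>|M. (norm (r (k + K) \<omega>))\<^sup>2) / \<rho> (k + K))"
      by (rule summable_ignore_initial_segment[OF drift])
    then show "summable (\<lambda>k. LINT \<omega>|M. (norm (r (k + K) \<omega>))\<^sup>2 / \<rho> (k + K))" by simp
    show "integrable M (\<lambda>\<omega>. (norm (r (k + K) \<omega>))\<^sup>2 / \<rho> (k + K))" for k
      using sqintD(2)[OF r, of "k + K"] by simp
    show "0 \<le> (norm (r (k + K) \<omega>))\<^sup>2 / \<rho> (k + K)" for k \<omega>
      using \<rho>[of "k + K"] by simp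
  qed
  moreover have "AE \<omega> in M. summable (\<lambda>k. (norm (n k \<omega>))\<^sup>2)"
    by (rule AE_summable_of_summable_integral[OF _ n_sq noise]) simp
  moreover have "AE \<omega> in M. summable (\<lambda>k. (b k \<omega> + r k \<omega>) \<bullet> P (n k \<omega>))"
    by (rule martingale_summable[OF martingale_diff_inner[OF br Pn] summable_cross_variance])
  ultimately show ?thesis
  proof eventually_elim
    case (elim \<omega>)
    have "summable (\<lambda>k. (norm (r k \<omega>))\<^sup>2 / \<rho> k)"
      using elim(1) by (rule summable_iff_shift[THEN iffD1])
    from summable_mult[OF this, of "3 * \<kappa>"] show ?case
      unfolding defect_def by (intro summable_add summable_mult elim(2,3)) simp
  qed
qed

text \<open>Along almost every path the energy converges and is summable against \<rho>; divergence
  of the rates then forces its limit to be 0.\<close>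

lemma AE_tendsto_zero:
  assumes "\<not> summable \<rho>"
  shows "AE \<omega> in M. (\<lambda>k. Z k \<omega>) \<longlonglongrightarrow> 0"
  using AE_summable_defect AE_space
proof eventually_elim
  case (elim \<omega>)
  have v: "0 \<le> energy k \<omega>" for k by (rule energy_nonneg)
  have d: "0 \<le> \<rho> k / 2 * energy k \<omega>" if "K \<le> k" for k
    using \<rho>[OF that] v[of k] by simp
  have s: "energy (Suc k) \<omega> \<le> energy k \<omega> - \<rho> k / 2 * energy k \<omega> + defect k \<omega>" if "K \<le> k" for k
    using energy_Suc_le[OF that elim(2)] by (simp add: algebra_simps)
  have "convergent (\<lambda>k. energy k \<omega>)"
    by (rule almost_decreasing_converges(1)[OF v d s elim(1)])
  moreover have "summable (\<lambda>k. \<rho> k / 2 * energy k \<omega>)"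
    by (rule almost_decreasing_converges(2)[OF v d s elim(1)])
  from summable_mult[OF this, of 2] have "summable (\<lambda>k. \<rho> k * energy k \<omega>)" by simp
  moreover have "\<forall>\<^sub>F k in sequentially. 0 \<le> energy k \<omega> \<and> 0 \<le> \<rho> k"
    using eventually_ge_at_top[of K] by eventually_elim (use \<rho> v in force)
  ultimately have null: "(\<lambda>k. energy k \<omega>) \<longlonglongrightarrow> 0"
    using assms by (intro limit_zero_of_weighted_summable)
  have "(\<lambda>k. (norm (Z k \<omega>))\<^sup>2) \<longlonglongrightarrow> 0"
    by (rule Lim_null_comparison[OF _ null]) (simp add: energy_def energy_formD(3)[OF P])
  from tendsto_real_sqrt[OF this] show ?case
    by (simp add: tendsto_norm_zero_iff)
qed

end

end

subsection \<open>Filtrations of independent noise and mixing Laplacians\<close>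

text \<open>\<open>T\<close> carries the whole noise process. Its independence of \<open>A\<close>,
  together with independence in time, makes \<open>A\<close> and all the \<open>G k\<close> one
  independent family, and grouping that family into past and present yields the filtration.\<close>

lemma (in prob_space) noise_filtration_of_independent:
  assumes A: "subalgebra M A" and T: "subalgebra M T" and AT: "indep_set (sets A) (sets T)"
    and G: "\<And>k. subalgebra T (G k)" and indep: "indep_sets (\<lambda>k. sets (G k)) UNIV"
  shows "noise_filtration M (\<lambda>k. sigma (space M) (sets A \<union> (\<Union>j<k. sets (G j)))) G"
proof -
  \<comment> \<open>\<open>None\<close> indexes the initial data, \<open>Some k\<close> the noise of
    time \<open>k\<close>.\<close>
  define E where "E i = (case i of None \<Rightarrow> sets A | Some k \<Rightarrow> sets (G k))" for i
  have GM: "subalgebra M (G k)" for k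
    using T G[of k] by (auto simp: subalgebra_def)
  have E_events: "E i \<subseteq> events" for i
    using A GM by (cases i) (auto simp: E_def subalgebra_def)
  have indep_E: "indep_sets E UNIV"
  proof (rule indep_setsI)
    fix S :: "nat option \<Rightarrow> 'a set" and J assume J: "J \<noteq> {}" "finite J" and S: "\<forall>j\<in>J. S j \<in> E j"
    define J' where "J' = {k. Some k \<in> J}"
    have J': "finite J'"
      unfolding J'_def using J(2) by (rule finite_vimageI[unfolded vimage_def]) simp
    have S': "S (Some k) \<in> sets (G k)" if "k \<in> J'" for k
      using S that by (force simp: J'_def E_def)
    have prod: "prob (\<Inter>k\<in>J'. S (Some k)) = (\<Prod>k\<in>J'. prob (S (Some k)))" if "J' \<noteq> {}"
      using indep_setsD[OF indep, of J' "\<lambda>k. S (Some k)"] that J' S' by auto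
    show "prob (\<Inter>j\<in>J. S j) = (\<Prod>j\<in>J. prob (S j))"
    proof (cases "None \<in> J")
      case False
      then have eq: "J = Some ` J'"
        by (auto simp: J'_def image_iff) (metis not_None_eq)
      then show ?thesis
        using prod J(1) by (simp add: prod.reindex image_comp)
    next
      case True
      then have eq: "J = insert None (Some ` J')"
        by (auto simp: J'_def image_iff) (metis not_None_eq)
      show ?thesis
      proof (cases "J' = {}")
        case False
        have "S (Some k) \<in> sets T" if "k \<in> J'" for k
          using S'[OF that] G[of k] by (auto simp: subalgebra_def)
        then have "(\<Inter>k\<in>J'. S (Some k)) \<in> sets T"
          using J' False by (intro sets.finite_INT) auto
        moreover have "S None \<in> sets A"
          using S True by (force simp: E_def)
        ultimately have "prob (S None \<inter> (\<Inter>k\<in>J'. S (Some k))) = prob (S None) * prob (\<Inter>k\<in>J'. S (Some k))"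
          by (intro indep_setD[OF AT])
        then show ?thesis
          using prod[OF False] J' by (simp add: eq prod.reindex image_comp)
      qed (simp add: eq)
    qed
  qed (use E_events in auto)
  let ?F = "\<lambda>k. sigma (space M) (sets A \<union> (\<Union>j<k. sets (G j)))"
  have gen: "sets A \<union> (\<Union>j<k. sets (G j)) \<subseteq> Pow (space M)" for k
  proof -
    have "sets A \<subseteq> Pow (space M)" "sets (G j) \<subseteq> Pow (space M)" for j
      using sets.space_closed[of A] sets.space_closed[of "G j"] A GM[of j] by (simp_all add: subalgebra_def)
    then show ?thesis by blast
  qed
  have F_sets: "sets (?F k) = sigma_sets (space M) (sets A \<union> (\<Union>j<k. sets (G j)))" for k
    by (rule sets_measure_of[OF gen])
  have F_space: "space (?F k) = space M" for k
    by (rule space_measure_of[OF gen])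
  show ?thesis
  proof
    fix k
    have "sigma_sets (space M) (sets A \<union> (\<Union>j<k. sets (G j))) \<subseteq> events"
      by (rule sets.sigma_sets_subset) (use A GM in \<open>auto simp: subalgebra_def\<close>)
    then show "subalgebra M (?F k)"
      by (simp add: subalgebra_def F_space F_sets)
    have "sigma_sets (space M) (sets A \<union> (\<Union>j<k. sets (G j)))
        \<subseteq> sigma_sets (space M) (sets A \<union> (\<Union>j<Suc k. sets (G j)))"
      by (intro sigma_sets_mono') (auto simp: less_Suc_eq)
    then show "subalgebra (?F (Suc k)) (?F k)"
      by (simp add: subalgebra_def F_space F_sets)
    have "sets (G k) \<subseteq> sigma_sets (space M) (sets A \<union> (\<Union>j<Suc k. sets (G j)))"
      by (auto intro: sigma_sets.Basic)
    then show "subalgebra (?F (Suc k)) (G k)"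
      using GM[of k] by (simp add: subalgebra_def F_space F_sets)
    \<comment> \<open>\<open>True\<close> selects the past, that is, the initial data and the noise
      before time \<open>k\<close>; \<open>False\<close> selects the noise of time
      \<open>k\<close>.\<close>
    define I where "I c = (if c then insert None (Some ` {..<k}) else {Some k})" for c
    have "indep_sets (\<lambda>c. sigma_sets (space M) (\<Union>i\<in>I c. E i)) UNIV"
    proof (rule indep_sets_collect_sigma)
      show "indep_sets E (\<Union>c\<in>UNIV. I c)"
        by (rule indep_sets_mono_index[OF _ indep_E]) simp
      show "Int_stable (E i)" for i
        by (cases i) (auto simp: E_def Int_stable_def)
      show "disjoint_family_on I UNIV"
        by (auto simp: disjoint_family_on_def I_def)
    qed
    then have "indep_set (sigma_sets (space M) (\<Union>i\<in>I True. E i)) (sigma_sets (space M) (\<Union>i\<in>I False. E i))"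
      unfolding indep_set_def by (rule indep_sets_mono_sets) (auto split: bool.split)
    moreover have "sigma_sets (space M) (\<Union>i\<in>I True. E i) = sets (?F k)"
      by (simp add: I_def E_def F_sets image_comp)
    moreover have "sigma_sets (space M) (\<Union>i\<in>I False. E i) = sets (G k)"
      using sets.sigma_sets_eq[of "G k"] GM[of k] by (simp add: I_def E_def subalgebra_def)
    ultimately show "indep_set (sets (?F k)) (sets (G k))" by simp
  qed
qed

lemma subalgebra_vimage_algebra:
  assumes "f \<in> measurable N S" shows "subalgebra N (vimage_algebra (space N) f S)"
  using sets_image_in_sets[OF refl assms] by (simp add: subalgebra_def)

lemma noise_filtration_of_independent_noise:
  fixes M :: "'w measure" and x0 :: "'m::finite \<Rightarrow> 'w \<Rightarrow> 'a::euclidean_space"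
  assumes "prob_space M" "independent_noise M x0 \<zeta> \<xi>" "\<And>i. x0 i \<in> borel_measurable M"
  obtains F G where "noise_filtration M F G" "\<And>i. x0 i \<in> borel_measurable (F 0)"
    "\<And>i k. \<zeta> i k \<in> borel_measurable (G k)" "\<And>i k. \<xi> i k \<in> borel_measurable (G k)"
proof -
  interpret prob_space M by fact
  let ?P = "PiM UNIV (\<lambda>_. borel) :: ('m + 'm \<Rightarrow> 'a) measure"
  let ?x = "\<lambda>\<omega> i. x0 i \<omega>" and ?n = "\<lambda>k \<omega> s. noise_at \<zeta> \<xi> k s \<omega>" and ?a = "\<lambda>\<omega> (k, s). noise_at \<zeta> \<xi> k s \<omega>"
  define A where "A = vimage_algebra (space M) ?x (PiM UNIV (\<lambda>_. borel))"
  define T where "T = vimage_algebra (space M) ?a (PiM UNIV (\<lambda>_. borel))"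
  define G where "G k = vimage_algebra (space M) (?n k) ?P" for k
  define F where "F k = sigma (space M) (sets A \<union> (\<Union>j<k. sets (G j)))" for k
  have vars: "indep_vars (\<lambda>_. ?P) ?n UNIV" and AT: "indep_set (sets A) (sets T)"
    using assms(2) by (auto simp: independent_noise_def A_def T_def)
  have n_meas: "?n k \<in> measurable M ?P" for k
    using vars by (auto simp: indep_vars_def)
  have noise_M: "noise_at \<zeta> \<xi> k s \<in> borel_measurable M" for k s
    using measurable_compose[OF n_meas[of k] measurable_component_singleton[of s]] by simp
  have A: "subalgebra M A"
    unfolding A_def by (intro subalgebra_vimage_algebra measurable_PiM_single') (use assms(3) in auto)
  have "(\<lambda>\<omega>. case p of (k, s) \<Rightarrow> noise_at \<zeta> \<xi> k s \<omega>) \<in> borel_measurable M" for p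
    using noise_M by (cases p) auto
  then have T: "subalgebra M T"
    unfolding T_def by (intro subalgebra_vimage_algebra measurable_PiM_single') auto
  have a_meas: "?a \<in> measurable T (PiM UNIV (\<lambda>_. borel))"
    unfolding T_def by (rule measurable_vimage_algebra1) (auto simp: space_PiM)
  have noise_T: "noise_at \<zeta> \<xi> k s \<in> borel_measurable T" for k s
    using measurable_compose[OF a_meas measurable_component_singleton[of "(k, s)"]] by simp
  have "?n k \<in> measurable T ?P" for k
    by (intro measurable_PiM_single') (use noise_T in auto)
  from subalgebra_vimage_algebra[OF this] have G: "subalgebra T (G k)" for k
    using T by (simp add: G_def subalgebra_def)
  have indep: "indep_sets (\<lambda>k. sets (G k)) UNIV"
    using vars by (simp add: indep_vars_def G_def sets_vimage_algebra)
  have filtr: "noise_filtration M F G"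
    unfolding F_def by (rule noise_filtration_of_independent[OF A T AT G indep])
  have x_meas: "?x \<in> measurable A (PiM UNIV (\<lambda>_. borel))"
    unfolding A_def by (rule measurable_vimage_algebra1) (auto simp: space_PiM)
  have "sets A \<subseteq> Pow (space M)"
    using A sets.space_closed[of A] by (simp add: subalgebra_def)
  then have A_F: "subalgebra (F 0) A"
    using A by (auto simp: F_def subalgebra_def space_measure_of sets_measure_of intro: sigma_sets.Basic)
  have "x0 i \<in> borel_measurable A" for i
    using measurable_compose[OF x_meas measurable_component_singleton[of i]] by simp
  then have "x0 i \<in> borel_measurable (F 0)" for i
    by (rule measurable_from_subalg[OF A_F])
  moreover have nG_meas: "?n k \<in> measurable (G k) ?P" for k
    unfolding G_def by (rule measurable_vimage_algebra1) (auto simp: space_PiM)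
  have "noise_at \<zeta> \<xi> k s \<in> borel_measurable (G k)" for k s
    using measurable_compose[OF nG_meas[of k] measurable_component_singleton[of s]] by simp
  from this[of _ "Inl _"] this[of _ "Inr _"]
  have "\<zeta> i k \<in> borel_measurable (G k)" "\<xi> i k \<in> borel_measurable (G k)" for i k
    by (simp_all add: noise_at_def)
  ultimately show ?thesis using filtr that by blast
qed

text \<open>Symmetric in a right and a left null vector, so that transposition exchanges row and
  column Laplacians. The rank-one matrix approached by the powers is the projection onto
  \<open>a\<close> along the kernel of \<open>b\<close>.\<close>

definition mixing :: "real ^ 'n ^ 'n \<Rightarrow> real ^ 'n \<Rightarrow> real ^ 'n \<Rightarrow> bool" where
  "mixing A a b \<longleftrightarrow> A *v a = 0 \<and> b v* A = 0 \<and> (\<Sum>i\<in>UNIV. a $ i * b $ i) = real CARD('n) \<and>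
     (\<exists>g>0. \<forall>\<epsilon>>0. \<exists>N>0. \<forall>i j. \<bar>mat_pow (mat 1 + g *\<^sub>R A) N $ i $ j - a $ i * b $ j / real CARD('n)\<bar> \<le> \<epsilon>)"

lemma mixing_transpose:
  assumes "mixing A a b" shows "mixing (transpose A) b a"
proof -
  obtain g where g: "g > 0" "\<forall>\<epsilon>>0. \<exists>N>0. \<forall>i j. \<bar>mat_pow (mat 1 + g *\<^sub>R A) N $ i $ j - a $ i * b $ j / real CARD('a)\<bar> \<le> \<epsilon>"
    using assms by (auto simp: mixing_def)
  have "mat 1 + g *\<^sub>R transpose A = transpose (mat 1 + g *\<^sub>R A)"
    by (auto simp: vec_eq_iff transpose_def mat_def)
  then have "mat_pow (mat 1 + g *\<^sub>R transpose A) N $ i $ j = mat_pow (mat 1 + g *\<^sub>R A) N $ j $ i" for N i j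
    by (simp flip: transpose_mat_pow) (simp add: transpose_def)
  then have "\<forall>\<epsilon>>0. \<exists>N>0. \<forall>i j. \<bar>mat_pow (mat 1 + g *\<^sub>R transpose A) N $ i $ j - b $ i * a $ j / real CARD('a)\<bar> \<le> \<epsilon>"
    using g(2) by (metis mult.commute)
  then show ?thesis
    using assms g(1) unfolding mixing_def
    by (auto simp: mult.commute transpose_matrix_vector vector_transpose_matrix)
qed

text \<open>For small \<open>g\<close> the matrix \<open>mat 1 + g *\<^sub>R A\<close> is stochastic
  with positive diagonal and positive along the edges of \<open>A\<close>, so its powers converge.
  Positivity at the root: zeros of an invariant vector propagate along edges, so a zero at
  \<open>r\<close> would make \<open>u\<close> vanish everywhere.\<close>

lemma row_laplacian_mixing:
  fixes A :: "real ^ 'n ^ 'n" and u :: "real ^ 'n"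
  assumes offdiag: "\<And>i j. i \<noteq> j \<Longrightarrow> 0 \<le> A $ i $ j" and rows: "\<And>i. (\<Sum>j\<in>UNIV. A $ i $ j) = 0"
    and root: "r \<in> spanning_tree_roots (induced_graph A)"
    and u: "\<And>i. 0 \<le> u $ i" "u v* A = 0" "(\<Sum>i\<in>UNIV. u $ i) = real CARD('n)"
  shows "mixing A (\<chi> i. 1) u" "u $ r > 0"
proof -
  obtain t where t: "t \<subseteq> induced_graph A" "\<And>i. (r, i) \<in> t\<^sup>*"
    using root by (auto simp: spanning_tree_roots_def spanning_tree_def)
  have reach: "(r, i) \<in> (induced_graph A)\<^sup>*" for i
    using rtrancl_mono[OF t(1)] t(2) by blast
  \<comment> \<open>\<open>s\<close> exceeds every \<open>\<bar>A $ i $ i\<bar>\<close>, so that the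
    step \<open>1 / s\<close> keeps the diagonal positive.\<close>
  define s where "s = (\<Sum>i\<in>UNIV. \<bar>A $ i $ i\<bar>) + 1"
  define g where "g = 1 / s"
  have s: "\<bar>A $ i $ i\<bar> < s" for i
    using member_le_sum[of i UNIV "\<lambda>i. \<bar>A $ i $ i\<bar>"] by (simp add: s_def)
  have s_pos: "s > 0" using s[of r] by linarith
  then have g: "g > 0" by (simp add: g_def)
  define B where "B = mat 1 + g *\<^sub>R A"
  have B: "B $ i $ j = (if i = j then 1 else 0) + g * A $ i $ j" for i j
    by (simp add: B_def mat_def)
  have diag: "0 < B $ i $ i" for i
    using s[of i] s_pos by (simp add: B g_def field_simps abs_less_iff)
  have nonneg: "0 \<le> B $ i $ j" for i j
    using diag[of i] offdiag[of i j] g by (cases "i = j") (auto simp: B)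
  have rowsB: "(\<Sum>j\<in>UNIV. B $ i $ j) = 1" for i
    by (simp add: B sum.distrib rows flip: sum_distrib_left)
  have edges: "0 < B $ i $ j" if "(j, i) \<in> induced_graph A" for i j
    using that g by (auto simp: induced_graph_def B)
  have uB: "u v* B = u"
  proof -
    have "(u v* B) $ j = u $ j + g * (u v* A) $ j" for j
      by (simp add: vector_matrix_mult_def B algebra_simps sum.distrib sum_distrib_left
          if_distrib[of "\<lambda>x. x * _"] if_distrib[of "\<lambda>x. _ * x"] cong: if_cong)
    then show ?thesis by (simp add: vec_eq_iff u(2))
  qed
  have lim: "\<exists>N>0. \<forall>i j. \<bar>mat_pow B N $ i $ j - u $ j / real CARD('n)\<bar> \<le> \<epsilon>" if "\<epsilon> > 0" for \<epsilon>
    using stochastic_mat_pow_limit[OF nonneg rowsB diag edges reach u(1) uB u(3) that] by metis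
  have "A *v (\<chi> i. 1) = 0"
    by (simp add: vec_eq_iff matrix_vector_mult_def rows)
  then show "mixing A (\<chi> i. 1) u"
    using lim g u unfolding mixing_def B_def by auto
  show "u $ r > 0"
  proof (rule ccontr)
    assume "\<not> u $ r > 0"
    then have "u $ r = 0" using u(1)[of r] by simp
    have "u $ i = 0" for i
      using reach[of i]
    proof (induction rule: rtrancl_induct)
      case base
      show ?case by fact
    next
      case (step j i)
      have "(u v* B) $ j = 0" by (simp add: uB step.IH)
      then have "(\<Sum>k\<in>UNIV. B $ k $ j * u $ k) = 0"
        by (simp add: vector_matrix_mult_def mult.commute)
      then have "\<forall>k\<in>UNIV. B $ k $ j * u $ k = 0"
        by (subst (asm) sum_nonneg_eq_0_iff) (auto simp: nonneg u)
      then have "B $ i $ j * u $ i = 0" by simp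
      then show ?case using edges[OF step.hyps(2)] by simp
    qed
    then show False using u(3) by simp
  qed
qed

section \<open>Weighted averages and the oblique consensus projection\<close>

definition wavg :: "real ^ 'n \<Rightarrow> 'a::real_vector ^ 'n \<Rightarrow> 'a" where
  "wavg b z = (1 / real CARD('n)) *\<^sub>R (\<Sum>i\<in>UNIV. b $ i *\<^sub>R z $ i)"

definition spread :: "real ^ 'n \<Rightarrow> 'a::real_vector \<Rightarrow> 'a ^ 'n" where
  "spread a x = (\<chi> i. a $ i *\<^sub>R x)"

text \<open>Removes the consensus part along \<open>a\<close>. With \<open>a = one\<close> and
  \<open>b = u\<close> it gives the deviations of the states from their average, with
  \<open>a = v\<close> and \<open>b = one\<close> those of the trackers from the
  \<open>v\<close>-weighted average.\<close>

definition proj :: "real ^ 'n \<Rightarrow> real ^ 'n \<Rightarrow> 'a::real_vector ^ 'n \<Rightarrow> 'a ^ 'n" where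
  "proj a b z = z - spread a (wavg b z)"

lemma linear_wavg: "linear (wavg b)"
  unfolding wavg_def
  by (rule linearI) (simp_all add: scaleR_add_right sum.distrib scaleR_sum_right mult_ac)

lemma linear_spread: "linear (spread a)"
  by (rule linearI) (simp_all add: spread_def vec_eq_iff scaleR_add_right mult.commute)

lemma linear_proj: "linear (proj a b)"
  unfolding proj_def
  by (intro linear_compose_sub linear_ident linear_compose[OF linear_wavg linear_spread, unfolded comp_def])

lemma mixing_wavg_mat_act:
  assumes "mixing A a b" shows "wavg b (mat_act A z) = 0"
proof -
  have "(\<Sum>i\<in>UNIV. b $ i *\<^sub>R mat_act A z $ i) = (\<Sum>j\<in>UNIV. (b v* A) $ j *\<^sub>R z $ j)"
    by (simp add: mat_act_nth vector_matrix_mult_def scaleR_sum_right scaleR_sum_left mult.commute, subst sum.swap) simp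
  then show ?thesis
    using assms by (simp add: wavg_def mixing_def)
qed

lemma mixing_mat_act_spread:
  assumes "mixing A a b" shows "mat_act A (spread a x) = 0"
proof -
  have "mat_act A (spread a x) $ i = (A *v a) $ i *\<^sub>R x" for i
    by (simp add: mat_act_nth spread_def matrix_vector_mult_def scaleR_sum_left)
  then show ?thesis using assms by (simp add: vec_eq_iff mixing_def)
qed

lemma mixing_wavg_spread:
  fixes A :: "real ^ 'n ^ 'n"
  assumes "mixing A a b" shows "wavg b (spread a x) = x"
proof -
  have "(\<Sum>i\<in>UNIV. b $ i * a $ i) = real CARD('n)"
    using assms by (simp add: mixing_def mult.commute)
  then show ?thesis
    by (simp add: wavg_def spread_def flip: scaleR_sum_left)
qed

text \<open>\<open>A\<close> does not see the consensus part and its image has average zero. For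
  this reason the projected recursions close up in the projected variables.\<close>

lemma mixing_proj:
  assumes "mixing A a b"
  shows "mat_act A (proj a b z) = mat_act A z" "proj a b (mat_act A z) = mat_act A z" "wavg b (proj a b z) = 0"
  by (simp_all add: mixing_wavg_mat_act[OF assms] mixing_mat_act_spread[OF assms] mixing_wavg_spread[OF assms] proj_def linear_diff[OF linear_mat_act] linear_diff[OF linear_wavg] linear_0[OF linear_spread])

lemma mixing_lyapunov:
  fixes A :: "real ^ 'n ^ 'n"
  assumes "mixing A a b"
  obtains P :: "'a::euclidean_space ^ 'n \<Rightarrow> 'a ^ 'n" and \<kappa> c \<gamma>m :: real
  where "energy_form P \<kappa>" "c > 0" "\<gamma>m > 0"
    "\<And>z \<theta> \<gamma>. wavg b z = 0 \<Longrightarrow> 1 / 2 \<le> \<theta> \<Longrightarrow> \<theta> \<le> 1 \<Longrightarrow> 0 \<le> \<gamma> \<Longrightarrow> \<gamma> \<le> \<gamma>m \<Longrightarrow>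
      (\<theta> *\<^sub>R z + \<gamma> *\<^sub>R mat_act A z) \<bullet> P (\<theta> *\<^sub>R z + \<gamma> *\<^sub>R mat_act A z) \<le> (1 - c * \<gamma>) * (z \<bullet> P z)"
proof -
  obtain g where g: "g > 0" "\<And>\<epsilon>. \<epsilon> > 0 \<Longrightarrow> \<exists>N>0. \<forall>i j. \<bar>mat_pow (mat 1 + g *\<^sub>R A) N $ i $ j - a $ i * b $ j / real CARD('n)\<bar> \<le> \<epsilon>"
    using assms by (auto simp: mixing_def)
  have zero: "(\<Sum>j\<in>UNIV. b $ j *\<^sub>R z $ j) = 0" if "wavg b z = 0" for z :: "'a ^ 'n"
    using that by (simp add: wavg_def)
  obtain P :: "'a ^ 'n \<Rightarrow> 'a ^ 'n" and \<kappa> c \<gamma>m where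
    P: "energy_form P \<kappa>" "c > 0" "\<gamma>m > 0"
      "\<And>z \<theta> \<gamma>. (\<Sum>j\<in>UNIV. b $ j *\<^sub>R z $ j) = 0 \<Longrightarrow> 1 / 2 \<le> \<theta> \<Longrightarrow> \<theta> \<le> 1 \<Longrightarrow> 0 \<le> \<gamma> \<Longrightarrow> \<gamma> \<le> \<gamma>m \<Longrightarrow>
        (\<theta> *\<^sub>R z + \<gamma> *\<^sub>R mat_act A z) \<bullet> P (\<theta> *\<^sub>R z + \<gamma> *\<^sub>R mat_act A z) \<le> (1 - c * \<gamma>) * (z \<bullet> P z)"
    using mat_act_lyapunov[OF g, where 'a = 'a] by blast
  show ?thesis
    by (rule that[OF P(1-3)]) (rule P(4)[OF zero])
qed

subsection \<open>Consensus and tracking errors\<close>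

abbreviation (input) msq :: "'w measure \<Rightarrow> ('w \<Rightarrow> 'b::real_normed_vector) \<Rightarrow> real" where
  "msq M X \<equiv> LINT \<omega>|M. (norm (X \<omega>))\<^sup>2"

lemma msq_nonneg: "0 \<le> msq M X"
  by (rule Bochner_Integration.integral_nonneg) simp

lemma msq_le:
  assumes "sqint M N X" "sqint M N' Y" "sqint M N'' Z" and "0 \<le> a" "0 \<le> b"
    and le: "\<And>\<omega>. \<omega> \<in> space M \<Longrightarrow> norm (X \<omega>) \<le> a * norm (Y \<omega>) + b * norm (Z \<omega>)"
  shows "msq M X \<le> 2 * a\<^sup>2 * msq M Y + 2 * b\<^sup>2 * msq M Z"
proof -
  have "msq M X \<le> (LINT \<omega>|M. 2 * a\<^sup>2 * (norm (Y \<omega>))\<^sup>2 + 2 * b\<^sup>2 * (norm (Z \<omega>))\<^sup>2)"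
  proof (rule integral_mono)
    fix \<omega> assume "\<omega> \<in> space M"
    have "(norm (X \<omega>))\<^sup>2 \<le> (a * norm (Y \<omega>) + b * norm (Z \<omega>))\<^sup>2"
      by (intro power_mono le \<open>\<omega> \<in> space M\<close>) simp
    also have "\<dots> \<le> 2 * (a * norm (Y \<omega>))\<^sup>2 + 2 * (b * norm (Z \<omega>))\<^sup>2"
      using norm_add_sq_le[of "a * norm (Y \<omega>)" "b * norm (Z \<omega>)"] by (simp add: power2_eq_square)
    finally show "(norm (X \<omega>))\<^sup>2 \<le> 2 * a\<^sup>2 * (norm (Y \<omega>))\<^sup>2 + 2 * b\<^sup>2 * (norm (Z \<omega>))\<^sup>2"
      by (simp add: power_mult_distrib)
  qed (use sqintD(2)[OF assms(1)] sqintD(2)[OF assms(2)] sqintD(2)[OF assms(3)] in simp_all)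
  also have "\<dots> = 2 * a\<^sup>2 * msq M Y + 2 * b\<^sup>2 * msq M Z"
    using sqintD(2)[OF assms(2)] sqintD(2)[OF assms(3)] by simp
  finally show ?thesis .
qed

lemma (in prob_space) msq_le_const:
  assumes "sqint M N X" "sqint M N' Y" and "0 \<le> a" "0 \<le> c"
    and le: "\<And>\<omega>. \<omega> \<in> space M \<Longrightarrow> norm (X \<omega>) \<le> a * norm (Y \<omega>) + c"
  shows "msq M X \<le> 2 * a\<^sup>2 * msq M Y + 2 * c\<^sup>2"
proof -
  have "sqint M N (\<lambda>_. 1 :: real)" by (simp add: sqint_def)
  from msq_le[OF assms(1,2) this assms(3,4)] le show ?thesis
    by (simp add: prob_space)
qed

lemma tendsto_zero_of_summable_sq:
  fixes a :: "nat \<Rightarrow> real"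
  assumes "summable (\<lambda>k. (a k)\<^sup>2)" shows "a \<longlonglongrightarrow> 0"
  using tendsto_real_sqrt[OF summable_LIMSEQ_zero[OF assms]] by (simp add: tendsto_rabs_zero_iff)

lemma eventually_le_of_tendsto_zero:
  fixes a :: "nat \<Rightarrow> real"
  assumes "a \<longlonglongrightarrow> 0" "e > 0" shows "\<forall>\<^sub>F k in sequentially. a k \<le> e"
  using order_tendstoD(2)[OF assms] by (rule eventually_mono) simp

lemma (in noise_filtration) centered_scaled_linear:
  fixes h :: "'b::euclidean_space \<Rightarrow> 'c::euclidean_space"
  assumes "linear h" "centered k n"
  shows "centered k (\<lambda>\<omega>. c *\<^sub>R h (n \<omega>))"
  by (rule centered_linear[OF assms(2) linear_compose_scale_right[OF assms(1)]])

lemma (in noise_filtration) summable_linear_noise: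
  fixes h :: "'b::euclidean_space \<Rightarrow> 'c::euclidean_space"
  assumes h: "linear h" and n: "\<And>k. centered k (n k)" and sum: "summable (\<lambda>k. (c k)\<^sup>2 * msq M (n k))"
  shows "summable (\<lambda>k. msq M (\<lambda>\<omega>. c k *\<^sub>R h (n k \<omega>)))"
proof -
  obtain B where B: "B > 0" "\<And>x. norm (h x) \<le> B * norm x"
    using linear_bounded_pos[OF h] by auto
  have "msq M (\<lambda>\<omega>. c k *\<^sub>R h (n k \<omega>)) \<le> 2 * B\<^sup>2 * ((c k)\<^sup>2 * msq M (n k))" for k
  proof -
    have nk: "sqint M (G k) (n k)" "sqint M (G k) (\<lambda>\<omega>. c k *\<^sub>R h (n k \<omega>))"
      using n centered_scaled_linear[OF h n] by (auto simp: centered_def)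
    have "\<bar>c k\<bar> * norm (h (n k \<omega>)) \<le> \<bar>c k\<bar> * (B * norm (n k \<omega>))" for \<omega>
      by (intro mult_left_mono B) simp
    then have "msq M (\<lambda>\<omega>. c k *\<^sub>R h (n k \<omega>)) \<le> 2 * (\<bar>c k\<bar> * B)\<^sup>2 * msq M (n k) + 2 * 0\<^sup>2"
      using B(1) by (intro msq_le_const[OF nk(2,1)]) (auto simp: mult_ac)
    then show ?thesis by (simp add: power_mult_distrib mult_ac)
  qed
  then show ?thesis
    by (intro summable_comparison_test'[OF summable_mult[OF sum, of "2 * B\<^sup>2"]]) (simp add: msq_nonneg)
qed

text \<open>The algorithm in stacked form. \<open>N\<^sub>1\<close> and \<open>N\<^sub>2\<close>
  stand for the injected noises after weighting by the off-diagonal entries, but before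
  multiplication by the weakening factors.\<close>

locale tracking_process = noise_filtration M F G for M :: "'w measure" and F G +
  fixes R C :: "real ^ 'm ^ 'm" and u v :: "real ^ 'm"
    and \<gamma>\<^sub>1 \<gamma>\<^sub>2 \<alpha> lam :: "nat \<Rightarrow> real" and g :: "'m::finite \<Rightarrow> 'a::euclidean_space \<Rightarrow> 'a" and L c\<^sub>0 :: real
    and X Y N\<^sub>1 N\<^sub>2 :: "nat \<Rightarrow> 'w \<Rightarrow> 'a ^ 'm" and one :: "real ^ 'm" and grads :: "'a ^ 'm \<Rightarrow> 'a ^ 'm"
  defines "one \<equiv> \<chi> i. 1" and "grads \<equiv> \<lambda>z. \<chi> i. g i (z $ i)"
  assumes mixR: "mixing R one u" and mixC: "mixing C v one"
    and L: "0 \<le> L" and lip: "norm (g i p - g i q) \<le> L * norm (p - q)" and bdd: "norm (g i p) \<le> c\<^sub>0"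
    and \<gamma>1_pos: "0 < \<gamma>\<^sub>1 k" and \<gamma>2_pos: "0 < \<gamma>\<^sub>2 k" and lam_nonneg: "0 \<le> lam k"
    and \<gamma>1_div: "\<not> summable \<gamma>\<^sub>1" and \<gamma>2_div: "\<not> summable \<gamma>\<^sub>2"
    and \<gamma>1_sq: "summable (\<lambda>k. (\<gamma>\<^sub>1 k)\<^sup>2)" and \<gamma>2_sq: "summable (\<lambda>k. (\<gamma>\<^sub>2 k)\<^sup>2)"
    and lam_\<gamma>1: "summable (\<lambda>k. (lam k)\<^sup>2 / \<gamma>\<^sub>1 k)" and lam_\<gamma>2: "summable (\<lambda>k. (lam k)\<^sup>2 / \<gamma>\<^sub>2 k)"
    and lam_\<gamma>1_0: "(\<lambda>k. lam k / \<gamma>\<^sub>1 k) \<longlonglongrightarrow> 0" and lam_\<gamma>2_0: "(\<lambda>k. lam k / \<gamma>\<^sub>2 k) \<longlonglongrightarrow> 0"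
    and \<alpha>_pos: "\<forall>\<^sub>F k in sequentially. 0 < \<alpha> k" and lam_\<alpha>: "\<exists>B. \<forall>\<^sub>F k in sequentially. lam k \<le> B * \<alpha> k"
    and \<alpha>_\<gamma>2: "summable (\<lambda>k. (\<alpha> k)\<^sup>2 / \<gamma>\<^sub>2 k)" and \<gamma>1_\<gamma>2: "summable (\<lambda>k. (\<gamma>\<^sub>1 k)\<^sup>2 / \<gamma>\<^sub>2 k)"
    and N1: "centered k (N\<^sub>1 k)" and N2: "centered k (N\<^sub>2 k)"
    and N1_sum: "summable (\<lambda>k. (\<gamma>\<^sub>1 k)\<^sup>2 * msq M (N\<^sub>1 k))" and N2_sum: "summable (\<lambda>k. (\<gamma>\<^sub>2 k)\<^sup>2 * msq M (N\<^sub>2 k))"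
    and X0: "sqint M (F 0) (X 0)" and Y0: "\<omega> \<in> space M \<Longrightarrow> Y 0 \<omega> = grads (X 0 \<omega>)"
    and X_Suc: "\<omega> \<in> space M \<Longrightarrow> X (Suc k) \<omega>
      = X k \<omega> + \<gamma>\<^sub>1 k *\<^sub>R mat_act R (X k \<omega>) + \<gamma>\<^sub>1 k *\<^sub>R N\<^sub>1 k \<omega> - lam k *\<^sub>R Y k \<omega>"
    and Y_Suc: "\<omega> \<in> space M \<Longrightarrow> Y (Suc k) \<omega>
      = (1 - \<alpha> k) *\<^sub>R Y k \<omega> + \<gamma>\<^sub>2 k *\<^sub>R mat_act C (Y k \<omega>) + \<gamma>\<^sub>2 k *\<^sub>R N\<^sub>2 k \<omega>
        + grads (X (Suc k) \<omega>) - (1 - \<alpha> k) *\<^sub>R grads (X k \<omega>)"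
begin

lemma c0_nonneg: "0 \<le> c\<^sub>0"
  using norm_ge_zero bdd order_trans by blast

lemma grads_lip: "norm (grads p - grads q) \<le> L * norm (p - q)"
proof -
  have "norm (grads p - grads q) \<le> L2_set (\<lambda>i. L * norm ((p - q) $ i)) UNIV"
    unfolding norm_vec_def by (intro L2_set_mono) (auto simp: grads_def lip)
  then show ?thesis
    unfolding norm_vec_def using L by (simp add: L2_set_right_distrib)
qed

lemma grads_bdd: "norm (grads p) \<le> real CARD('m) * c\<^sub>0"
proof -
  have "norm (grads p) \<le> (\<Sum>i\<in>(UNIV::'m set). c\<^sub>0)"
    by (rule order_trans[OF norm_vec_le_sum sum_mono]) (simp add: grads_def bdd)
  then show ?thesis by simp
qed

lemma grads_measurable: "grads \<in> borel_measurable borel"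
proof (rule borel_measurable_continuous_onI)
  have "L-lipschitz_on UNIV grads"
    using grads_lip L by (intro lipschitz_onI) (auto simp: dist_norm)
  then show "continuous_on UNIV grads" by (rule lipschitz_on_continuous_on)
qed

lemma sqint_grads:
  assumes "sqint M (F k) Z" shows "sqint M (F k) (\<lambda>\<omega>. grads (Z \<omega>))"
  by (rule sqint_bounded[OF measurable_compose[OF sqintD(1)[OF assms] grads_measurable] F_sub grads_bdd])

lemma sqint_mat_act: "sqint M (F k) Z \<Longrightarrow> sqint M (F k) (\<lambda>\<omega>. mat_act A (Z \<omega> :: 'a ^ 'm))"
  by (rule sqint_linear[OF _ F_sub linear_mat_act])

lemma sqint_proj: "sqint M (F k) Z \<Longrightarrow> sqint M (F k) (\<lambda>\<omega>. proj a b (Z \<omega> :: 'a ^ 'm))"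
  by (rule sqint_linear[OF _ F_sub linear_proj])

lemma sqint_wavg: "sqint M (F k) Z \<Longrightarrow> sqint M (F k) (\<lambda>\<omega>. wavg b (Z \<omega> :: 'a ^ 'm))"
  by (rule sqint_linear[OF _ F_sub linear_wavg])

lemma sqint_spread: "sqint M (F k) Z \<Longrightarrow> sqint M (F k) (\<lambda>\<omega>. spread a (Z \<omega> :: 'a) :: 'a ^ 'm)"
  by (rule sqint_linear[OF _ F_sub linear_spread])

lemmas sqint_F = sqint_add[OF _ _ F_sub] sqint_diff[OF _ _ F_sub] sqint_scaleR[OF _ F_sub]
  sqint_grads sqint_mat_act sqint_proj sqint_wavg sqint_spread

lemmas lin = linear_add[OF linear_wavg] linear_diff[OF linear_wavg] linear_scale[OF linear_wavg]
  linear_add[OF linear_proj] linear_diff[OF linear_proj] linear_scale[OF linear_proj]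
  linear_add[OF linear_mat_act] linear_diff[OF linear_mat_act] linear_scale[OF linear_mat_act]

lemma XY_sqint: "sqint M (F k) (X k) \<and> sqint M (F k) (Y k)"
proof (induction k)
  case 0
  have "sqint M (F 0) (\<lambda>\<omega>. grads (X 0 \<omega>)) \<longleftrightarrow> sqint M (F 0) (Y 0)"
    by (rule sqint_cong[OF F_sub]) (simp add: Y0)
  then show ?case using X0 sqint_grads[OF X0] by blast
next
  case (Suc k)
  have XY: "sqint M (F (Suc k)) (X k)" "sqint M (F (Suc k)) (Y k)"
    using Suc sqint_mono[OF _ F_mono] by blast+
  have N: "sqint M (F (Suc k)) (N\<^sub>1 k)" "sqint M (F (Suc k)) (N\<^sub>2 k)"
    using N1 N2 centered_sqint_F by blast+
  have "sqint M (F (Suc k)) (\<lambda>\<omega>. X k \<omega> + \<gamma>\<^sub>1 k *\<^sub>R mat_act R (X k \<omega>) + \<gamma>\<^sub>1 k *\<^sub>R N\<^sub>1 k \<omega> - lam k *\<^sub>R Y k \<omega>)"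
    by (intro sqint_F XY N)
  then have X': "sqint M (F (Suc k)) (X (Suc k))"
    by (subst sqint_cong[OF F_sub X_Suc])
  have "sqint M (F (Suc k)) (\<lambda>\<omega>. (1 - \<alpha> k) *\<^sub>R Y k \<omega> + \<gamma>\<^sub>2 k *\<^sub>R mat_act C (Y k \<omega>) + \<gamma>\<^sub>2 k *\<^sub>R N\<^sub>2 k \<omega>
        + grads (X (Suc k) \<omega>) - (1 - \<alpha> k) *\<^sub>R grads (X k \<omega>))"
    by (intro sqint_F XY N X')
  then have "sqint M (F (Suc k)) (Y (Suc k))"
    by (subst sqint_cong[OF F_sub Y_Suc])
  with X' show ?case by blast
qed

lemmas X_sqint = XY_sqint[THEN conjunct1] and Y_sqint = XY_sqint[THEN conjunct2]

lemma \<gamma>1_0: "\<gamma>\<^sub>1 \<longlonglongrightarrow> 0" and \<gamma>2_0: "\<gamma>\<^sub>2 \<longlonglongrightarrow> 0"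
  using \<gamma>1_sq \<gamma>2_sq by (auto intro: tendsto_zero_of_summable_sq)

lemma \<alpha>_0: "\<alpha> \<longlonglongrightarrow> 0"
proof -
  have "(\<lambda>k. (\<alpha> k)\<^sup>2 / \<gamma>\<^sub>2 k * \<gamma>\<^sub>2 k) \<longlonglongrightarrow> 0 * 0"
    by (intro tendsto_mult summable_LIMSEQ_zero[OF \<alpha>_\<gamma>2] \<gamma>2_0)
  moreover have "(\<alpha> k)\<^sup>2 / \<gamma>\<^sub>2 k * \<gamma>\<^sub>2 k = (\<alpha> k)\<^sup>2" for k
    using \<gamma>2_pos[of k] by simp
  ultimately have "(\<lambda>k. (\<alpha> k)\<^sup>2) \<longlonglongrightarrow> 0" by simp
  from tendsto_real_sqrt[OF this] show ?thesis by (simp add: tendsto_rabs_zero_iff)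
qed

lemma lam_le_\<gamma>1: "\<forall>\<^sub>F k in sequentially. lam k \<le> \<gamma>\<^sub>1 k" and lam_le_\<gamma>2: "\<forall>\<^sub>F k in sequentially. lam k \<le> \<gamma>\<^sub>2 k"
  using eventually_le_of_tendsto_zero[OF lam_\<gamma>1_0 zero_less_one] eventually_le_of_tendsto_zero[OF lam_\<gamma>2_0 zero_less_one]
    \<gamma>1_pos \<gamma>2_pos
  by (simp_all add: divide_le_eq_1_pos)

text \<open>Carries summability from the natural rate \<open>w\<close> of an error over to the
  weight \<open>lam\<close> that occurs in the descent of the objective.\<close>

lemma summable_lam_of_summable:
  assumes "summable (\<lambda>k. w k * msq M (Z k))" "\<forall>\<^sub>F k in sequentially. lam k \<le> B * w k"
  shows "summable (\<lambda>k. lam k * msq M (Z k))"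
proof (rule summable_comparison_test_ev[OF _ summable_mult[OF assms(1), of B]])
  show "\<forall>\<^sub>F k in sequentially. norm (lam k * msq M (Z k)) \<le> B * (w k * msq M (Z k))"
    using assms(2)
  proof eventually_elim
    case (elim k)
    then have "lam k * msq M (Z k) \<le> (B * w k) * msq M (Z k)"
      by (intro mult_right_mono msq_nonneg)
    then show ?case
      using lam_nonneg[of k] msq_nonneg[of M "Z k"] by (simp add: mult_ac)
  qed
qed

text \<open>Subtracting the current gradients removes the gradient increment: apart from the noise,
  \<open>W (Suc k)\<close> depends on quantities of time \<open>k\<close> only, so its recursion is
  adapted.\<close>

definition W :: "nat \<Rightarrow> 'w \<Rightarrow> 'a ^ 'm" where "W k \<omega> = Y k \<omega> - grads (X k \<omega>)"

lemma W_sqint: "sqint M (F k) (W k)"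
  unfolding W_def[abs_def] by (intro sqint_F X_sqint Y_sqint)

lemma W_Suc: "\<omega> \<in> space M \<Longrightarrow> W (Suc k) \<omega>
    = (1 - \<alpha> k) *\<^sub>R W k \<omega> + \<gamma>\<^sub>2 k *\<^sub>R mat_act C (W k \<omega> + grads (X k \<omega>)) + \<gamma>\<^sub>2 k *\<^sub>R N\<^sub>2 k \<omega>"
  by (simp add: W_def Y_Suc algebra_simps)

definition E :: "nat \<Rightarrow> 'w \<Rightarrow> 'a" where "E k \<omega> = wavg one (W k \<omega>)"

lemma E_sqint: "sqint M (F k) (E k)"
  unfolding E_def[abs_def] by (intro sqint_F W_sqint)

text \<open>Zero column sums remove the mixing term, so the average of \<open>W\<close> contracts at
  the rate \<alpha> with no drift at all.\<close>

lemma E_moments: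
  shows E_bounded: "\<exists>B. \<forall>k. msq M (E k) \<le> B" and E_summable: "summable (\<lambda>k. \<alpha> k * msq M (E k))"
proof -
  obtain K where K: "\<And>k. K \<le> k \<Longrightarrow> 0 < \<alpha> k \<and> \<alpha> k \<le> 1"
    using eventually_conj[OF \<alpha>_pos eventually_le_of_tendsto_zero[OF \<alpha>_0 zero_less_one]]
    by (auto simp: eventually_sequentially)
  interpret contracting_process M F G "\<lambda>x. x" 1 K \<alpha> E "\<lambda>k \<omega>. (1 - \<alpha> k) *\<^sub>R E k \<omega>" "\<lambda>k \<omega>. 0"
    "\<lambda>k \<omega>. \<gamma>\<^sub>2 k *\<^sub>R wavg one (N\<^sub>2 k \<omega>)"
  proof
    show "energy_form (\<lambda>x :: 'a. x) 1" by (rule energy_form_id)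
    show "sqint M (F k) (E k)" "sqint M (F k) (\<lambda>\<omega>. (1 - \<alpha> k) *\<^sub>R E k \<omega>)" for k
      by (intro sqint_F E_sqint)+
    show "sqint M (F k) (\<lambda>\<omega>. 0 :: 'a)" for k by (simp add: sqint_def)
    show "centered k (\<lambda>\<omega>. \<gamma>\<^sub>2 k *\<^sub>R wavg one (N\<^sub>2 k \<omega>))" for k
      by (rule centered_scaled_linear[OF linear_wavg N2])
    show "summable (\<lambda>k. msq M (\<lambda>\<omega>. \<gamma>\<^sub>2 k *\<^sub>R wavg one (N\<^sub>2 k \<omega>)))"
      by (rule summable_linear_noise[OF linear_wavg N2 N2_sum])
    show "E (Suc k) \<omega> = (1 - \<alpha> k) *\<^sub>R E k \<omega> + 0 + \<gamma>\<^sub>2 k *\<^sub>R wavg one (N\<^sub>2 k \<omega>)" if "\<omega> \<in> space M" for k \<omega>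
      unfolding E_def W_Suc[OF that] lin(1,3) mixing_wavg_mat_act[OF mixC] by simp
    show "(1 - \<alpha> k) *\<^sub>R E k \<omega> \<bullet> (1 - \<alpha> k) *\<^sub>R E k \<omega> \<le> (1 - \<alpha> k) * (E k \<omega> \<bullet> E k \<omega>)"
      if "K \<le> k" for k \<omega>
      using K[OF that] by (intro inner_shrink_le) auto
  qed (use K in blast)
  have drift: "summable (\<lambda>k. msq M (\<lambda>\<omega>. 0 :: 'a) / \<alpha> k)" by simp
  show "\<exists>B. \<forall>k. msq M (E k) \<le> B" by (rule second_moment_bounded'[OF drift])
  show "summable (\<lambda>k. \<alpha> k * msq M (E k))" by (rule summable_second_moment[OF drift])
qed

text \<open>Serves the states with \<open>\<theta> = 1\<close> and the trackers with
  \<open>\<theta> = 1 - \<alpha>\<close>.\<close>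

lemma mixing_contraction:
  fixes A :: "real ^ 'm ^ 'm" and \<gamma> \<theta> :: "nat \<Rightarrow> real" and Z r n :: "nat \<Rightarrow> 'w \<Rightarrow> 'a ^ 'm"
  assumes mix: "mixing A a b" and \<gamma>: "\<And>k. 0 < \<gamma> k" "\<gamma> \<longlonglongrightarrow> 0" and \<theta>: "\<forall>\<^sub>F k in sequentially. 1 / 2 \<le> \<theta> k \<and> \<theta> k \<le> 1"
    and Z: "\<And>k. sqint M (F k) (Z k)" "\<And>k \<omega>. wavg b (Z k \<omega>) = 0" and r: "\<And>k. sqint M (F k) (r k)"
    and n: "\<And>k. centered k (n k)" "summable (\<lambda>k. msq M (n k))"
    and step: "\<And>k \<omega>. \<omega> \<in> space M \<Longrightarrow> Z (Suc k) \<omega> = \<theta> k *\<^sub>R Z k \<omega> + \<gamma> k *\<^sub>R mat_act A (Z k \<omega>) + r k \<omega> + n k \<omega>"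
  obtains P :: "'a ^ 'm \<Rightarrow> 'a ^ 'm" and \<kappa> K c where "c > 0"
    "contracting_process M F G P \<kappa> K (\<lambda>k. c * \<gamma> k) Z (\<lambda>k \<omega>. \<theta> k *\<^sub>R Z k \<omega> + \<gamma> k *\<^sub>R mat_act A (Z k \<omega>)) r n"
proof -
  obtain P :: "'a ^ 'm \<Rightarrow> 'a ^ 'm" and \<kappa> c \<gamma>m where P: "energy_form P \<kappa>" "c > 0" "\<gamma>m > 0"
    "\<And>z \<theta> \<gamma>. wavg b z = 0 \<Longrightarrow> 1 / 2 \<le> \<theta> \<Longrightarrow> \<theta> \<le> 1 \<Longrightarrow> 0 \<le> \<gamma> \<Longrightarrow> \<gamma> \<le> \<gamma>m \<Longrightarrow>
      (\<theta> *\<^sub>R z + \<gamma> *\<^sub>R mat_act A z) \<bullet> P (\<theta> *\<^sub>R z + \<gamma> *\<^sub>R mat_act A z) \<le> (1 - c * \<gamma>) * (z \<bullet> P z)"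
    using mixing_lyapunov[OF mix, where 'a = 'a] by blast
  \<comment> \<open>The bound \<open>\<gamma>m\<close> secures the Lyapunov contraction,
    \<open>1 / c\<close> keeps the rate \<open>c * \<gamma> k\<close> at most 1.\<close>
  have "min \<gamma>m (1 / c) > 0" using P(2,3) by simp
  from eventually_conj[OF \<theta> eventually_le_of_tendsto_zero[OF \<gamma>(2) this]]
  obtain K where K: "\<And>k. K \<le> k \<Longrightarrow> (1 / 2 \<le> \<theta> k \<and> \<theta> k \<le> 1) \<and> \<gamma> k \<le> min \<gamma>m (1 / c)"
    by (auto simp: eventually_sequentially)
  have "contracting_process M F G P \<kappa> K (\<lambda>k. c * \<gamma> k) Z (\<lambda>k \<omega>. \<theta> k *\<^sub>R Z k \<omega> + \<gamma> k *\<^sub>R mat_act A (Z k \<omega>)) r n"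
  proof
    show "sqint M (F k) (\<lambda>\<omega>. \<theta> k *\<^sub>R Z k \<omega> + \<gamma> k *\<^sub>R mat_act A (Z k \<omega>))" for k
      by (intro sqint_F Z)
    show "0 < c * \<gamma> k \<and> c * \<gamma> k \<le> 1" if "K \<le> k" for k
      using K[OF that] P(2) \<gamma>(1)[of k] by (auto simp: field_simps)
    fix k \<omega> assume "K \<le> k"
    then show "(\<theta> k *\<^sub>R Z k \<omega> + \<gamma> k *\<^sub>R mat_act A (Z k \<omega>)) \<bullet> P (\<theta> k *\<^sub>R Z k \<omega> + \<gamma> k *\<^sub>R mat_act A (Z k \<omega>))
        \<le> (1 - c * \<gamma> k) * (Z k \<omega> \<bullet> P (Z k \<omega>))"
      using K[of k] \<gamma>(1)[of k] by (intro P(4) Z) auto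
  qed (use P(1) Z r n step in blast)+
  then show ?thesis using that P(2) by blast
qed

lemma \<theta>_range: "\<forall>\<^sub>F k in sequentially. 1 / 2 \<le> 1 - \<alpha> k \<and> 1 - \<alpha> k \<le> 1"
  using eventually_conj[OF \<alpha>_pos eventually_le_of_tendsto_zero[OF \<alpha>_0, of "1 / 2"]]
  by (auto elim: eventually_mono)

lemma proj_N2_sum: "summable (\<lambda>k. msq M (\<lambda>\<omega>. \<gamma>\<^sub>2 k *\<^sub>R proj v one (N\<^sub>2 k \<omega>)))"
  by (rule summable_linear_noise[OF linear_proj N2 N2_sum])

text \<open>As gradients are bounded, the gradient term is a drift of the order of the contraction
  rate \<open>\<gamma>\<^sub>2\<close>. This bounds the moments of the projected \<open>W\<close>;
  its average \<open>E\<close> and the gradients are then added back.\<close>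

lemma Y_bounded: "\<exists>B. \<forall>k. msq M (Y k) \<le> B"
proof -
  define Z where "Z k \<omega> = proj v one (W k \<omega>)" for k \<omega>
  define r where "r k \<omega> = \<gamma>\<^sub>2 k *\<^sub>R mat_act C (grads (X k \<omega>))" for k \<omega>
  have Z: "sqint M (F k) (Z k)" and r: "sqint M (F k) (r k)" for k
    unfolding Z_def[abs_def] r_def[abs_def] by (intro sqint_F W_sqint X_sqint)+
  have Z0: "wavg one (Z k \<omega>) = 0" for k \<omega>
    by (simp add: Z_def mixing_proj[OF mixC])
  have step: "Z (Suc k) \<omega> = (1 - \<alpha> k) *\<^sub>R Z k \<omega> + \<gamma>\<^sub>2 k *\<^sub>R mat_act C (Z k \<omega>) + r k \<omega> + \<gamma>\<^sub>2 k *\<^sub>R proj v one (N\<^sub>2 k \<omega>)"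
    if "\<omega> \<in> space M" for k \<omega>
    by (simp add: Z_def r_def W_Suc[OF that] lin mixing_proj[OF mixC] scaleR_add_right add.assoc)
  obtain P \<kappa> K c where c: "c > 0" and cp: "contracting_process M F G P \<kappa> K (\<lambda>k. c * \<gamma>\<^sub>2 k) Z
      (\<lambda>k \<omega>. (1 - \<alpha> k) *\<^sub>R Z k \<omega> + \<gamma>\<^sub>2 k *\<^sub>R mat_act C (Z k \<omega>)) r (\<lambda>k \<omega>. \<gamma>\<^sub>2 k *\<^sub>R proj v one (N\<^sub>2 k \<omega>))"
    by (rule mixing_contraction[OF mixC \<gamma>2_pos \<gamma>2_0 \<theta>_range Z Z0 r centered_scaled_linear[OF linear_proj N2] proj_N2_sum step]) (assumption, rule that, assumption+)
  interpret contracting_process M F G P \<kappa> K "\<lambda>k. c * \<gamma>\<^sub>2 k" Z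
      "\<lambda>k \<omega>. (1 - \<alpha> k) *\<^sub>R Z k \<omega> + \<gamma>\<^sub>2 k *\<^sub>R mat_act C (Z k \<omega>)" r "\<lambda>k \<omega>. \<gamma>\<^sub>2 k *\<^sub>R proj v one (N\<^sub>2 k \<omega>)"
    by (rule cp)
  obtain D where D: "D > 0" "\<And>x :: 'a ^ 'm. norm (mat_act C x) \<le> D * norm x"
    using linear_bounded_pos[OF linear_mat_act] by auto
  define D' where "D' = D * (real CARD('m) * c\<^sub>0)"
  have D': "0 \<le> D'" using D(1) c0_nonneg by (simp add: D'_def)
  have "msq M (r k) \<le> 2 * (D' / c)\<^sup>2 * (c * \<gamma>\<^sub>2 k)\<^sup>2" for k
  proof -
    have "norm (r k \<omega>) \<le> \<gamma>\<^sub>2 k * D'" for \<omega>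
    proof -
      have "norm (mat_act C (grads (X k \<omega>))) \<le> D'"
        unfolding D'_def using D(1) by (intro order_trans[OF D(2)] mult_left_mono grads_bdd) auto
      then show ?thesis
        using \<gamma>2_pos[of k] by (simp add: r_def)
    qed
    then have "msq M (r k) \<le> 2 * 0\<^sup>2 * msq M (r k) + 2 * (\<gamma>\<^sub>2 k * D')\<^sup>2"
      using D' \<gamma>2_pos[of k] by (intro msq_le_const[OF r r]) auto
    then show ?thesis using c by (simp add: power_mult_distrib power_divide mult.commute)
  qed
  then obtain B1 where B1: "\<And>k. msq M (Z k) \<le> B1"
    using second_moment_bounded by blast
  obtain B2 where B2: "\<And>k. msq M (E k) \<le> B2" using E_bounded by blast
  obtain S where S: "S > 0" "\<And>x :: 'a. norm (spread v x :: 'a ^ 'm) \<le> S * norm x"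
    using linear_bounded_pos[OF linear_spread] by auto
  have WZ: "msq M (W k) \<le> 2 * 1\<^sup>2 * msq M (Z k) + 2 * S\<^sup>2 * msq M (E k)" for k
  proof (rule msq_le[OF W_sqint Z E_sqint])
    fix \<omega>
    have "W k \<omega> = Z k \<omega> + spread v (E k \<omega>)" by (simp add: Z_def E_def proj_def)
    then show "norm (W k \<omega>) \<le> 1 * norm (Z k \<omega>) + S * norm (E k \<omega>)"
      using norm_triangle_ineq[of "Z k \<omega>" "spread v (E k \<omega>)"] S(2)[of "E k \<omega>"] by simp
  qed (use S in auto)
  have YW: "msq M (Y k) \<le> 2 * 1\<^sup>2 * msq M (W k) + 2 * (real CARD('m) * c\<^sub>0)\<^sup>2" for k
  proof (rule msq_le_const[OF Y_sqint W_sqint])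
    fix \<omega>
    show "norm (Y k \<omega>) \<le> 1 * norm (W k \<omega>) + real CARD('m) * c\<^sub>0"
      using norm_triangle_ineq[of "W k \<omega>" "grads (X k \<omega>)"] grads_bdd[of "X k \<omega>"] by (simp add: W_def)
  qed (use c0_nonneg in auto)
  have "msq M (Y k) \<le> 2 * (2 * B1 + 2 * S\<^sup>2 * B2) + 2 * (real CARD('m) * c\<^sub>0)\<^sup>2" for k
  proof -
    have "2 * S\<^sup>2 * msq M (E k) \<le> 2 * S\<^sup>2 * B2"
      by (intro mult_left_mono B2) simp
    then show ?thesis using YW[of k] WZ[of k] B1[of k] by simp
  qed
  then show ?thesis by blast
qed

section \<open>Consensus error of the states\<close>

definition Xt :: "nat \<Rightarrow> 'w \<Rightarrow> 'a ^ 'm" where "Xt k \<omega> = proj one u (X k \<omega>)"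

lemma Xt_sqint: "sqint M (F k) (Xt k)"
  unfolding Xt_def[abs_def] by (intro sqint_F X_sqint)

text \<open>The drift is \<open>lam\<close> times the projection of \<open>Y\<close>, whose second
  moments are bounded; after division by the rate it is summable by
  \<open>lam_\<gamma>1\<close>.\<close>

lemma Xt_convergence:
  shows Xt_bounded: "\<exists>B. \<forall>k. msq M (Xt k) \<le> B" and Xt_summable: "summable (\<lambda>k. \<gamma>\<^sub>1 k * msq M (Xt k))"
    and Xt_AE: "AE \<omega> in M. (\<lambda>k. Xt k \<omega>) \<longlonglongrightarrow> 0"
proof -
  define r where "r k \<omega> = - lam k *\<^sub>R proj one u (Y k \<omega>)" for k \<omega>
  have r: "sqint M (F k) (r k)" for k
    unfolding r_def[abs_def] by (intro sqint_F Y_sqint)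
  have step: "Xt (Suc k) \<omega> = 1 *\<^sub>R Xt k \<omega> + \<gamma>\<^sub>1 k *\<^sub>R mat_act R (Xt k \<omega>) + r k \<omega> + \<gamma>\<^sub>1 k *\<^sub>R proj one u (N\<^sub>1 k \<omega>)"
    if "\<omega> \<in> space M" for k \<omega>
    by (simp add: Xt_def r_def X_Suc[OF that] lin mixing_proj[OF mixR])
  have \<theta>1: "\<forall>\<^sub>F k in sequentially. 1 / 2 \<le> (1 :: real) \<and> (1 :: real) \<le> 1" by simp
  have Xt0: "wavg u (Xt k \<omega>) = 0" for k \<omega>
    by (simp add: Xt_def mixing_proj[OF mixR])
  have N: "summable (\<lambda>k. msq M (\<lambda>\<omega>. \<gamma>\<^sub>1 k *\<^sub>R proj one u (N\<^sub>1 k \<omega>)))"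
    by (rule summable_linear_noise[OF linear_proj N1 N1_sum])
  obtain P \<kappa> K c where c: "c > 0" and cp: "contracting_process M F G P \<kappa> K (\<lambda>k. c * \<gamma>\<^sub>1 k) Xt
      (\<lambda>k \<omega>. 1 *\<^sub>R Xt k \<omega> + \<gamma>\<^sub>1 k *\<^sub>R mat_act R (Xt k \<omega>)) r (\<lambda>k \<omega>. \<gamma>\<^sub>1 k *\<^sub>R proj one u (N\<^sub>1 k \<omega>))"
    by (rule mixing_contraction[where \<theta> = "\<lambda>_. 1", OF mixR \<gamma>1_pos \<gamma>1_0 \<theta>1 Xt_sqint Xt0 r
        centered_scaled_linear[OF linear_proj N1] N step]) (assumption, rule that, assumption+)
  interpret contracting_process M F G P \<kappa> K "\<lambda>k. c * \<gamma>\<^sub>1 k" Xt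
      "\<lambda>k \<omega>. 1 *\<^sub>R Xt k \<omega> + \<gamma>\<^sub>1 k *\<^sub>R mat_act R (Xt k \<omega>)" r "\<lambda>k \<omega>. \<gamma>\<^sub>1 k *\<^sub>R proj one u (N\<^sub>1 k \<omega>)"
    by (rule cp)
  obtain D where D: "D > 0" "\<And>x :: 'a ^ 'm. norm (proj one u x) \<le> D * norm x"
    using linear_bounded_pos[OF linear_proj] by auto
  obtain B where B: "\<And>k. msq M (Y k) \<le> B" using Y_bounded by blast
  have le: "msq M (r k) / (c * \<gamma>\<^sub>1 k) \<le> 2 * D\<^sup>2 * B / c * ((lam k)\<^sup>2 / \<gamma>\<^sub>1 k)" for k
  proof -
    have "msq M (r k) \<le> 2 * (lam k * D)\<^sup>2 * msq M (Y k) + 2 * 0\<^sup>2"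
    proof (rule msq_le_const[OF r Y_sqint])
      fix \<omega>
      have "lam k * norm (proj one u (Y k \<omega>)) \<le> lam k * (D * norm (Y k \<omega>))"
        by (intro mult_left_mono D lam_nonneg)
      then show "norm (r k \<omega>) \<le> lam k * D * norm (Y k \<omega>) + 0"
        using lam_nonneg[of k] by (simp add: r_def mult_ac)
    qed (use D(1) lam_nonneg in auto)
    also have "\<dots> \<le> 2 * (lam k * D)\<^sup>2 * B"
      using B[of k] by (simp add: mult_left_mono)
    finally have "msq M (r k) / (c * \<gamma>\<^sub>1 k) \<le> 2 * (lam k * D)\<^sup>2 * B / (c * \<gamma>\<^sub>1 k)"
      using c \<gamma>1_pos[of k] by (intro divide_right_mono) auto
    then show ?thesis by (simp add: power_mult_distrib mult_ac)
  qed
  have drift: "summable (\<lambda>k. msq M (r k) / (c * \<gamma>\<^sub>1 k))"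
    by (rule summable_comparison_test'[OF summable_mult[OF lam_\<gamma>1, of "2 * D\<^sup>2 * B / c"], of 0])
      (use le c \<gamma>1_pos less_imp_le in \<open>auto simp: msq_nonneg abs_of_pos\<close>)
  show "\<exists>B. \<forall>k. msq M (Xt k) \<le> B" by (rule second_moment_bounded'[OF drift])
  from summable_mult[OF summable_second_moment[OF drift], of "1 / c"] c
  show "summable (\<lambda>k. \<gamma>\<^sub>1 k * msq M (Xt k))" by simp
  show "AE \<omega> in M. (\<lambda>k. Xt k \<omega>) \<longlonglongrightarrow> 0"
    using c \<gamma>1_div by (intro AE_tendsto_zero[OF drift]) (simp add: summable_cmult_iff)
qed

text \<open>A lagged copy of the states, moving at the rate \<open>\<gamma>\<^sub>2\<close>. The increments of the gradients along the
  states are too rough for the tracking recursion (the noise in them is of order \<open>\<gamma>\<^sub>1 \<zeta>\<close> and enters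
  nonlinearly), whereas those along the copy are of order \<open>\<gamma>\<^sub>2\<close> times the lag.\<close>
primrec lagged :: "nat \<Rightarrow> 'w \<Rightarrow> 'a ^ 'm" where
  "lagged 0 = X 0"
| "lagged (Suc k) = (\<lambda>\<omega>. lagged k \<omega> + \<gamma>\<^sub>2 k *\<^sub>R (X k \<omega> - lagged k \<omega>))"

definition lag :: "nat \<Rightarrow> 'w \<Rightarrow> 'a ^ 'm" where "lag k \<omega> = X k \<omega> - lagged k \<omega>"

text \<open>The copy at \<open>Suc k\<close> is already \<open>F k\<close>-measurable, one step
  ahead of \<open>X\<close>; this makes its increments admissible as an adapted drift.\<close>

lemma lagged_sqint: "sqint M (F k) (lagged k)" and lagged_Suc_sqint: "sqint M (F k) (lagged (Suc k))"
proof -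
  show 1: "sqint M (F k) (lagged k)" for k
  proof (induction k)
    case (Suc k)
    then have "sqint M (F k) (lagged (Suc k))"
      unfolding lagged.simps by (intro sqint_F X_sqint)
    then show ?case by (rule sqint_mono[OF _ F_mono])
  qed (simp add: X0)
  show "sqint M (F k) (lagged (Suc k))"
    unfolding lagged.simps by (intro sqint_F X_sqint 1)
qed

lemma lag_sqint: "sqint M (F k) (lag k)"
  unfolding lag_def[abs_def] by (intro sqint_F X_sqint lagged_sqint)

text \<open>The noise of \<open>X\<close> enters the lag additively and so stays centered.
  \<open>mat_act R\<close> sees only the consensus error, whose moments are bounded, so the drift is
  summable over the rate by \<open>\<gamma>1_\<gamma>2\<close> and
  \<open>lam_\<gamma>2\<close>.\<close>

lemma lag_convergence:
  shows lag_summable: "summable (\<lambda>k. \<gamma>\<^sub>2 k * msq M (lag k))" and lag_AE: "AE \<omega> in M. (\<lambda>k. lag k \<omega>) \<longlonglongrightarrow> 0"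
proof -
  define r where "r k \<omega> = \<gamma>\<^sub>1 k *\<^sub>R mat_act R (Xt k \<omega>) - lam k *\<^sub>R Y k \<omega>" for k \<omega>
  obtain K where K: "\<And>k. K \<le> k \<Longrightarrow> \<gamma>\<^sub>2 k \<le> 1"
    using eventually_le_of_tendsto_zero[OF \<gamma>2_0 zero_less_one] by (auto simp: eventually_sequentially)
  have r: "sqint M (F k) (r k)" for k
    unfolding r_def[abs_def] by (intro sqint_F Xt_sqint Y_sqint)
  interpret contracting_process M F G "\<lambda>x. x" 1 K \<gamma>\<^sub>2 lag "\<lambda>k \<omega>. (1 - \<gamma>\<^sub>2 k) *\<^sub>R lag k \<omega>" r "\<lambda>k \<omega>. \<gamma>\<^sub>1 k *\<^sub>R N\<^sub>1 k \<omega>"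
  proof
    show "energy_form (\<lambda>x :: 'a ^ 'm. x) 1" by (rule energy_form_id)
    show "sqint M (F k) (lag k)" "sqint M (F k) (\<lambda>\<omega>. (1 - \<gamma>\<^sub>2 k) *\<^sub>R lag k \<omega>)" for k
      by (intro sqint_F lag_sqint)+
    show "sqint M (F k) (r k)" for k by (rule r)
    show "centered k (\<lambda>\<omega>. \<gamma>\<^sub>1 k *\<^sub>R N\<^sub>1 k \<omega>)" for k
      by (rule centered_scaled_linear[OF linear_ident N1])
    show "summable (\<lambda>k. msq M (\<lambda>\<omega>. \<gamma>\<^sub>1 k *\<^sub>R N\<^sub>1 k \<omega>))"
      by (rule summable_linear_noise[OF linear_ident N1 N1_sum])
    show "lag (Suc k) \<omega> = (1 - \<gamma>\<^sub>2 k) *\<^sub>R lag k \<omega> + r k \<omega> + \<gamma>\<^sub>1 k *\<^sub>R N\<^sub>1 k \<omega>" if "\<omega> \<in> space M" for k \<omega>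
      by (simp add: lag_def r_def X_Suc[OF that] Xt_def mixing_proj[OF mixR] algebra_simps)
    show "(1 - \<gamma>\<^sub>2 k) *\<^sub>R lag k \<omega> \<bullet> (1 - \<gamma>\<^sub>2 k) *\<^sub>R lag k \<omega> \<le> (1 - \<gamma>\<^sub>2 k) * (lag k \<omega> \<bullet> lag k \<omega>)"
      if "K \<le> k" for k \<omega>
      using K[OF that] \<gamma>2_pos[of k] by (intro inner_shrink_le) auto
  qed (use K \<gamma>2_pos in blast)
  obtain D where D: "D > 0" "\<And>x :: 'a ^ 'm. norm (mat_act R x) \<le> D * norm x"
    using linear_bounded_pos[OF linear_mat_act] by auto
  obtain B1 where B1: "\<And>k. msq M (Xt k) \<le> B1" using Xt_bounded by blast
  obtain B2 where B2: "\<And>k. msq M (Y k) \<le> B2" using Y_bounded by blast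
  have le: "msq M (r k) / \<gamma>\<^sub>2 k \<le> 2 * D\<^sup>2 * B1 * ((\<gamma>\<^sub>1 k)\<^sup>2 / \<gamma>\<^sub>2 k) + 2 * B2 * ((lam k)\<^sup>2 / \<gamma>\<^sub>2 k)" for k
  proof -
    have "msq M (r k) \<le> 2 * (\<gamma>\<^sub>1 k * D)\<^sup>2 * msq M (Xt k) + 2 * (lam k)\<^sup>2 * msq M (Y k)"
    proof (rule msq_le[OF r Xt_sqint Y_sqint])
      fix \<omega>
      have "norm (r k \<omega>) \<le> \<gamma>\<^sub>1 k * norm (mat_act R (Xt k \<omega>)) + lam k * norm (Y k \<omega>)"
        using norm_triangle_ineq4[of "\<gamma>\<^sub>1 k *\<^sub>R mat_act R (Xt k \<omega>)" "lam k *\<^sub>R Y k \<omega>"] \<gamma>1_pos[of k] lam_nonneg[of k]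
        by (simp add: r_def)
      also have "\<gamma>\<^sub>1 k * norm (mat_act R (Xt k \<omega>)) \<le> \<gamma>\<^sub>1 k * (D * norm (Xt k \<omega>))"
        using \<gamma>1_pos[of k] by (intro mult_left_mono D) auto
      finally show "norm (r k \<omega>) \<le> \<gamma>\<^sub>1 k * D * norm (Xt k \<omega>) + lam k * norm (Y k \<omega>)"
        by (simp add: mult.assoc)
    qed (use D(1) lam_nonneg \<gamma>1_pos[of k] in auto)
    also have "\<dots> \<le> 2 * (\<gamma>\<^sub>1 k * D)\<^sup>2 * B1 + 2 * (lam k)\<^sup>2 * B2"
      by (intro add_mono mult_left_mono B1 B2) auto
    finally have "msq M (r k) / \<gamma>\<^sub>2 k \<le> (2 * (\<gamma>\<^sub>1 k * D)\<^sup>2 * B1 + 2 * (lam k)\<^sup>2 * B2) / \<gamma>\<^sub>2 k"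
      using \<gamma>2_pos[of k] by (intro divide_right_mono) auto
    then show ?thesis by (simp add: power_mult_distrib mult_ac add_divide_distrib)
  qed
  have bound: "summable (\<lambda>k. 2 * D\<^sup>2 * B1 * ((\<gamma>\<^sub>1 k)\<^sup>2 / \<gamma>\<^sub>2 k) + 2 * B2 * ((lam k)\<^sup>2 / \<gamma>\<^sub>2 k))"
    by (intro summable_add summable_mult \<gamma>1_\<gamma>2 lam_\<gamma>2)
  have drift: "summable (\<lambda>k. msq M (r k) / \<gamma>\<^sub>2 k)"
    by (rule summable_comparison_test'[OF bound, of 0])
      (use le \<gamma>2_pos less_imp_le in \<open>auto simp: msq_nonneg abs_of_pos\<close>)
  show "summable (\<lambda>k. \<gamma>\<^sub>2 k * msq M (lag k))" by (rule summable_second_moment[OF drift])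
  show "AE \<omega> in M. (\<lambda>k. lag k \<omega>) \<longlonglongrightarrow> 0" by (rule AE_tendsto_zero[OF drift \<gamma>2_div])
qed

section \<open>Tracking error, by way of the gradients at the lagged states\<close>

definition Yt :: "nat \<Rightarrow> 'w \<Rightarrow> 'a ^ 'm" where "Yt k \<omega> = proj v one (Y k \<omega>)"

lemma Yt_sqint: "sqint M (F k) (Yt k)"
  unfolding Yt_def[abs_def] by (intro sqint_F Y_sqint)

text \<open>\<open>Yt\<close> with \<open>grads (X k \<omega>)\<close>, the part of \<open>Y\<close>
  beyond \<open>W\<close>, exchanged for the gradients at the lagged copy; the two differ by at most
  a multiple of the lag.\<close>

definition smooth :: "nat \<Rightarrow> 'w \<Rightarrow> 'a ^ 'm" where
  "smooth k \<omega> = proj v one (W k \<omega> + grads (lagged k \<omega>))"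

lemma smooth_sqint: "sqint M (F k) (smooth k)"
  unfolding smooth_def[abs_def] by (intro sqint_F W_sqint lagged_sqint)

lemma lagged_grads_diff: "norm (grads (X k \<omega>) - grads (lagged k \<omega>)) \<le> L * norm (lag k \<omega>)"
  unfolding lag_def by (rule grads_lip)

text \<open>The drift has gradient differences of size \<open>\<gamma>\<^sub>2\<close> times the lag
  and a decay term of size \<alpha>. Squared and divided by \<open>\<gamma>\<^sub>2\<close>, they
  are controlled by \<open>lag_summable\<close> and \<open>\<alpha>_\<gamma>2\<close>.\<close>

lemma smooth_convergence:
  shows smooth_summable: "summable (\<lambda>k. \<gamma>\<^sub>2 k * msq M (smooth k))" and smooth_AE: "AE \<omega> in M. (\<lambda>k. smooth k \<omega>) \<longlonglongrightarrow> 0"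
proof -
  define r where "r k \<omega> = proj v one (grads (lagged (Suc k) \<omega>) - (1 - \<alpha> k) *\<^sub>R grads (lagged k \<omega>))
      + \<gamma>\<^sub>2 k *\<^sub>R mat_act C (grads (X k \<omega>) - grads (lagged k \<omega>))" for k \<omega>
  have r: "sqint M (F k) (r k)" for k
    unfolding r_def[abs_def] by (intro sqint_F lagged_sqint lagged_Suc_sqint X_sqint)
  have zero: "wavg one (smooth k \<omega>) = 0" for k \<omega>
    by (simp add: smooth_def mixing_proj[OF mixC])
  have step: "smooth (Suc k) \<omega> = (1 - \<alpha> k) *\<^sub>R smooth k \<omega> + \<gamma>\<^sub>2 k *\<^sub>R mat_act C (smooth k \<omega>) + r k \<omega>
      + \<gamma>\<^sub>2 k *\<^sub>R proj v one (N\<^sub>2 k \<omega>)" if "\<omega> \<in> space M" for k \<omega>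
    by (simp add: smooth_def r_def W_Suc[OF that] lin mixing_proj[OF mixC] algebra_simps del: lagged.simps)
  obtain P \<kappa> K c where c: "c > 0" and cp: "contracting_process M F G P \<kappa> K (\<lambda>k. c * \<gamma>\<^sub>2 k) smooth
      (\<lambda>k \<omega>. (1 - \<alpha> k) *\<^sub>R smooth k \<omega> + \<gamma>\<^sub>2 k *\<^sub>R mat_act C (smooth k \<omega>)) r (\<lambda>k \<omega>. \<gamma>\<^sub>2 k *\<^sub>R proj v one (N\<^sub>2 k \<omega>))"
    by (rule mixing_contraction[OF mixC \<gamma>2_pos \<gamma>2_0 \<theta>_range smooth_sqint zero r centered_scaled_linear[OF linear_proj N2] proj_N2_sum step]) (assumption, rule that, assumption+)
  interpret contracting_process M F G P \<kappa> K "\<lambda>k. c * \<gamma>\<^sub>2 k" smooth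
      "\<lambda>k \<omega>. (1 - \<alpha> k) *\<^sub>R smooth k \<omega> + \<gamma>\<^sub>2 k *\<^sub>R mat_act C (smooth k \<omega>)" r "\<lambda>k \<omega>. \<gamma>\<^sub>2 k *\<^sub>R proj v one (N\<^sub>2 k \<omega>)"
    by (rule cp)
  obtain D1 where D1: "D1 > 0" "\<And>x :: 'a ^ 'm. norm (proj v one x) \<le> D1 * norm x"
    using linear_bounded_pos[OF linear_proj] by auto
  obtain D2 where D2: "D2 > 0" "\<And>x :: 'a ^ 'm. norm (mat_act C x) \<le> D2 * norm x"
    using linear_bounded_pos[OF linear_mat_act] by auto
  define A1 where "A1 = (D1 + D2) * L"
  define A2 where "A2 = D1 * (real CARD('m) * c\<^sub>0)"
  have A: "0 \<le> A1" "0 \<le> A2" using D1(1) D2(1) L c0_nonneg by (auto simp: A1_def A2_def)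
  have norm_r: "norm (r k \<omega>) \<le> (\<gamma>\<^sub>2 k * A1) * norm (lag k \<omega>) + \<bar>\<alpha> k\<bar> * A2" for k \<omega>
  proof -
    let ?l = "\<gamma>\<^sub>2 k * (L * norm (lag k \<omega>))"
    have "lagged (Suc k) \<omega> - lagged k \<omega> = \<gamma>\<^sub>2 k *\<^sub>R lag k \<omega>" by (simp add: lag_def)
    then have move: "norm (grads (lagged (Suc k) \<omega>) - grads (lagged k \<omega>)) \<le> ?l"
      using grads_lip[of "lagged (Suc k) \<omega>" "lagged k \<omega>"] \<gamma>2_pos[of k] by (simp add: mult_ac del: lagged.simps)
    have decay: "norm (\<alpha> k *\<^sub>R grads (lagged k \<omega>)) \<le> \<bar>\<alpha> k\<bar> * (real CARD('m) * c\<^sub>0)"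
      by (simp only: norm_scaleR) (intro mult_left_mono grads_bdd abs_ge_zero)
    have eq: "grads (lagged (Suc k) \<omega>) - (1 - \<alpha> k) *\<^sub>R grads (lagged k \<omega>)
        = (grads (lagged (Suc k) \<omega>) - grads (lagged k \<omega>)) + \<alpha> k *\<^sub>R grads (lagged k \<omega>)"
      by (simp add: algebra_simps del: lagged.simps)
    have "norm (grads (lagged (Suc k) \<omega>) - (1 - \<alpha> k) *\<^sub>R grads (lagged k \<omega>)) \<le> ?l + \<bar>\<alpha> k\<bar> * (real CARD('m) * c\<^sub>0)"
      using norm_triangle_ineq[of "grads (lagged (Suc k) \<omega>) - grads (lagged k \<omega>)" "\<alpha> k *\<^sub>R grads (lagged k \<omega>)"] move decay
      unfolding eq by linarith
    then have first: "norm (proj v one (grads (lagged (Suc k) \<omega>) - (1 - \<alpha> k) *\<^sub>R grads (lagged k \<omega>)))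
        \<le> D1 * (?l + \<bar>\<alpha> k\<bar> * (real CARD('m) * c\<^sub>0))"
      using D1(1) by (intro order_trans[OF D1(2)] mult_left_mono) auto
    have "norm (mat_act C (grads (X k \<omega>) - grads (lagged k \<omega>))) \<le> D2 * (L * norm (lag k \<omega>))"
      using D2(1) by (intro order_trans[OF D2(2)] mult_left_mono lagged_grads_diff) auto
    then have second: "norm (\<gamma>\<^sub>2 k *\<^sub>R mat_act C (grads (X k \<omega>) - grads (lagged k \<omega>))) \<le> \<gamma>\<^sub>2 k * (D2 * (L * norm (lag k \<omega>)))"
      using \<gamma>2_pos[of k] by simp
    have "norm (r k \<omega>) \<le> D1 * (?l + \<bar>\<alpha> k\<bar> * (real CARD('m) * c\<^sub>0)) + \<gamma>\<^sub>2 k * (D2 * (L * norm (lag k \<omega>)))"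
      unfolding r_def by (rule norm_triangle_le) (intro add_mono first second)
    then show ?thesis by (simp add: A1_def A2_def algebra_simps)
  qed
  have le: "msq M (r k) / (c * \<gamma>\<^sub>2 k) \<le> 2 * A1\<^sup>2 / c * (\<gamma>\<^sub>2 k * msq M (lag k)) + 2 * A2\<^sup>2 / c * ((\<alpha> k)\<^sup>2 / \<gamma>\<^sub>2 k)" for k
  proof -
    have "msq M (r k) \<le> 2 * (\<gamma>\<^sub>2 k * A1)\<^sup>2 * msq M (lag k) + 2 * (\<bar>\<alpha> k\<bar> * A2)\<^sup>2"
      using A \<gamma>2_pos[of k] by (intro msq_le_const[OF r lag_sqint] norm_r) auto
    then have "msq M (r k) / (c * \<gamma>\<^sub>2 k) \<le> (2 * (\<gamma>\<^sub>2 k * A1)\<^sup>2 * msq M (lag k) + 2 * (\<bar>\<alpha> k\<bar> * A2)\<^sup>2) / (c * \<gamma>\<^sub>2 k)"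
      using c \<gamma>2_pos[of k] by (intro divide_right_mono) auto
    also have "\<dots> = 2 * A1\<^sup>2 / c * (\<gamma>\<^sub>2 k * msq M (lag k)) + 2 * A2\<^sup>2 / c * ((\<alpha> k)\<^sup>2 / \<gamma>\<^sub>2 k)"
      using c \<gamma>2_pos[of k] by (simp add: field_simps power2_eq_square)
    finally show ?thesis .
  qed
  have bound: "summable (\<lambda>k. 2 * A1\<^sup>2 / c * (\<gamma>\<^sub>2 k * msq M (lag k)) + 2 * A2\<^sup>2 / c * ((\<alpha> k)\<^sup>2 / \<gamma>\<^sub>2 k))"
    by (intro summable_add summable_mult lag_summable \<alpha>_\<gamma>2)
  have drift: "summable (\<lambda>k. msq M (r k) / (c * \<gamma>\<^sub>2 k))"
    by (rule summable_comparison_test'[OF bound, of 0])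
      (use le c \<gamma>2_pos less_imp_le in \<open>auto simp: msq_nonneg abs_of_pos\<close>)
  from summable_mult[OF summable_second_moment[OF drift], of "1 / c"] c
  show "summable (\<lambda>k. \<gamma>\<^sub>2 k * msq M (smooth k))" by simp
  show "AE \<omega> in M. (\<lambda>k. smooth k \<omega>) \<longlonglongrightarrow> 0"
    using c \<gamma>2_div by (intro AE_tendsto_zero[OF drift]) (simp add: summable_cmult_iff)
qed

lemma Yt_le: "\<exists>D\<ge>0. \<forall>k \<omega>. norm (Yt k \<omega>) \<le> 1 * norm (smooth k \<omega>) + D * norm (lag k \<omega>)"
proof -
  obtain D where D: "D > 0" "\<And>x :: 'a ^ 'm. norm (proj v one x) \<le> D * norm x"
    using linear_bounded_pos[OF linear_proj] by auto
  have "norm (Yt k \<omega>) \<le> 1 * norm (smooth k \<omega>) + D * L * norm (lag k \<omega>)" for k \<omega>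
  proof -
    have "Yt k \<omega> = smooth k \<omega> + proj v one (grads (X k \<omega>) - grads (lagged k \<omega>))"
      by (simp add: Yt_def smooth_def W_def lin)
    moreover have "norm (proj v one (grads (X k \<omega>) - grads (lagged k \<omega>))) \<le> D * (L * norm (lag k \<omega>))"
      using D(1) by (intro order_trans[OF D(2)] mult_left_mono lagged_grads_diff) auto
    ultimately show ?thesis
      using norm_triangle_ineq[of "smooth k \<omega>" "proj v one (grads (X k \<omega>) - grads (lagged k \<omega>))"] by (simp add: mult_ac)
  qed
  then show ?thesis using D(1) L by (intro exI[of _ "D * L"]) auto
qed

lemma Yt_AE: "AE \<omega> in M. (\<lambda>k. Yt k \<omega>) \<longlonglongrightarrow> 0"
proof -
  obtain D where D: "\<And>k \<omega>. norm (Yt k \<omega>) \<le> 1 * norm (smooth k \<omega>) + D * norm (lag k \<omega>)"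
    using Yt_le by blast
  show ?thesis
    using smooth_AE lag_AE
  proof eventually_elim
    case (elim \<omega>)
    have "(\<lambda>k. 1 * norm (smooth k \<omega>) + D * norm (lag k \<omega>)) \<longlonglongrightarrow> 1 * 0 + D * 0"
      by (intro tendsto_intros tendsto_norm_zero elim)
    then show ?case
      using D by (intro Lim_null_comparison[of "\<lambda>k. Yt k \<omega>"]) auto
  qed
qed

text \<open>The natural rates are \<alpha> for \<open>E\<close>, \<open>\<gamma>\<^sub>1\<close> for
  \<open>Xt\<close>, and \<open>\<gamma>\<^sub>2\<close> for \<open>smooth\<close> and
  \<open>lag\<close>, which together dominate \<open>Yt\<close>.\<close>

lemma lam_E_summable: "summable (\<lambda>k. lam k * msq M (E k))"
  and lam_Xt_summable: "summable (\<lambda>k. lam k * msq M (Xt k))"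
  and lam_Yt_summable: "summable (\<lambda>k. lam k * msq M (Yt k))"
proof -
  show "summable (\<lambda>k. lam k * msq M (E k))"
    using lam_\<alpha> summable_lam_of_summable[OF E_summable] by blast
  show "summable (\<lambda>k. lam k * msq M (Xt k))"
    using lam_le_\<gamma>1 summable_lam_of_summable[OF Xt_summable, of 1] by simp
  obtain D where D: "D \<ge> 0" "\<And>k \<omega>. norm (Yt k \<omega>) \<le> 1 * norm (smooth k \<omega>) + D * norm (lag k \<omega>)"
    using Yt_le by blast
  have le: "msq M (Yt k) \<le> 2 * 1\<^sup>2 * msq M (smooth k) + 2 * D\<^sup>2 * msq M (lag k)" for k
    using D by (intro msq_le[OF Yt_sqint smooth_sqint lag_sqint]) auto
  have "summable (\<lambda>k. lam k * msq M (smooth k))" "summable (\<lambda>k. lam k * msq M (lag k))"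
    using lam_le_\<gamma>2 summable_lam_of_summable[OF smooth_summable, of 1] summable_lam_of_summable[OF lag_summable, of 1]
    by simp_all
  then have bound: "summable (\<lambda>k. 2 * (lam k * msq M (smooth k)) + 2 * D\<^sup>2 * (lam k * msq M (lag k)))"
    by (intro summable_add summable_mult)
  have "lam k * msq M (Yt k) \<le> 2 * (lam k * msq M (smooth k)) + 2 * D\<^sup>2 * (lam k * msq M (lag k))" for k
    using mult_left_mono[OF le lam_nonneg, of k] by (simp add: algebra_simps)
  then show "summable (\<lambda>k. lam k * msq M (Yt k))"
    by (intro summable_comparison_test'[OF bound, of 0]) (auto simp: msq_nonneg lam_nonneg)
qed

lemma AE_summable_lam:
  fixes Z :: "nat \<Rightarrow> 'w \<Rightarrow> 'b::euclidean_space"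
  assumes "\<And>k. sqint M (F k) (Z k)" "summable (\<lambda>k. lam k * msq M (Z k))"
  shows "AE \<omega> in M. summable (\<lambda>k. lam k * (norm (Z k \<omega>))\<^sup>2)"
  by (rule AE_summable_of_summable_integral) (use assms lam_nonneg sqintD(2)[OF assms(1)] in auto)

end

subsection \<open>Descent of the objective\<close>

text \<open>The mean value theorem on the segment from \<open>a\<close> to \<open>b\<close> gives
  the constant \<open>L\<close> in place of the sharp \<open>L / 2\<close>, which is good enough for
  summability arguments.\<close>

lemma descent_inequality:
  fixes f :: "'a::euclidean_space \<Rightarrow> real"
  assumes grad: "\<And>x. GDERIV f x :> h x" and lip: "\<And>x y. norm (h x - h y) \<le> L * norm (x - y)" and L: "0 \<le> L"
  shows "f b \<le> f a + h a \<bullet> (b - a) + L * (norm (b - a))\<^sup>2"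
proof -
  define p where "p t = a + t *\<^sub>R (b - a)" for t :: real
  have p: "(p has_derivative (\<lambda>t. t *\<^sub>R (b - a))) (at t)" for t
    unfolding p_def by (auto intro!: derivative_eq_intros)
  have "((\<lambda>t. f (p t)) has_derivative (\<lambda>t. (t *\<^sub>R (b - a)) \<bullet> h (p t'))) (at t')" for t'
    using has_derivative_compose[OF p grad[of "p t'", unfolded gderiv_def]] .
  then have "((\<lambda>t. f (p t)) has_real_derivative ((b - a) \<bullet> h (p t'))) (at t')" for t'
    by (simp add: has_field_derivative_def mult_commute_abs)
  then obtain t where t: "0 < t" "t < 1" "f (p 1) - f (p 0) = (1 - 0) * ((b - a) \<bullet> h (p t))"
    using MVT2[of 0 1 "\<lambda>t. f (p t)" "\<lambda>t. (b - a) \<bullet> h (p t)"] by auto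
  have "f b - f a = h a \<bullet> (b - a) + (h (p t) - h a) \<bullet> (b - a)"
    using t(3) by (simp add: p_def inner_diff_left inner_diff_right inner_commute)
  also have "(h (p t) - h a) \<bullet> (b - a) \<le> norm (h (p t) - h a) * norm (b - a)"
    by (rule norm_cauchy_schwarz)
  also have "\<dots> \<le> (L * norm (b - a)) * norm (b - a)"
  proof (intro mult_right_mono norm_ge_zero)
    have "norm (h (p t) - h a) \<le> L * (t * norm (b - a))"
      using lip[of "p t" a] t(1) by (simp add: p_def)
    also have "\<dots> \<le> L * norm (b - a)"
      using t L by (intro mult_left_mono mult_left_le_one_le) auto
    finally show "norm (h (p t) - h a) \<le> L * norm (b - a)" .
  qed
  finally show ?thesis by (simp add: power2_eq_square)
qed

context tracking_process
begin

definition mean_grad :: "'a \<Rightarrow> 'a" where "mean_grad x = wavg one (grads (spread one x))"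

lemma mean_grad_eq: "mean_grad x = (1 / real CARD('m)) *\<^sub>R (\<Sum>i\<in>UNIV. g i x)"
  by (simp add: mean_grad_def wavg_def grads_def spread_def one_def)

lemma norm_wavg_one_le: "(\<And>i. norm (z $ i) \<le> c) \<Longrightarrow> norm (wavg one z) \<le> c"
  for z :: "'a ^ 'm"
proof -
  assume c: "\<And>i. norm (z $ i) \<le> c"
  have "norm (\<Sum>i\<in>UNIV. z $ i) \<le> real CARD('m) * c"
    using sum_norm_le[of UNIV "\<lambda>i. z $ i" "\<lambda>_. c"] c by simp
  then show "norm (wavg one z) \<le> c"
    by (simp add: wavg_def one_def field_simps)
qed

lemma mean_grad_lip: "norm (mean_grad x - mean_grad y) \<le> L * norm (x - y)"
  unfolding mean_grad_def lin(2)[symmetric]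
  by (rule norm_wavg_one_le) (simp add: grads_def spread_def one_def lip)

lemma mean_grad_bdd: "norm (mean_grad x) \<le> c\<^sub>0"
  unfolding mean_grad_def by (rule norm_wavg_one_le) (simp add: grads_def bdd)

definition xbar :: "nat \<Rightarrow> 'w \<Rightarrow> 'a" where "xbar k \<omega> = wavg u (X k \<omega>)"

lemma xbar_sqint: "sqint M (F k) (xbar k)"
  unfolding xbar_def[abs_def] by (intro sqint_F X_sqint)

lemma mean_grad_sqint: "sqint M (F k) (\<lambda>\<omega>. mean_grad (xbar k \<omega>))"
  unfolding mean_grad_def by (intro sqint_F xbar_sqint)

text \<open>The factor with which the tracked average survives: the trackers align with
  \<open>v\<close>, whereas the states are averaged with the weights \<open>u\<close>.\<close>

definition \<eta> :: real where "\<eta> = (\<Sum>i\<in>UNIV. u $ i * v $ i) / real CARD('m)"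

lemma wavg_u_spread_v: "wavg u (spread v x) = \<eta> *\<^sub>R x"
  by (simp add: wavg_def spread_def \<eta>_def flip: scaleR_sum_left)

definition direction_error :: "nat \<Rightarrow> 'w \<Rightarrow> 'a" where
  "direction_error k \<omega> = wavg u (Y k \<omega>) - \<eta> *\<^sub>R mean_grad (xbar k \<omega>)"

text \<open>Three sources of error: the tracking error, the error \<open>E\<close> of the tracked
  average, and the disagreement of the states at which gradients are taken. The square of each is
  summable against \<open>lam\<close>.\<close>

lemma AE_direction_error: "AE \<omega> in M. summable (\<lambda>k. lam k * (norm (direction_error k \<omega>))\<^sup>2)"
proof -
  obtain D1 where D1: "D1 > 0" "\<And>x :: 'a ^ 'm. norm (wavg u x) \<le> D1 * norm x"
    using linear_bounded_pos[OF linear_wavg] by auto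
  obtain D2 where D2: "D2 > 0" "\<And>x :: 'a ^ 'm. norm (wavg one x) \<le> D2 * norm x"
    using linear_bounded_pos[OF linear_wavg] by auto
  define A where "A = D2 * L"
  have bound: "norm (direction_error k \<omega>) \<le> D1 * norm (Yt k \<omega>) + \<bar>\<eta>\<bar> * (norm (E k \<omega>) + A * norm (Xt k \<omega>))" for k \<omega>
  proof -
    let ?d = "grads (X k \<omega>) - grads (spread one (xbar k \<omega>))"
    have Y1: "Y k \<omega> = Yt k \<omega> + spread v (wavg one (Y k \<omega>))"
      by (simp add: Yt_def proj_def)
    \<comment> \<open>The tracked average is \<open>E\<close> plus the average gradient at the
      actual states; moving all of them to the averaged state costs a Lipschitz multiple of
      \<open>Xt\<close>.\<close>
    have Y2: "wavg one (Y k \<omega>) = E k \<omega> + wavg one ?d + mean_grad (xbar k \<omega>)"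
      by (simp add: E_def W_def mean_grad_def lin)
    have "direction_error k \<omega> = wavg u (Yt k \<omega>) + \<eta> *\<^sub>R (E k \<omega> + wavg one ?d)"
      unfolding direction_error_def by (subst Y1, subst Y2) (simp add: lin wavg_u_spread_v scaleR_add_right)
    moreover have "norm (wavg one ?d) \<le> A * norm (Xt k \<omega>)"
    proof -
      have "norm ?d \<le> L * norm (Xt k \<omega>)"
        using grads_lip[of "X k \<omega>" "spread one (xbar k \<omega>)"] by (simp add: Xt_def proj_def xbar_def)
      then have "D2 * norm ?d \<le> D2 * (L * norm (Xt k \<omega>))"
        using D2(1) by (intro mult_left_mono) auto
      then show ?thesis using D2(2)[of ?d] by (simp add: A_def mult.assoc)
    qed
    then have "norm (E k \<omega> + wavg one ?d) \<le> norm (E k \<omega>) + A * norm (Xt k \<omega>)"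
      by (intro norm_triangle_le) simp
    then have "\<bar>\<eta>\<bar> * norm (E k \<omega> + wavg one ?d) \<le> \<bar>\<eta>\<bar> * (norm (E k \<omega>) + A * norm (Xt k \<omega>))"
      by (intro mult_left_mono) auto
    ultimately show ?thesis
      using norm_triangle_ineq[of "wavg u (Yt k \<omega>)" "\<eta> *\<^sub>R (E k \<omega> + wavg one ?d)"] D1(2)[of "Yt k \<omega>"] by simp
  qed
  have sq: "(norm (direction_error k \<omega>))\<^sup>2
      \<le> 2 * D1\<^sup>2 * (norm (Yt k \<omega>))\<^sup>2 + (4 * \<eta>\<^sup>2 * (norm (E k \<omega>))\<^sup>2 + 4 * \<eta>\<^sup>2 * A\<^sup>2 * (norm (Xt k \<omega>))\<^sup>2)" for k \<omega>
  proof -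
    let ?y = "D1 * norm (Yt k \<omega>)" and ?e = "\<bar>\<eta>\<bar> * norm (E k \<omega>)" and ?x = "\<bar>\<eta>\<bar> * (A * norm (Xt k \<omega>))"
    have "(norm (direction_error k \<omega>))\<^sup>2 \<le> (?y + (?e + ?x))\<^sup>2"
      by (rule power_mono) (use bound[of k \<omega>] in \<open>simp_all add: distrib_left\<close>)
    also have "\<dots> \<le> 2 * ?y\<^sup>2 + 2 * (?e + ?x)\<^sup>2"
      using norm_add_sq_le[of ?y "?e + ?x"] by simp
    also have "(?e + ?x)\<^sup>2 \<le> 2 * ?e\<^sup>2 + 2 * ?x\<^sup>2"
      using norm_add_sq_le[of ?e ?x] by simp
    finally show ?thesis by (simp add: power_mult_distrib)
  qed
  show ?thesis
    using AE_summable_lam[OF Yt_sqint lam_Yt_summable] AE_summable_lam[OF E_sqint lam_E_summable]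
      AE_summable_lam[OF Xt_sqint lam_Xt_summable]
  proof eventually_elim
    case (elim \<omega>)
    have s: "summable (\<lambda>k. 2 * D1\<^sup>2 * (lam k * (norm (Yt k \<omega>))\<^sup>2) + (4 * \<eta>\<^sup>2 * (lam k * (norm (E k \<omega>))\<^sup>2)
        + 4 * \<eta>\<^sup>2 * A\<^sup>2 * (lam k * (norm (Xt k \<omega>))\<^sup>2)))"
      by (intro summable_add summable_mult elim)
    show ?case
    proof (rule summable_comparison_test'[OF s, of 0])
      fix k
      show "norm (lam k * (norm (direction_error k \<omega>))\<^sup>2) \<le> 2 * D1\<^sup>2 * (lam k * (norm (Yt k \<omega>))\<^sup>2)
          + (4 * \<eta>\<^sup>2 * (lam k * (norm (E k \<omega>))\<^sup>2) + 4 * \<eta>\<^sup>2 * A\<^sup>2 * (lam k * (norm (Xt k \<omega>))\<^sup>2))"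
        using mult_left_mono[OF sq[of k \<omega>] lam_nonneg[of k]] lam_nonneg[of k] by (simp add: algebra_simps)
    qed
  qed
qed

text \<open>The second moments of \<open>Y\<close> are bounded, and \<open>lam_\<gamma>1\<close>
  covers the squares of \<open>lam\<close> because \<open>\<gamma>\<^sub>1\<close> is eventually at
  most 1.\<close>

lemma AE_step_sq: "AE \<omega> in M. summable (\<lambda>k. (lam k)\<^sup>2 * (norm (wavg u (Y k \<omega>)))\<^sup>2)"
proof (rule AE_summable_of_summable_integral)
  obtain D where D: "D > 0" "\<And>x :: 'a ^ 'm. norm (wavg u x) \<le> D * norm x"
    using linear_bounded_pos[OF linear_wavg] by auto
  obtain B where B: "\<And>k. msq M (Y k) \<le> B" using Y_bounded by blast
  have wY: "sqint M (F k) (\<lambda>\<omega>. wavg u (Y k \<omega>))" for k by (intro sqint_F Y_sqint)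
  then show "integrable M (\<lambda>\<omega>. (lam k)\<^sup>2 * (norm (wavg u (Y k \<omega>)))\<^sup>2)" for k
    using sqintD(2)[OF wY] by simp
  have le: "msq M (\<lambda>\<omega>. wavg u (Y k \<omega>)) \<le> 2 * D\<^sup>2 * B" for k
  proof -
    have "msq M (\<lambda>\<omega>. wavg u (Y k \<omega>)) \<le> 2 * D\<^sup>2 * msq M (Y k) + 2 * 0\<^sup>2"
      using D by (intro msq_le_const[OF wY Y_sqint]) auto
    also have "\<dots> \<le> 2 * D\<^sup>2 * B" using mult_left_mono[OF B, of "2 * D\<^sup>2" k] by simp
    finally show ?thesis .
  qed
  have "\<forall>\<^sub>F k in sequentially. norm ((lam k)\<^sup>2 * msq M (\<lambda>\<omega>. wavg u (Y k \<omega>))) \<le> 2 * D\<^sup>2 * B * ((lam k)\<^sup>2 / \<gamma>\<^sub>1 k)"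
    using eventually_le_of_tendsto_zero[OF \<gamma>1_0 zero_less_one]
  proof eventually_elim
    case (elim k)
    have "(lam k)\<^sup>2 * msq M (\<lambda>\<omega>. wavg u (Y k \<omega>)) \<le> ((lam k)\<^sup>2 / \<gamma>\<^sub>1 k) * (2 * D\<^sup>2 * B)"
    proof (intro mult_mono le msq_nonneg)
      show "(lam k)\<^sup>2 \<le> (lam k)\<^sup>2 / \<gamma>\<^sub>1 k"
        using elim \<gamma>1_pos[of k] by (simp add: field_simps mult_left_le_one_le)
      show "0 \<le> (lam k)\<^sup>2 / \<gamma>\<^sub>1 k" using \<gamma>1_pos[of k] by simp
    qed
    then show ?case by (simp add: msq_nonneg mult_ac)
  qed
  then have "summable (\<lambda>k. (lam k)\<^sup>2 * msq M (\<lambda>\<omega>. wavg u (Y k \<omega>)))"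
    by (rule summable_comparison_test_ev) (intro summable_mult lam_\<gamma>1)
  then show "summable (\<lambda>k. LINT \<omega>|M. (lam k)\<^sup>2 * (norm (wavg u (Y k \<omega>)))\<^sup>2)" by simp
qed simp

text \<open>The averaged state loses its mixing term because \<open>u\<close> is a left null vector,
  and the noise enters it linearly. The inner product of that noise with the bounded gradient is
  therefore a martingale difference of summable variance; all other error terms of the descent
  inequality are summable.\<close>

lemma objective_convergence:
  assumes grad: "\<And>x. GDERIV f x :> mean_grad x" and lower: "\<And>x. l \<le> f x" and \<eta>: "\<eta> > 0"
  shows "AE \<omega> in M. convergent (\<lambda>k. f (xbar k \<omega>)) \<and> summable (\<lambda>k. lam k * (norm (mean_grad (xbar k \<omega>)))\<^sup>2)"
proof -
  define n where "n k \<omega> = \<gamma>\<^sub>1 k *\<^sub>R wavg u (N\<^sub>1 k \<omega>)" for k \<omega>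
  have n: "centered k (n k)" for k
    unfolding n_def[abs_def] by (rule centered_scaled_linear[OF linear_wavg N1])
  have n_sum: "summable (\<lambda>k. msq M (n k))"
    unfolding n_def[abs_def] by (rule summable_linear_noise[OF linear_wavg N1 N1_sum])
  have n_int: "integrable M (\<lambda>\<omega>. (norm (n k \<omega>))\<^sup>2)" for k
    using n by (simp add: centered_def sqint_def)
  have AE_n: "AE \<omega> in M. summable (\<lambda>k. (norm (n k \<omega>))\<^sup>2)"
    by (rule AE_summable_of_summable_integral[OF _ n_int n_sum]) simp
  have cross: "summable (\<lambda>k. LINT \<omega>|M. (mean_grad (xbar k \<omega>) \<bullet> n k \<omega>)\<^sup>2)"
  proof (rule summable_comparison_test'[OF summable_mult[OF n_sum, of "2 * c\<^sub>0\<^sup>2"], of 0])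
    fix k
    have "msq M (\<lambda>\<omega>. mean_grad (xbar k \<omega>)) \<le> 2 * 0\<^sup>2 * msq M (\<lambda>\<omega>. mean_grad (xbar k \<omega>)) + 2 * c\<^sub>0\<^sup>2"
      by (intro msq_le_const[OF mean_grad_sqint mean_grad_sqint]) (auto simp: mean_grad_bdd c0_nonneg)
    then have "msq M (\<lambda>\<omega>. mean_grad (xbar k \<omega>)) * msq M (n k) \<le> 2 * c\<^sub>0\<^sup>2 * msq M (n k)"
      by (intro mult_right_mono msq_nonneg) simp
    then show "norm (LINT \<omega>|M. (mean_grad (xbar k \<omega>) \<bullet> n k \<omega>)\<^sup>2) \<le> 2 * c\<^sub>0\<^sup>2 * msq M (n k)"
      using inner_centered_sq(2)[OF mean_grad_sqint n, of k] by simp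
  qed
  have AE_cross: "AE \<omega> in M. summable (\<lambda>k. mean_grad (xbar k \<omega>) \<bullet> n k \<omega>)"
    by (rule martingale_summable[OF martingale_diff_inner[OF mean_grad_sqint n] cross])
  show ?thesis
    using AE_direction_error AE_step_sq AE_n AE_cross AE_space
  proof eventually_elim
    case (elim \<omega>)
    let ?g = "\<lambda>k. mean_grad (xbar k \<omega>)" and ?h = "\<lambda>k. direction_error k \<omega>"
    define a where "a k = 1 / (2 * \<eta>) * (lam k * (norm (?h k))\<^sup>2) + ?g k \<bullet> n k \<omega>
        + (2 * L) * (norm (n k \<omega>))\<^sup>2 + (2 * L) * ((lam k)\<^sup>2 * (norm (wavg u (Y k \<omega>)))\<^sup>2)" for k
    define d where "d k = \<eta> / 2 * (lam k * (norm (?g k))\<^sup>2)" for k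
    have a: "summable a"
      unfolding a_def by (intro summable_add summable_mult elim)
    have d: "0 \<le> d k" for k
      using \<eta> lam_nonneg by (simp add: d_def)
    have step: "f (xbar (Suc k) \<omega>) - l \<le> (f (xbar k \<omega>) - l) - d k + a k" for k
    proof -
      let ?y = "wavg u (Y k \<omega>)"
      have \<Delta>: "xbar (Suc k) \<omega> - xbar k \<omega> = n k \<omega> - lam k *\<^sub>R ?y"
        by (simp add: xbar_def n_def X_Suc[OF elim(5)] lin mixing_wavg_mat_act[OF mixR])
      have y: "?y = \<eta> *\<^sub>R ?g k + ?h k" by (simp add: direction_error_def)
      \<comment> \<open>Completing the square with weight \<eta> sacrifices half of the decrease and
        charges the rest to the direction error.\<close>
      have "- (?g k \<bullet> ?h k) \<le> \<eta> / 2 * (norm (?g k))\<^sup>2 + 1 / (2 * \<eta>) * (norm (?h k))\<^sup>2"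
      proof -
        have "0 \<le> (norm (\<eta> *\<^sub>R ?g k + ?h k))\<^sup>2 / (2 * \<eta>)" using \<eta> by simp
        also have "\<dots> = \<eta> / 2 * (norm (?g k))\<^sup>2 + ?g k \<bullet> ?h k + 1 / (2 * \<eta>) * (norm (?h k))\<^sup>2"
          using \<eta> by (simp add: power2_norm_eq_inner inner_add_left inner_add_right inner_commute field_simps)
        finally show ?thesis by simp
      qed
      then have "- (?g k \<bullet> ?y) \<le> - (\<eta> / 2) * (norm (?g k))\<^sup>2 + 1 / (2 * \<eta>) * (norm (?h k))\<^sup>2"
        unfolding y by (simp add: inner_add_right power2_norm_eq_inner)
      from mult_left_mono[OF this lam_nonneg[of k]]
      have lin_part: "- (lam k * (?g k \<bullet> ?y)) \<le> - d k + 1 / (2 * \<eta>) * (lam k * (norm (?h k))\<^sup>2)"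
        by (simp add: d_def algebra_simps)
      have "(norm (n k \<omega> - lam k *\<^sub>R ?y))\<^sup>2 \<le> 2 * (norm (n k \<omega>))\<^sup>2 + 2 * ((lam k)\<^sup>2 * (norm ?y)\<^sup>2)"
        using norm_add_sq_le[of "n k \<omega>" "- lam k *\<^sub>R ?y"] by (simp add: power_mult_distrib)
      from mult_left_mono[OF this L]
      have quad: "L * (norm (n k \<omega> - lam k *\<^sub>R ?y))\<^sup>2 \<le> 2 * L * (norm (n k \<omega>))\<^sup>2 + 2 * L * ((lam k)\<^sup>2 * (norm ?y)\<^sup>2)"
        by (simp add: algebra_simps)
      have "f (xbar (Suc k) \<omega>) \<le> f (xbar k \<omega>) + ?g k \<bullet> (n k \<omega> - lam k *\<^sub>R ?y) + L * (norm (n k \<omega> - lam k *\<^sub>R ?y))\<^sup>2"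
        using descent_inequality[OF grad mean_grad_lip L, of "xbar (Suc k) \<omega>" "xbar k \<omega>"] unfolding \<Delta> .
      then show ?thesis
        using lin_part quad unfolding a_def by (simp add: inner_diff_right)
    qed
    have "convergent (\<lambda>k. f (xbar k \<omega>) - l)"
      by (rule almost_decreasing_converges(1)[where K = 0, OF _ d step a]) (simp add: lower)
    from convergent_add[OF this convergent_const[of l]] have "convergent (\<lambda>k. f (xbar k \<omega>))" by simp
    moreover have "summable d"
      by (rule almost_decreasing_converges(2)[where K = 0, OF _ d step a]) (simp add: lower)
    from summable_mult[OF this, of "2 / \<eta>"] \<eta> have "summable (\<lambda>k. lam k * (norm (?g k))\<^sup>2)"
      by (simp add: d_def)
    ultimately show ?case by blast
  qed
qed

end

subsection \<open>Convergence to the minimum\<close>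

text \<open>On the line through \<open>p\<close> and \<open>q\<close> the function is convex with
  derivative 0 at \<open>p\<close>, so its horizontal tangent lies below it.\<close>

lemma convex_critical_point_minimal:
  fixes f :: "'a::euclidean_space \<Rightarrow> real"
  assumes conv: "convex_on UNIV f" and grad: "GDERIV f p :> 0"
  shows "f p \<le> f q"
proof -
  let ?\<phi> = "\<lambda>t. f (p + t *\<^sub>R (q - p))"
  have "convex_on UNIV ?\<phi>"
  proof (rule convex_onI)
    fix t x y :: real assume t: "0 < t" "t < 1"
    have "p + ((1 - t) *\<^sub>R x + t *\<^sub>R y) *\<^sub>R (q - p) = (1 - t) *\<^sub>R (p + x *\<^sub>R (q - p)) + t *\<^sub>R (p + y *\<^sub>R (q - p))"
      by (simp add: algebra_simps)
    then show "?\<phi> ((1 - t) *\<^sub>R x + t *\<^sub>R y) \<le> (1 - t) * ?\<phi> x + t * ?\<phi> y"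
      using convex_onD[OF conv, of t "p + x *\<^sub>R (q - p)" "p + y *\<^sub>R (q - p)"] t by simp
  qed simp
  moreover have "((\<lambda>t. p + t *\<^sub>R (q - p)) has_derivative (\<lambda>t. t *\<^sub>R (q - p))) (at 0)"
    by (auto intro!: derivative_eq_intros)
  from has_derivative_compose[OF this, of f "\<lambda>h. h \<bullet> 0"] grad
  have "(?\<phi> has_real_derivative 0) (at 0)"
    by (simp add: gderiv_def has_field_derivative_def lambda_zero)
  ultimately have "?\<phi> 1 - ?\<phi> 0 \<ge> 0 * (1 - 0)"
    by (intro convex_on_imp_above_tangent[of UNIV ?\<phi> 0 1 0]) auto
  then show ?thesis by simp
qed

text \<open>Small gradients are known only along a subsequence. Compactness gives it a critical
  limit point, which by convexity is a minimiser, and convergence of the values carries its value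
  over to the whole sequence.\<close>

lemma convergence_to_minimum:
  fixes f :: "'a::euclidean_space \<Rightarrow> real" and z :: "nat \<Rightarrow> 'a"
  assumes conv: "convex_on UNIV f" and grad: "\<And>x. GDERIV f x :> h x" and cont: "continuous_on UNIV h"
    and lim: "convergent (\<lambda>k. f (z k))" and small: "\<And>e. e > 0 \<Longrightarrow> \<exists>\<^sub>F k in sequentially. norm (h (z k)) < e"
    and level: "\<And>c. bounded {x. f x \<le> c}"
  shows "bounded (range z)" "\<exists>p. (\<forall>x. f p \<le> f x) \<and> (\<lambda>k. f (z k)) \<longlonglongrightarrow> f p"
proof -
  have isCont_f: "isCont f x" for x
    using grad[of x] unfolding gderiv_def by (rule has_derivative_continuous)
  obtain B where "\<And>k. \<bar>f (z k)\<bar> \<le> B"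
    using convergent_imp_Bseq[OF lim] by (auto simp: Bseq_def)
  then have "range z \<subseteq> {x. f x \<le> B}"
    by (auto simp: abs_le_iff)
  then show bounded: "bounded (range z)"
    using level bounded_subset by blast
  have "\<exists>k\<ge>n. norm (h (z k)) < 1 / real (Suc n)" for n
    using small[of "1 / real (Suc n)"] unfolding frequently_sequentially by simp
  \<comment> \<open>\<open>s\<close> need not be increasing; \<open>n \<le> s n\<close> is what
    makes \<open>s (r n)\<close> tend to infinity.\<close>
  then obtain s where s: "\<And>n. n \<le> s n" "\<And>n. norm (h (z (s n))) < 1 / real (Suc n)"
    by metis
  have "bounded (range (z \<circ> s))"
    by (rule bounded_subset[OF bounded]) auto
  then obtain r p where r: "strict_mono r" and p: "((z \<circ> s) \<circ> r) \<longlonglongrightarrow> p"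
    using bounded_imp_convergent_subsequence by blast
  have sr: "filterlim (\<lambda>n. s (r n)) at_top sequentially"
    by (rule filterlim_at_top_mono[OF filterlim_ident])
      (use order_trans[OF seq_suble[OF r] s(1)] in simp)
  have "(\<lambda>n. h (z (s n))) \<longlonglongrightarrow> 0"
    by (rule Lim_null_comparison[OF _ LIMSEQ_inverse_real_of_nat])
      (use s(2) less_imp_le in \<open>auto intro!: always_eventually simp: inverse_eq_divide\<close>)
  then have "(\<lambda>n. h (z (s (r n)))) \<longlonglongrightarrow> 0"
    using LIMSEQ_subseq_LIMSEQ[OF _ r] by (auto simp: comp_def)
  moreover have "(\<lambda>n. h (z (s (r n)))) \<longlonglongrightarrow> h p"
    using p cont by (intro isCont_tendsto_compose[of p h]) (auto simp: comp_def continuous_on_eq_continuous_at)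
  ultimately have "h p = 0" using LIMSEQ_unique by blast
  then have min: "f p \<le> f x" for x
    using convex_critical_point_minimal[OF conv] grad[of p] by simp
  obtain l where l: "(\<lambda>k. f (z k)) \<longlonglongrightarrow> l" using lim by (auto simp: convergent_def)
  have "(\<lambda>n. f (z (s (r n)))) \<longlonglongrightarrow> l"
    by (rule filterlim_compose[OF l sr])
  moreover have "(\<lambda>n. f (z (s (r n)))) \<longlonglongrightarrow> f p"
    using p isCont_f by (intro isCont_tendsto_compose[of p f]) (auto simp: comp_def)
  ultimately have "l = f p" using LIMSEQ_unique by blast
  then show "\<exists>p. (\<forall>x. f p \<le> f x) \<and> (\<lambda>k. f (z k)) \<longlonglongrightarrow> f p" using l min by blast
qed

lemma liminf_eq_0_of_frequently_small:
  fixes a :: "nat \<Rightarrow> real"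
  assumes "\<And>k. 0 \<le> a k" and small: "\<And>e. e > 0 \<Longrightarrow> \<exists>\<^sub>F k in sequentially. a k < e"
  shows "liminf (\<lambda>k. ereal (a k)) = 0"
proof (rule antisym)
  show "0 \<le> liminf (\<lambda>k. ereal (a k))"
    by (rule Liminf_bounded) (simp add: assms(1))
  show "liminf (\<lambda>k. ereal (a k)) \<le> 0"
  proof (rule ccontr)
    assume "\<not> ?thesis"
    then have "0 < liminf (\<lambda>k. ereal (a k))" by simp
    then obtain r where r: "0 < ereal r" "ereal r < liminf (\<lambda>k. ereal (a k))"
      using ereal_dense2 by blast
    from less_LiminfD[OF r(2)] have "\<forall>\<^sub>F k in sequentially. r < a k" by simp
    then have "\<forall>\<^sub>F k in sequentially. \<not> a k < r" by (rule eventually_mono) simp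
    then show False using small[of r] r(1) by (simp add: frequently_def)
  qed
qed

section \<open>From the single agents to stacked vectors\<close>

lemma linear_axis: "linear (\<lambda>x :: 'a::real_vector. axis j x)"
  by (rule linearI) (simp_all add: vec_eq_iff axis_def)

lemma vec_lambda_eq_sum_axis: "(\<chi> j. n j) = (\<Sum>j\<in>UNIV. axis j (n j))"
  for n :: "'m::finite \<Rightarrow> 'a::real_vector"
  by (simp add: vec_eq_iff axis_def if_distrib cong: if_cong)

lemma sqint_vec:
  fixes n :: "'m::finite \<Rightarrow> 'w \<Rightarrow> 'a::euclidean_space"
  assumes "\<And>j. sqint M N (n j)" "subalgebra M N"
  shows "sqint M N (\<lambda>\<omega>. \<chi> j. n j \<omega>)"
proof -
  have "sqint M N (\<lambda>\<omega>. \<Sum>j\<in>J. axis j (n j \<omega>) :: 'a ^ 'm)" if "finite J" for J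
    using that
  proof induction
    case empty
    show ?case by (simp add: sqint_def)
  next
    case (insert j J)
    then show ?case
      using sqint_add[OF sqint_linear[OF assms(1,2) linear_axis] insert.IH assms(2)] by simp
  qed
  then show ?thesis unfolding vec_lambda_eq_sum_axis by simp
qed

lemma (in noise_filtration) centered_vec:
  fixes n :: "'m::finite \<Rightarrow> 'w \<Rightarrow> 'b::euclidean_space"
  assumes "\<And>j. centered k (n j)"
  shows "centered k (\<lambda>\<omega>. \<chi> j. n j \<omega>)"
proof -
  have ax: "centered k (\<lambda>\<omega>. axis j (n j \<omega>) :: 'b ^ 'm)" for j
    by (rule centered_linear[OF assms linear_axis])
  then have "(LINT \<omega>|M. (\<Sum>j\<in>UNIV. axis j (n j \<omega>) :: 'b ^ 'm)) = 0"
    using sqint_integrable[OF _ G_sub_M] by (subst Bochner_Integration.integral_sum) (auto simp: centered_def)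
  then have "(LINT \<omega>|M. (\<chi> j. n j \<omega>)) = 0"
    unfolding vec_lambda_eq_sum_axis .
  moreover have "sqint M (G k) (\<lambda>\<omega>. \<chi> j. n j \<omega>)"
    using assms by (intro sqint_vec G_sub_M) (auto simp: centered_def)
  ultimately show ?thesis by (simp add: centered_def)
qed

lemma norm_vec_sq: "(norm z)\<^sup>2 = (\<Sum>i\<in>UNIV. (norm (z $ i))\<^sup>2)"
  unfolding norm_vec_def L2_set_def by (simp add: sum_nonneg)

text \<open>Nonnegative entries outside the neighbour set vanish, so the neighbour sum and the
  diagonal term make up the full row.\<close>

lemma sum_nbrs:
  fixes A :: "real ^ 'm ^ 'm" and h :: "'m::finite \<Rightarrow> 'a::real_vector"
  assumes "\<And>j. i \<noteq> j \<Longrightarrow> 0 \<le> A $ i $ j"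
  shows "A $ i $ i *\<^sub>R h i + (\<Sum>j\<in>in_nbrs A i. A $ i $ j *\<^sub>R h j) = (\<Sum>j\<in>UNIV. A $ i $ j *\<^sub>R h j)"
proof -
  have "(\<Sum>j\<in>in_nbrs A i. A $ i $ j *\<^sub>R h j) = (\<Sum>j\<in>UNIV - {i}. A $ i $ j *\<^sub>R h j)"
  proof (rule sum.mono_neutral_left)
    show "\<forall>j\<in>UNIV - {i} - in_nbrs A i. A $ i $ j *\<^sub>R h j = 0"
      using assms by (force simp: in_nbrs_def)
  qed (auto simp: in_nbrs_def)
  then show ?thesis
    by (simp add: sum.remove[of UNIV i])
qed

text \<open>An agent reads its own state without noise, so the diagonal has no part in the noise
  term.\<close>

definition off_diag :: "real ^ 'm ^ 'm \<Rightarrow> real ^ 'm ^ 'm" where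
  "off_diag A = (\<chi> i j. if j \<in> in_nbrs A i then A $ i $ j else 0)"

lemma mat_act_off_diag: "mat_act (off_diag A) z $ i = (\<Sum>j\<in>in_nbrs A i. A $ i $ j *\<^sub>R z $ j)"
  by (simp add: mat_act_nth off_diag_def if_distrib[of "\<lambda>c. c *\<^sub>R _"] sum.If_cases cong: if_cong)

lemma (in noise_filtration) off_diag_noise:
  fixes \<zeta> :: "'m::finite \<Rightarrow> nat \<Rightarrow> 'w \<Rightarrow> 'b::euclidean_space"
  assumes "\<And>i k. \<zeta> i k \<in> borel_measurable (G k)" "\<And>i k. integrable M (\<lambda>\<omega>. (norm (\<zeta> i k \<omega>))\<^sup>2)"
    "\<And>i k. (LINT \<omega>|M. \<zeta> i k \<omega>) = 0"
    and sum: "summable (\<lambda>k. (\<gamma> k)\<^sup>2 * (MAX i. LINT \<omega>|M. (norm (\<zeta> i k \<omega>))\<^sup>2))"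
  shows "centered k (\<lambda>\<omega>. mat_act (off_diag A) (\<chi> j. \<zeta> j k \<omega>))"
    and "summable (\<lambda>k. (\<gamma> k)\<^sup>2 * msq M (\<lambda>\<omega>. mat_act (off_diag A) (\<chi> j. \<zeta> j k \<omega>)))"
proof -
  have "centered k (\<zeta> j k)" for j k
    using assms(1-3) by (simp add: centered_def sqint_def)
  then have n: "centered k (\<lambda>\<omega>. \<chi> j. \<zeta> j k \<omega>)" for k
    by (rule centered_vec)
  show "centered k (\<lambda>\<omega>. mat_act (off_diag A) (\<chi> j. \<zeta> j k \<omega>))"
    by (rule centered_linear[OF n linear_mat_act])
  have le: "msq M (\<lambda>\<omega>. \<chi> j. \<zeta> j k \<omega>) \<le> real CARD('m) * (MAX i. LINT \<omega>|M. (norm (\<zeta> i k \<omega>))\<^sup>2)" for k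
  proof -
    have "msq M (\<lambda>\<omega>. \<chi> j. \<zeta> j k \<omega>) = (\<Sum>j\<in>UNIV. msq M (\<zeta> j k))"
      unfolding norm_vec_sq using assms(2) by simp
    also have "\<dots> \<le> real CARD('m) * (MAX i. LINT \<omega>|M. (norm (\<zeta> i k \<omega>))\<^sup>2)"
      by (rule sum_bounded_above) simp
    finally show ?thesis .
  qed
  have "(\<gamma> k)\<^sup>2 * msq M (\<lambda>\<omega>. \<chi> j. \<zeta> j k \<omega>) \<le> real CARD('m) * ((\<gamma> k)\<^sup>2 * (MAX i. LINT \<omega>|M. (norm (\<zeta> i k \<omega>))\<^sup>2))" for k
    using mult_left_mono[OF le[of k], of "(\<gamma> k)\<^sup>2"] by (simp add: mult_ac)
  then have "summable (\<lambda>k. (\<gamma> k)\<^sup>2 * msq M (\<lambda>\<omega>. \<chi> j. \<zeta> j k \<omega>))"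
    by (intro summable_comparison_test'[OF summable_mult[OF sum, of "real CARD('m)"], of 0]) (simp add: msq_nonneg)
  from summable_linear_noise[OF linear_mat_act[of "off_diag A"] n this]
  show "summable (\<lambda>k. (\<gamma> k)\<^sup>2 * msq M (\<lambda>\<omega>. mat_act (off_diag A) (\<chi> j. \<zeta> j k \<omega>)))"
    by (simp add: power_mult_distrib)
qed

lemma GDERIV_avg_obj:
  fixes f :: "'m::finite \<Rightarrow> 'a::euclidean_space \<Rightarrow> real"
  assumes "\<And>i. f i differentiable (at x)"
  shows "GDERIV (avg_obj f) x :> (1 / real CARD('m)) *\<^sub>R (\<Sum>i\<in>UNIV. gradient (f i) x)"
proof -
  have "(f i has_derivative (\<lambda>h. h \<bullet> gradient (f i) x)) (at x)" for i
    using GDERIV_gradient[OF assms[of i]] by (simp add: gderiv_def)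
  then have "((\<lambda>x. (1 / real CARD('m)) * (\<Sum>i\<in>UNIV. f i x)) has_derivative
      (\<lambda>h. (1 / real CARD('m)) * (\<Sum>i\<in>UNIV. h \<bullet> gradient (f i) x))) (at x)"
    by (intro has_derivative_mult_right has_derivative_sum)
  then show ?thesis
    by (simp add: gderiv_def avg_obj_def[abs_def] inner_sum_right)
qed

theorem theorem3:
  fixes M :: "'w measure"
    and f :: "'m::finite \<Rightarrow> real ^ 'd \<Rightarrow> real"
    and R C :: "real ^ 'm ^ 'm"
    and u v :: "real ^ 'm"
    and \<gamma>\<^sub>1 \<gamma>\<^sub>2 \<alpha> lam :: "nat \<Rightarrow> real"
    and \<zeta> \<xi> x y :: "'m \<Rightarrow> nat \<Rightarrow> 'w \<Rightarrow> real ^ 'd"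
    and L C\<^sub>0 :: real
  defines "F \<equiv> avg_obj f"
  assumes "prob_space M"
    \<comment> \<open>objective functions\<close>
    and "\<And>i \<theta>. f i differentiable (at \<theta>)"
    and "\<exists>\<theta>. \<forall>\<theta>'. F \<theta> \<le> F \<theta>'"
    and "convex_on UNIV F"
    and "L > 0"
    and "\<And>i a b. norm (gradient (f i) a - gradient (f i) b) \<le> L * norm (a - b)"
    and "\<And>i a. l1_norm (gradient (f i) a) \<le> C\<^sub>0"
    \<comment> \<open>interaction matrices\<close>
    and "\<And>i j. i \<noteq> j \<Longrightarrow> R $ i $ j \<ge> 0"
    and "\<And>i j. i \<noteq> j \<Longrightarrow> C $ i $ j \<ge> 0"
    and "\<And>i. R $ i $ i = - (\<Sum>j\<in>in_nbrs R i. R $ i $ j)"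
    and "\<And>i. C $ i $ i = - (\<Sum>j\<in>out_nbrs C i. C $ j $ i)"
    and "spanning_tree_roots (induced_graph R) \<noteq> {}"
    and "spanning_tree_roots (induced_graph (transpose C)) \<noteq> {}"
    and "spanning_tree_roots (induced_graph R) \<inter> spanning_tree_roots (induced_graph (transpose C)) \<noteq> {}"
    and "\<And>i. u $ i \<ge> 0" and "u v* R = 0" and "(\<Sum>i\<in>UNIV. u $ i) = real CARD('m)"
    and "\<And>i. v $ i \<ge> 0" and "C *v v = 0" and "(\<Sum>i\<in>UNIV. v $ i) = real CARD('m)"
    \<comment> \<open>noises and initial states\<close>
    and "\<And>i. x i 0 \<in> borel_measurable M"
    and "independent_noise M (\<lambda>i. x i 0) \<zeta> \<xi>"
    and "\<And>i k. integrable M (\<lambda>\<omega>. (norm (\<zeta> i k \<omega>))\<^sup>2)" and "\<And>i k. (LINT \<omega>|M. \<zeta> i k \<omega>) = 0"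
    and "\<And>i k. integrable M (\<lambda>\<omega>. (norm (\<xi> i k \<omega>))\<^sup>2)" and "\<And>i k. (LINT \<omega>|M. \<xi> i k \<omega>) = 0"
    and "summable (\<lambda>k. (\<gamma>\<^sub>1 k)\<^sup>2 * (MAX i. LINT \<omega>|M. (norm (\<zeta> i k \<omega>))\<^sup>2))"
    and "summable (\<lambda>k. (\<gamma>\<^sub>2 k)\<^sup>2 * (MAX j. LINT \<omega>|M. (norm (\<xi> j k \<omega>))\<^sup>2))"
    and "\<And>i. integrable M (\<lambda>\<omega>. (norm (x i 0 \<omega>))\<^sup>2)"
    \<comment> \<open>stepsizes and weakening factors\<close>
    and "\<And>k. \<gamma>\<^sub>1 k > 0" and "\<And>k. \<gamma>\<^sub>2 k > 0"
    and "\<And>k i. 1 + \<gamma>\<^sub>1 k * R $ i $ i > 0" and "\<And>k i. 1 + \<gamma>\<^sub>2 k * C $ i $ i > 0"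
    and "\<And>k. \<alpha> k \<ge> 0" and "\<And>k. lam k \<ge> 0"
    and "\<forall>\<gamma>\<in>{\<gamma>\<^sub>1, \<gamma>\<^sub>2}. series_diverges \<gamma> \<and> summable (\<lambda>k. (\<gamma> k)\<^sup>2) \<and>
           summable (\<lambda>k. (lam k)\<^sup>2 / \<gamma> k) \<and> (\<lambda>k. lam k / \<gamma> k) \<longlonglongrightarrow> 0"
    and "series_diverges \<alpha>" and "series_diverges lam"
      \<comment> \<open>eventual positivity of \<open>\<alpha>\<close> makes the quotient in the next assumption meaningful\<close>
    and "\<forall>\<^sub>F k in sequentially. \<alpha> k > 0" and "convergent (\<lambda>k. lam k / \<alpha> k)"
    and "summable (\<lambda>k. (\<alpha> k)\<^sup>2 / \<gamma>\<^sub>2 k)"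
    and "summable (\<lambda>k. (\<gamma>\<^sub>1 k)\<^sup>2 / \<gamma>\<^sub>2 k)"
    \<comment> \<open>iterates\<close>
    and "\<And>\<omega>. \<omega> \<in> space M \<Longrightarrow>
           gradient_tracking f R C \<gamma>\<^sub>1 \<gamma>\<^sub>2 \<alpha> lam
             (\<lambda>i k. \<zeta> i k \<omega>) (\<lambda>i k. \<xi> i k \<omega>) (\<lambda>i k. x i k \<omega>) (\<lambda>i k. y i k \<omega>)"
  shows
    "((AE \<omega> in M. convergent (\<lambda>k. F (x_avg u x k \<omega>))) \<and>
      (AE \<omega> in M. \<forall>i.
         (\<lambda>k. norm (x i k \<omega> - x_avg u x k \<omega>)) \<longlonglongrightarrow> 0 \<and>
         (\<lambda>k. norm (y i k \<omega> - (v $ i) *\<^sub>R y_avg y k \<omega>)) \<longlonglongrightarrow> 0)) \<and>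
     ((AE \<omega> in M. liminf (\<lambda>k. ereal (norm (gradient F (x_avg u x k \<omega>)))) = 0) \<and>
      ((\<forall>c. bounded {\<theta>. F \<theta> \<le> c}) \<longrightarrow>
        (AE \<omega> in M.
           bounded (range (\<lambda>k. x_avg u x k \<omega>)) \<and>
           (\<forall>r p. strict_mono r \<and> ((\<lambda>k. x_avg u x k \<omega>) \<circ> r) \<longlonglongrightarrow> p \<longrightarrow> (\<forall>\<theta>. F p \<le> F \<theta>)) \<and>
           (\<forall>i. (\<lambda>k. F (x i k \<omega>)) \<longlonglongrightarrow> (INF \<theta>. F \<theta>)))))"
proof -
  interpret prob_space M by fact
  let ?one = "\<chi> i. 1 :: real ^ 'm"
  let ?g = "\<lambda>i. gradient (f i)"
  define X where "X k \<omega> = (\<chi> i. x i k \<omega>)" for k \<omega>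
  define Y where "Y k \<omega> = (\<chi> i. y i k \<omega>)" for k \<omega>
  define N1 where "N1 k \<omega> = mat_act (off_diag R) (\<chi> j. \<zeta> j k \<omega>)" for k \<omega>
  define N2 where "N2 k \<omega> = mat_act (off_diag C) (\<chi> j. \<xi> j k \<omega>)" for k \<omega>
  have N1_nth: "N1 k \<omega> $ i = (\<Sum>j\<in>in_nbrs R i. R $ i $ j *\<^sub>R \<zeta> j k \<omega>)"
    and N2_nth: "N2 k \<omega> $ i = (\<Sum>j\<in>in_nbrs C i. C $ i $ j *\<^sub>R \<xi> j k \<omega>)" for k \<omega> i
    by (simp_all add: N1_def N2_def mat_act_off_diag)
  obtain r where r: "r \<in> spanning_tree_roots (induced_graph R)" "r \<in> spanning_tree_roots (induced_graph (transpose C))"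
    using assms(15) by blast
  have "(\<Sum>j\<in>UNIV. R $ i $ j) = 0" for i
    using sum_nbrs[of i R "\<lambda>_. 1 :: real"] assms(9,11) by simp
  note R_mix = row_laplacian_mixing[OF assms(9) this r(1) assms(16-18)]
  \<comment> \<open>The column Laplacian \<open>C\<close> is treated as the row Laplacian
    \<open>transpose C\<close>, for which in- and out-neighbours change places.\<close>
  have offT: "i \<noteq> j \<Longrightarrow> 0 \<le> transpose C $ i $ j" for i j
    using assms(10)[of j i] by (simp add: transpose_def)
  have "in_nbrs (transpose C) i = out_nbrs C i" for i
    by (simp add: in_nbrs_def out_nbrs_def transpose_def)
  then have rowsT: "(\<Sum>j\<in>UNIV. transpose C $ i $ j) = 0" for i
    using sum_nbrs[of i "transpose C" "\<lambda>_. 1 :: real", OF offT] assms(12)[of i] by (simp add: transpose_def)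
  have "v v* transpose C = 0"
    using assms(20) by (simp add: vector_transpose_matrix)
  note C_mix = row_laplacian_mixing[OF offT rowsT r(2) assms(19) this assms(21)]
  obtain F' G where filtr: "noise_filtration M F' G" and x0: "\<And>i. x i 0 \<in> borel_measurable (F' 0)"
    and noise: "\<And>i k. \<zeta> i k \<in> borel_measurable (G k)" "\<And>i k. \<xi> i k \<in> borel_measurable (G k)"
    using noise_filtration_of_independent_noise[OF assms(2,23,22)] by blast
  interpret N: noise_filtration M F' G by fact
  have steps: "x i (Suc k) \<omega> = (1 + \<gamma>\<^sub>1 k * R $ i $ i) *\<^sub>R x i k \<omega>
        + \<gamma>\<^sub>1 k *\<^sub>R (\<Sum>j\<in>in_nbrs R i. (R $ i $ j) *\<^sub>R (x j k \<omega> + \<zeta> j k \<omega>)) - lam k *\<^sub>R y i k \<omega>"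
      "y i (Suc k) \<omega> = (1 - \<alpha> k + \<gamma>\<^sub>2 k * C $ i $ i) *\<^sub>R y i k \<omega>
        + \<gamma>\<^sub>2 k *\<^sub>R (\<Sum>j\<in>in_nbrs C i. (C $ i $ j) *\<^sub>R (y j k \<omega> + \<xi> j k \<omega>))
        + ?g i (x i (Suc k) \<omega>) - (1 - \<alpha> k) *\<^sub>R ?g i (x i k \<omega>)"
      "y i 0 \<omega> = ?g i (x i 0 \<omega>)" if "\<omega> \<in> space M" for \<omega> i k
    using assms(44)[OF that] unfolding gradient_tracking_def by blast+
  interpret T: tracking_process M F' G R C u v \<gamma>\<^sub>1 \<gamma>\<^sub>2 \<alpha> lam ?g L C\<^sub>0 X Y N1 N2 "\<chi> i. 1" "\<lambda>z. \<chi> i. ?g i (z $ i)"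
  proof unfold_locales
    show "mixing R (\<chi> i. 1) u" by (rule R_mix)
    show "mixing C v (\<chi> i. 1)" using mixing_transpose[OF C_mix(1)] by simp
    show "0 \<le> L" using assms(6) by simp
    show "norm (?g i p - ?g i q) \<le> L * norm (p - q)" for i p q by (rule assms(7))
    show "norm (?g i p) \<le> C\<^sub>0" for i p
      using order_trans[OF norm_le_l1_cart assms(8)[of i p, unfolded l1_norm_def]] .
    show "\<not> summable \<gamma>\<^sub>1" "\<not> summable \<gamma>\<^sub>2"
      using assms(37) by (simp_all add: series_diverges_not_summable)
    show "summable (\<lambda>k. (\<gamma>\<^sub>1 k)\<^sup>2)" "summable (\<lambda>k. (\<gamma>\<^sub>2 k)\<^sup>2)" "summable (\<lambda>k. (lam k)\<^sup>2 / \<gamma>\<^sub>1 k)"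
      "summable (\<lambda>k. (lam k)\<^sup>2 / \<gamma>\<^sub>2 k)" "(\<lambda>k. lam k / \<gamma>\<^sub>1 k) \<longlonglongrightarrow> 0" "(\<lambda>k. lam k / \<gamma>\<^sub>2 k) \<longlonglongrightarrow> 0"
      using assms(37) by simp_all
    \<comment> \<open>Convergence of the quotient enters through its boundedness; eventual
      positivity of \<alpha> then allows the denominator to be cleared.\<close>
    obtain B where B: "\<And>k. norm (lam k / \<alpha> k) \<le> B"
      using convergent_imp_Bseq[OF assms(41)] BseqE by metis
    show "\<exists>B. \<forall>\<^sub>F k in sequentially. lam k \<le> B * \<alpha> k"
    proof (intro exI[of _ B] eventually_mono[OF assms(40)])
      fix k assume "0 < \<alpha> k"
      then show "lam k \<le> B * \<alpha> k"
        using B[of k] assms(36)[of k] by (simp add: pos_divide_le_eq)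
    qed
    show "N.centered k (N1 k)" "N.centered k (N2 k)" for k
      unfolding N1_def[abs_def] N2_def[abs_def]
      by (rule N.off_diag_noise(1)[OF noise(1) assms(24,25,28)] N.off_diag_noise(1)[OF noise(2) assms(26,27,29)])+
    show "summable (\<lambda>k. (\<gamma>\<^sub>1 k)\<^sup>2 * msq M (N1 k))" "summable (\<lambda>k. (\<gamma>\<^sub>2 k)\<^sup>2 * msq M (N2 k))"
      unfolding N1_def[abs_def] N2_def[abs_def]
      by (rule N.off_diag_noise(2)[OF noise(1) assms(24,25,28)] N.off_diag_noise(2)[OF noise(2) assms(26,27,29)])+
    show "sqint M (F' 0) (X 0)"
      unfolding X_def[abs_def] using x0 assms(30) by (intro sqint_vec N.F_sub) (simp add: sqint_def)
    fix \<omega> k assume \<omega>: "\<omega> \<in> space M"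
    show "Y 0 \<omega> = (\<chi> i. ?g i (X 0 \<omega> $ i))"
      by (simp add: X_def Y_def steps(3)[OF \<omega>])
    have "X (Suc k) \<omega> $ i = (X k \<omega> + \<gamma>\<^sub>1 k *\<^sub>R mat_act R (X k \<omega>) + \<gamma>\<^sub>1 k *\<^sub>R N1 k \<omega> - lam k *\<^sub>R Y k \<omega>) $ i" for i
      by (simp add: X_def Y_def N1_nth steps(1)[OF \<omega>] mat_act_nth
          sum_nbrs[OF assms(9), symmetric] scaleR_add_right scaleR_add_left sum.distrib)
    then show "X (Suc k) \<omega> = X k \<omega> + \<gamma>\<^sub>1 k *\<^sub>R mat_act R (X k \<omega>) + \<gamma>\<^sub>1 k *\<^sub>R N1 k \<omega> - lam k *\<^sub>R Y k \<omega>"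
      by (simp only: vec_eq_iff) simp
    have "Y (Suc k) \<omega> $ i = ((1 - \<alpha> k) *\<^sub>R Y k \<omega> + \<gamma>\<^sub>2 k *\<^sub>R mat_act C (Y k \<omega>) + \<gamma>\<^sub>2 k *\<^sub>R N2 k \<omega>
        + (\<chi> i. ?g i (X (Suc k) \<omega> $ i)) - (1 - \<alpha> k) *\<^sub>R (\<chi> i. ?g i (X k \<omega> $ i))) $ i" for i
      by (simp add: X_def Y_def N2_nth steps(2)[OF \<omega>] mat_act_nth
          sum_nbrs[OF assms(10), symmetric] scaleR_add_right scaleR_add_left sum.distrib)
    then show "Y (Suc k) \<omega> = (1 - \<alpha> k) *\<^sub>R Y k \<omega> + \<gamma>\<^sub>2 k *\<^sub>R mat_act C (Y k \<omega>) + \<gamma>\<^sub>2 k *\<^sub>R N2 k \<omega>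
        + (\<chi> i. ?g i (X (Suc k) \<omega> $ i)) - (1 - \<alpha> k) *\<^sub>R (\<chi> i. ?g i (X k \<omega> $ i))"
      by (simp only: vec_eq_iff) simp
  qed (use assms(31,32,36,40,42,43) in auto)
  have xbar: "x_avg u x k \<omega> = T.xbar k \<omega>" for k \<omega>
    by (simp add: x_avg_def T.xbar_def wavg_def X_def)
  have x_dev: "x i k \<omega> - x_avg u x k \<omega> = T.Xt k \<omega> $ i" for i k \<omega>
    by (simp add: xbar T.xbar_def T.Xt_def proj_def spread_def X_def)
  have y_dev: "y i k \<omega> - (v $ i) *\<^sub>R y_avg y k \<omega> = T.Yt k \<omega> $ i" for i k \<omega>
    by (simp add: y_avg_def T.Yt_def proj_def spread_def wavg_def Y_def)
  have vec_limit: "(\<lambda>k. norm (z k $ i)) \<longlonglongrightarrow> 0" if "z \<longlonglongrightarrow> 0" for z :: "nat \<Rightarrow> (real ^ 'd) ^ 'm" and i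
    using tendsto_norm[OF tendsto_vec_nth[OF that, of i]] by simp
  have gradF: "GDERIV F \<theta> :> T.mean_grad \<theta>" for \<theta>
    unfolding F_def T.mean_grad_eq by (intro GDERIV_avg_obj assms(3))
  obtain \<theta>\<^sub>0 where opt: "\<And>\<theta>. F \<theta>\<^sub>0 \<le> F \<theta>" using assms(4) by blast
  \<comment> \<open>The common root carries positive weight in both null vectors, which makes the
    averaged step a descent step.\<close>
  have "0 < u $ r * v $ r" using R_mix(2) C_mix(2) by simp
  also have "\<dots> \<le> (\<Sum>i\<in>UNIV. u $ i * v $ i)"
    by (rule member_le_sum) (auto simp: assms(16,19))
  finally have "T.\<eta> > 0" by (simp add: T.\<eta>_def)
  note main = T.objective_convergence[OF gradF opt this]
  have lam_div: "\<not> summable lam" using assms(39) by (rule series_diverges_not_summable)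
  have small: "\<exists>\<^sub>F k in sequentially. norm (T.mean_grad (T.xbar k \<omega>)) < e"
    if "summable (\<lambda>k. lam k * (norm (T.mean_grad (T.xbar k \<omega>)))\<^sup>2)" "e > 0" for \<omega> e
    by (rule frequently_small_of_weighted_summable[OF assms(36) norm_ge_zero that(1) lam_div that(2)])
  have cont_grad: "continuous_on UNIV T.mean_grad"
    by (rule lipschitz_on_continuous_on[of L]) (intro lipschitz_onI; use T.mean_grad_lip assms(6) in \<open>simp add: dist_norm\<close>)
  have cont_F: "isCont F \<theta>" for \<theta>
    using gradF[of \<theta>] unfolding gderiv_def by (rule has_derivative_continuous)
  show ?thesis
  proof (intro conjI impI)
    show "AE \<omega> in M. convergent (\<lambda>k. F (x_avg u x k \<omega>))"
      using main unfolding xbar by (rule AE_mp) simp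
    show "AE \<omega> in M. \<forall>i. (\<lambda>k. norm (x i k \<omega> - x_avg u x k \<omega>)) \<longlonglongrightarrow> 0 \<and>
         (\<lambda>k. norm (y i k \<omega> - (v $ i) *\<^sub>R y_avg y k \<omega>)) \<longlonglongrightarrow> 0"
      unfolding x_dev y_dev using T.Xt_AE T.Yt_AE by eventually_elim (use vec_limit in blast)
    show "AE \<omega> in M. liminf (\<lambda>k. ereal (norm (gradient F (x_avg u x k \<omega>)))) = 0"
      using main
    proof eventually_elim
      case (elim \<omega>)
      show ?case
        unfolding xbar gradient_eqI[OF gradF]
        by (rule liminf_eq_0_of_frequently_small) (use small elim in auto)
    qed
    assume level: "\<forall>c. bounded {\<theta>. F \<theta> \<le> c}"
    show "AE \<omega> in M. bounded (range (\<lambda>k. x_avg u x k \<omega>)) \<and>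
           (\<forall>r p. strict_mono r \<and> ((\<lambda>k. x_avg u x k \<omega>) \<circ> r) \<longlonglongrightarrow> p \<longrightarrow> (\<forall>\<theta>. F p \<le> F \<theta>)) \<and>
           (\<forall>i. (\<lambda>k. F (x i k \<omega>)) \<longlonglongrightarrow> (INF \<theta>. F \<theta>))"
      using main T.Xt_AE
    proof eventually_elim
      case (elim \<omega>)
      let ?z = "\<lambda>k. x_avg u x k \<omega>"
      have conv: "convergent (\<lambda>k. F (?z k))"
        and freq: "\<And>e. e > 0 \<Longrightarrow> \<exists>\<^sub>F k in sequentially. norm (T.mean_grad (?z k)) < e"
        using elim(1) small unfolding xbar by auto
      note min = convergence_to_minimum[OF assms(5) gradF cont_grad conv freq level[rule_format]]
      obtain p where p: "\<And>\<theta>. F p \<le> F \<theta>" and lim: "(\<lambda>k. F (?z k)) \<longlonglongrightarrow> F p"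
        using min(2) by blast
      have Inf: "(INF \<theta>. F \<theta>) = F p"
        by (rule cInf_eq_minimum) (auto simp: p)
      \<comment> \<open>By continuity every accumulation point has the limiting value, which is
        already the minimum; it need not come from the indices with small gradients.\<close>
      have acc: "F q \<le> F \<theta>" if "strict_mono s" "(?z \<circ> s) \<longlonglongrightarrow> q" for s q \<theta>
      proof -
        have "(\<lambda>k. F ((?z \<circ> s) k)) \<longlonglongrightarrow> F q"
          by (rule isCont_tendsto_compose[OF cont_F that(2)])
        moreover have "(\<lambda>k. F ((?z \<circ> s) k)) \<longlonglongrightarrow> F p"
          using LIMSEQ_subseq_LIMSEQ[OF lim that(1)] by (simp add: comp_def)
        ultimately have "F q = F p" by (rule LIMSEQ_unique)
        then show ?thesis using p by simp
      qed
      have "(\<lambda>k. F (x i k \<omega>)) \<longlonglongrightarrow> F p" for i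
      proof -
        let ?d = "\<lambda>k. norm (x i k \<omega> - ?z k)"
        have d: "?d \<longlonglongrightarrow> 0"
          unfolding x_dev by (rule vec_limit[OF elim(2)])
        \<comment> \<open>A modulus of continuity uniform over the whole space, thanks to bounded
          and Lipschitz gradients. It transfers the limit from the averaged state to each agent,
          whose distance to it vanishes.\<close>
        have "F a - F b \<le> C\<^sub>0 * norm (a - b) + L * (norm (a - b))\<^sup>2" for a b
        proof -
          have "T.mean_grad b \<bullet> (a - b) \<le> C\<^sub>0 * norm (a - b)"
            by (rule order_trans[OF norm_cauchy_schwarz]) (intro mult_right_mono T.mean_grad_bdd norm_ge_zero)
          then show ?thesis
            using descent_inequality[OF gradF T.mean_grad_lip less_imp_le[OF assms(6)], of a b] by simp
        qed
        then have "norm (F (x i k \<omega>) - F (?z k)) \<le> C\<^sub>0 * ?d k + L * (?d k)\<^sup>2" for k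
          by (metis abs_le_iff minus_diff_eq norm_minus_commute real_norm_def)
        moreover have "(\<lambda>k. C\<^sub>0 * ?d k + L * (?d k)\<^sup>2) \<longlonglongrightarrow> C\<^sub>0 * 0 + L * 0\<^sup>2"
          by (intro tendsto_intros d)
        ultimately have "(\<lambda>k. F (x i k \<omega>) - F (?z k)) \<longlonglongrightarrow> 0"
          by (intro Lim_null_comparison[of "\<lambda>k. F (x i k \<omega>) - F (?z k)"]) auto
        from tendsto_add[OF this lim] show ?thesis by simp
      qed
      then show ?case
        using min(1) acc by (auto simp: Inf)
    qed
  qed
qed

end
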